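(* For each integer $d \geq 2$ there exists a constant $C_d$ (depending only on $d$) such that the following holds. Let $p \in [0,1]$ be fixed with $p > 1 - \frac{1}{8(d-1)}$ and put $q = 1-p$. Then for $Q \sim P_2(d,m,p)$ the expected number of facets $\mathbb{E}(f_{d-1}(Q))$ is, asymptotically as $m \to \infty$, at most \[\left(1 + F(d)\,p^d q\left(1 + \frac{C_d\, q}{1 - 8(d-1)q}\right)\right) m.\]
   Context: Model $P_1(d,m)$: $P$ is the convex hull of $m$ independent uniformly random points on the unit sphere $S^{d-1} \subset \mathbb{R}^d$. Its dual is $P^{\circ} = \{y \in \mathbb{R}^d : \langle x, y\rangle \leq 1 \text{ for all } x \in P\}$. Model $\mathcal{B}(P', p)$ for a polytope $P'$: include each vertex of $P'$ independently with probability $p$ and take the convex hull of the included vertices. Model $P_2(d,m,p)$: $Q \sim \mathcal{B}(P^{\circ}, p)$ where $P \sim P_1(d,m)$. $F(d)$ denotes the constant $F(d) = \lim_{m\to\infty} \mathbb{E}(f_{d-1}(P))/m$ for $P \sim P_1(d,m)$ (this limit exists and equals $\frac{2}{d}\gamma_{(d-1)^2}\gamma_{d-1}^{-(d-1)}$, where $\gamma_0 = 1/2$ and $\gamma_{k+1} = \frac{1}{2\pi(k+1)\gamma_k}$). $f_{d-1}$ denotes the number of facets. *)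

theory Defs
  imports "HOL-Probability.Probability"
begin

text \<open>
  The uniform distribution on the unit sphere: the radial projection of a uniformly random point
  of the unit ball. This is the normalised surface measure (the origin is a null set).
\<close>

definition uniform_sphere :: "'a::euclidean_space measure" where
  "uniform_sphere = distr (uniform_measure lborel (ball 0 1)) borel (\<lambda>x. x /\<^sub>R norm x)"

lemma prob_space_uniform_sphere: "prob_space (uniform_sphere :: 'a::euclidean_space measure)"
proof -
  have "emeasure lborel (ball 0 1 :: 'a set) \<noteq> 0"
    using unit_ball_vol_pos[of "real DIM('a)", THEN less_imp_neq] by (simp add: emeasure_ball del: unit_ball_vol_pos)
  moreover have "emeasure lborel (ball 0 1 :: 'a set) \<noteq> \<infinity>"
    using emeasure_bounded_finite[of "ball 0 1 :: 'a set"] by simp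
  ultimately interpret prob_space "uniform_measure lborel (ball 0 1 :: 'a set)"
    by (rule prob_space_uniform_measure)
  show ?thesis
    unfolding uniform_sphere_def by (rule prob_space_distr) measurable
qed

lemma AE_uniform_sphere: "AE x in uniform_sphere. (x :: 'a::euclidean_space) \<in> sphere 0 1"
proof -
  have "AE x in lborel. (x :: 'a) \<noteq> 0"
    by (rule AE_lborel_singleton)
  then have "AE x in uniform_measure lborel (ball 0 1 :: 'a set). x /\<^sub>R norm x \<in> sphere 0 1"
    by (intro AE_uniform_measureI) auto
  then show ?thesis
    unfolding uniform_sphere_def by (subst AE_distr_iff) auto
qed

definition sphere_sample :: "nat \<Rightarrow> (nat \<Rightarrow> 'a::euclidean_space) measure" where
  "sphere_sample m = PiM {..<m} (\<lambda>_. uniform_sphere)"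

definition sample_hull :: "nat \<Rightarrow> (nat \<Rightarrow> 'a::euclidean_space) \<Rightarrow> 'a set" where
  "sample_hull m X = convex hull (X ` {..<m})"

definition dual_polytope :: "'a::euclidean_space set \<Rightarrow> 'a set" where
  "dual_polytope P = {y. \<forall>x\<in>P. x \<bullet> y \<le> 1}"

definition vertices :: "'a::euclidean_space set \<Rightarrow> 'a set" where
  "vertices K = {v. v extreme_point_of K}"

definition num_facets :: "'a::euclidean_space set \<Rightarrow> nat" where
  "num_facets K = card {F. F facet_of K}"

text \<open>
  The model \<open>\<B>(K, p)\<close>. It is also defined when \<open>K\<close> is an unbounded polyhedron, which still has
  finitely many vertices. This is needed because the dual of a sample hull is bounded only if the
  origin is an interior point of that hull.
\<close>

definition vertex_subset_hull :: "'a::euclidean_space set \<Rightarrow> real \<Rightarrow> 'a set pmf" where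
  "vertex_subset_hull K p =
     map_pmf (\<lambda>b. convex hull {v \<in> vertices K. b v})
       (Pi_pmf (vertices K) False (\<lambda>_. bernoulli_pmf p))"

text \<open>The ambient space is passed as a type argument in the following three constants.\<close>

definition expected_facets_P1 :: "'a::euclidean_space itself \<Rightarrow> nat \<Rightarrow> real" where
  "expected_facets_P1 _ m =
     (\<integral>X. real (num_facets (sample_hull m (X :: nat \<Rightarrow> 'a))) \<partial>sphere_sample m)"

definition facet_constant :: "'a::euclidean_space itself \<Rightarrow> real" where
  "facet_constant T = lim (\<lambda>m. expected_facets_P1 T m / real m)"

text \<open>
  The two-stage experiment: the inner expectation is over the vertex selection for a fixed sample,
  the outer one is over the sample.
\<close>

definition expected_facets_P2 :: "'a::euclidean_space itself \<Rightarrow> nat \<Rightarrow> real \<Rightarrow> real" where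
  "expected_facets_P2 _ m p =
     (\<integral>X. measure_pmf.expectation
             (vertex_subset_hull (dual_polytope (sample_hull m (X :: nat \<Rightarrow> 'a))) p)
             (\<lambda>Q. real (num_facets Q))
        \<partial>sphere_sample m)"

end

theory Submission
  imports Defs
begin

text \<open>
  The dual \<open>P\<degree>\<close> is a simple polytope except on an event of exponentially small probability.
  Let \<open>H\<close> be the hyperplane of a facet of \<open>Q\<close>. At most \<open>m\<close> of these contain a facet of \<open>P\<degree>\<close>. If \<open>H\<close>
  is not one of them, then the vertices of \<open>P\<degree>\<close> beyond \<open>H\<close> form a nonempty
  connected set \<open>S\<close> in the graph of \<open>P\<degree>\<close>, all of them were discarded, and \<open>d\<close> affinely
  independent kept vertices on \<open>H\<close> are neighbours of \<open>S\<close>. A singleton \<open>S\<close> yields at most one facet,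
  with probability \<open>p\<^sup>d q\<close>. Site percolation shows that at most \<open>4 (4 (d - 1))\<^sup>k\<close> connected sets of
  size \<open>k\<close> contain a given vertex, so the sets with \<open>k \<ge> 2\<close> contribute a geometric series in
  \<open>8 (d - 1) q\<close>. Selections with a lower-dimensional hull are exponentially unlikely.

  The vertices of \<open>P\<degree>\<close> correspond to the facets of \<open>P\<close> when \<open>0\<close> is an interior point of \<open>P\<close>.
  Since the facet constant is defined as a limit, the limit has to be shown to exist.
  With \<open>cap y\<close> the measure of the cap \<open>x \<bullet> y \<ge> 1\<close>, the expected number of facets is
  \<open>m choose d\<close> times the integral of \<open>(1 - cap y)\<^bsup>m - d\<^esup>\<close>, where \<open>y\<close> is dual to the hyperplane through
  \<open>d\<close> sample points. One of them may be fixed by rotation invariance. Shrinking the directions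
  orthogonal to it by the factor \<open>m\<^bsup>-1 / (d - 1)\<^esup>\<close> turns the sphere into a paraboloid, and dominated
  convergence applies.
\<close>

subsection \<open>Connected vertex sets in graphs of bounded degree\<close>

text \<open>The threshold \<open>8 * (d - 1)\<close> is a product. Percolation at density
  \<open>1 / (2 * (d - 1))\<close> bounds the number of clusters by powers of
  \<open>4 * (d - 1)\<close>. The number of choices of \<open>d\<close> neighbours of a cluster of
  size \<open>k\<close> is polynomial in \<open>k\<close> and is absorbed into
  \<open>B * 2 ^ k\<close>, with \<open>B\<close> depending only on \<open>d\<close>. Taking one
  \<open>q\<close> out of \<open>(8 * (d - 1) * q) ^ 2 * B\<close> leaves the constant
  \<open>64 * (d - 1) ^ 2 * B\<close>. With positive probability all sample points lie in a
  half-space. The dual is then unbounded: some of its edges are rays, and neither the neighbour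
  arguments nor the correspondence with facets are available. Such samples get a crude polynomial
  bound, which their exponentially small probability outweighs. For the limit, pointwise convergence
  needs upper and lower bounds for \<open>cap\<close> with the same leading constant, and domination
  needs a lower bound for \<open>cap y\<close> by the distance of two sample points on its boundary.
  Both come from comparing the cone over a cap with one fixed cone.\<close>

definition outer_boundary :: "'v set \<Rightarrow> ('v \<Rightarrow> 'v \<Rightarrow> bool) \<Rightarrow> 'v set \<Rightarrow> 'v set" where
  "outer_boundary V E S = {w \<in> V - S. \<exists>v\<in>S. E v w}"

text \<open>Connectedness of the induced subgraph for symmetric \<open>E\<close>, stated through
  cuts instead of paths. This is the form in which connected sets are grown below, and the form that
  the improvement argument on the polytope produces. The empty set qualifies and is excluded
  separately.\<close>

definition linked :: "('v \<Rightarrow> 'v \<Rightarrow> bool) \<Rightarrow> 'v set \<Rightarrow> bool" where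
  "linked E S \<longleftrightarrow> (\<forall>A\<subseteq>S. A \<noteq> {} \<and> A \<noteq> S \<longrightarrow> (\<exists>a\<in>A. \<exists>w\<in>S - A. E a w))"

lemma linkedD:
  assumes "linked E S" "A \<subseteq> S" "A \<noteq> {}" "A \<noteq> S"
  obtains a w where "a \<in> A" "w \<in> S - A" "E a w"
  using assms unfolding linked_def by meson

lemma prob_Pi_bernoulli:
  fixes p :: real
  assumes V: "finite V" and "A \<subseteq> V" "B \<subseteq> V" "A \<inter> B = {}" and p: "0 \<le> p" "p \<le> 1"
  shows "measure_pmf.prob (Pi_pmf V False (\<lambda>_. bernoulli_pmf p))
           {b. (\<forall>u\<in>A. b u) \<and> (\<forall>u\<in>B. \<not> b u)} = p ^ card A * (1 - p) ^ card B"
proof -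
  define Z where "Z u = (if u \<in> A then {True} else if u \<in> B then {False} else UNIV)" for u
  have "{b. (\<forall>u\<in>A. b u) \<and> (\<forall>u\<in>B. \<not> b u)} = Pi V Z"
    using assms by (fastforce simp: Z_def Pi_def split: if_splits)
  then have "measure_pmf.prob (Pi_pmf V False (\<lambda>_. bernoulli_pmf p))
           {b. (\<forall>u\<in>A. b u) \<and> (\<forall>u\<in>B. \<not> b u)} = (\<Prod>u\<in>V. measure_pmf.prob (bernoulli_pmf p) (Z u))"
    by (simp add: measure_Pi_pmf_Pi V)
  also have "\<dots> = (\<Prod>u\<in>V. (if u \<in> A then p else 1) * (if u \<in> B then 1 - p else 1))"
    using p assms by (intro prod.cong) (auto simp: Z_def measure_pmf_single)
  also have "\<dots> = p ^ card A * (1 - p) ^ card B"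
    using assms by (simp add: prod.distrib prod.If_cases Int_absorb1 Int_absorb2)
  finally show ?thesis .
qed

locale bounded_degree_graph =
  fixes V :: "'v set" and E :: "'v \<Rightarrow> 'v \<Rightarrow> bool" and d :: nat
  assumes fin: "finite V" and sym: "E v w \<Longrightarrow> E w v" and irrefl: "\<not> E v v"
    and deg: "v \<in> V \<Longrightarrow> card {w \<in> V. E v w} \<le> d" and d2: "2 \<le> d"
begin

abbreviation bd where "bd \<equiv> outer_boundary V E"

lemma fin_bd [simp]: "finite (bd S)"
  using fin by (simp add: outer_boundary_def)

lemma bd_sub: "bd S \<subseteq> V" "bd S \<inter> S = {}"
  by (auto simp: outer_boundary_def)

lemma bd_singleton: "bd {v} = {w \<in> V. E v w}"
  using irrefl by (auto simp: outer_boundary_def)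

text \<open>The set is built vertex by vertex. The first vertex has at most \<open>d\<close>
  neighbours. Each later one leaves the boundary, and its edge back to the part already built
  creates no boundary vertex, so it raises the count by at most \<open>d - 2\<close>.\<close>

lemma card_bd:
  assumes S: "S \<subseteq> V" "S \<noteq> {}" "linked E S"
  shows "card (bd S) \<le> (d - 2) * card S + 2"
proof -
  have fS: "finite S" using S fin finite_subset by auto
  have "\<exists>A\<subseteq>S. card A = j \<and> card (bd A) \<le> (d - 2) * j + 2" if "1 \<le> j" "j \<le> card S" for j
    using that
  proof (induction j rule: dec_induct)
    case base
    obtain v where v: "v \<in> S" using S by auto
    then have "card (bd {v}) \<le> d" using deg[of v] S by (auto simp: bd_singleton)
    then show ?case using v d2 by (intro exI[of _ "{v}"]) auto
  next
    case (step j)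
    then obtain A where A: "A \<subseteq> S" "card A = j" "card (bd A) \<le> (d - 2) * j + 2" by auto
    have "A \<noteq> {}" "A \<noteq> S" using A step by auto
    then obtain a w where aw: "a \<in> A" "w \<in> S - A" "E a w" using linkedD[OF S(3) A(1)] by metis
    have fA: "finite A" using A fS finite_subset by auto
    \<comment> \<open>The two removed vertices account for \<open>d - 2\<close>: \<open>w\<close>
      was a boundary vertex and is now inside, and its neighbour \<open>a\<close> is inside
      already.\<close>
    have "bd (insert w A) \<subseteq> (bd A - {w}) \<union> ({u \<in> V. E w u} - {a})"
      using aw by (auto simp: outer_boundary_def)
    then have "card (bd (insert w A)) \<le> card ((bd A - {w}) \<union> ({u \<in> V. E w u} - {a}))"
      using fin by (intro card_mono) auto
    also have "\<dots> \<le> card (bd A - {w}) + card ({u \<in> V. E w u} - {a})"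
      by (rule card_Un_le)
    also have "card (bd A - {w}) = card (bd A) - 1"
      using aw S by (subst card_Diff_singleton) (auto simp: outer_boundary_def)
    also have "card ({u \<in> V. E w u} - {a}) = card {u \<in> V. E w u} - 1"
      using aw S A sym by (subst card_Diff_singleton) auto
    finally have "card (bd (insert w A)) \<le> (card (bd A) - 1) + (card {u \<in> V. E w u} - 1)" .
    moreover have "card {u \<in> V. E w u} \<le> d" using deg[of w] aw S by auto
    moreover have "card (bd A) \<ge> 1"
      using aw S by (auto simp: outer_boundary_def Suc_le_eq card_gt_0_iff fin)
    moreover obtain e where "d = e + 2" using d2 by (metis add.commute le_add_diff_inverse)
    ultimately have "card (bd (insert w A)) \<le> (d - 2) * Suc j + 2"
      using A(3) by (simp add: algebra_simps)
    moreover have "card (insert w A) = Suc j" using aw fA A by auto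
    ultimately show ?case using A aw by (intro exI[of _ "insert w A"]) auto
  qed
  from this[of "card S"] obtain A where "A \<subseteq> S" "card A = card S" "card (bd A) \<le> (d - 2) * card S + 2"
    using S fS by (auto simp: Suc_le_eq card_gt_0_iff)
  then show ?thesis using card_subset_eq[OF fS] by metis
qed

text \<open>Site percolation: the linked sets containing \<open>v\<close> are candidates for the cluster of \<open>v\<close>,
  and a configuration has only one such cluster.\<close>

lemma sum_clusters_le_1:
  assumes x: "0 \<le> x" "x \<le> (1::real)" and F: "F \<subseteq> {S. S \<subseteq> V \<and> v \<in> S \<and> linked E S}"
  shows "(\<Sum>S\<in>F. x ^ card S * (1 - x) ^ card (bd S)) \<le> 1"
proof -
  let ?P = "Pi_pmf V False (\<lambda>_. bernoulli_pmf x)"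
  define ev where "ev S = {b. (\<forall>u\<in>S. b u) \<and> (\<forall>u\<in>bd S. \<not> b u)}" for S
  have finF: "finite F" using fin by (intro finite_subset[OF F]) auto
  \<comment> \<open>If the configuration \<open>b\<close> has both \<open>S\<close> and
    \<open>S'\<close> as cluster of \<open>v\<close>, an edge of \<open>S'\<close> leaving
    \<open>S\<close> would end in a vertex that is open as a member of \<open>S'\<close> and closed
    as a boundary vertex of \<open>S\<close>.\<close>
  have sub: "S' \<subseteq> S" if S: "S \<in> F" "S' \<in> F" "b \<in> ev S" "b \<in> ev S'" for S S' b
  proof (rule ccontr)
    assume "\<not> S' \<subseteq> S"
    then have "S' \<inter> S \<subseteq> S'" "S' \<inter> S \<noteq> {}" "S' \<inter> S \<noteq> S'" "linked E S'" using S F by auto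
    then obtain a w where "a \<in> S' \<inter> S" "w \<in> S' - S' \<inter> S" "E a w" by (meson linkedD)
    then have "w \<in> bd S" "w \<in> S'" using S F by (auto simp: outer_boundary_def)
    then show False using S by (auto simp: ev_def)
  qed
  have "disjoint_family_on ev F"
    unfolding disjoint_family_on_def using sub by (metis disjoint_iff subset_antisym)
  then have "measure_pmf.prob ?P (\<Union>S\<in>F. ev S) = (\<Sum>S\<in>F. measure_pmf.prob ?P (ev S))"
    using finF by (intro measure_pmf.finite_measure_finite_Union) auto
  also have "\<dots> = (\<Sum>S\<in>F. x ^ card S * (1 - x) ^ card (bd S))"
    unfolding ev_def using F x fin bd_sub by (intro sum.cong refl prob_Pi_bernoulli) blast+
  finally show ?thesis using measure_pmf.prob_le_1 by metis
qed

text \<open>By \<open>card_bd\<close> every set of size \<open>k\<close> has weight at least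
  \<open>x ^ k * (1 - x) ^ ((d - 2) * k + 2)\<close> in the percolation inequality, whose total is
  at most 1. So the number of such sets is at most the inverse of this weight.\<close>

lemma card_clusters:
  assumes k: "1 \<le> k"
  shows "real (card {S. S \<subseteq> V \<and> v \<in> S \<and> linked E S \<and> card S = k}) \<le> 4 * (4 * (real d - 1)) ^ k"
proof -
  define F where "F = {S. S \<subseteq> V \<and> v \<in> S \<and> linked E S \<and> card S = k}"
  \<comment> \<open>Half of the maximiser \<open>1 / (d - 1)\<close> of
    \<open>x * (1 - x) ^ (d - 2)\<close>. Here Bernoulli's inequality gives
    \<open>(1 - x) ^ (d - 2) >= 1 / 2\<close>, so that the base becomes
    \<open>2 / x = 4 * (d - 1)\<close>.\<close>
  define x where "x = 1 / (2 * (real d - 1))"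
  have d1: "real d - 1 \<ge> 1" using d2 by simp
  have x: "0 < x" "x \<le> 1 / 2" using d1 by (auto simp: x_def field_simps)
  have bern: "1 / 2 \<le> (1 - x) ^ (d - 2)"
  proof -
    have "1 / 2 \<le> 1 - real (d - 2) * x" using d2 d1 by (simp add: x_def field_simps of_nat_diff)
    also have "\<dots> \<le> (1 + (- x)) ^ (d - 2)"
      using x Bernoulli_inequality[of "- x" "d - 2"] by simp
    finally show ?thesis by simp
  qed
  have low: "x ^ k * ((1 / 2) ^ k * (1 / 4)) \<le> x ^ card S * (1 - x) ^ card (bd S)" if "S \<in> F" for S
  proof -
    have S: "S \<subseteq> V" "S \<noteq> {}" "linked E S" "card S = k" using that by (auto simp: F_def)
    have "(1 / 2) ^ k * (1 / 4 :: real) \<le> ((1 - x) ^ (d - 2)) ^ k * (1 - x) ^ 2"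
    proof (intro mult_mono power_mono)
      show "1 / 4 \<le> (1 - x)\<^sup>2" using power_mono[of "1/2" "1-x" 2] x by (simp add: power_divide)
    qed (use bern x in auto)
    also have "\<dots> = (1 - x) ^ ((d - 2) * k + 2)" by (simp only: power_add power_mult)
    also have "\<dots> \<le> (1 - x) ^ card (bd S)"
      using card_bd[OF S(1-3)] S x by (intro power_decreasing) auto
    finally show ?thesis using S x by (intro mult_mono) auto
  qed
  have "real (card F) * (x ^ k * ((1 / 2) ^ k * (1 / 4))) = (\<Sum>S\<in>F. x ^ k * ((1 / 2) ^ k * (1 / 4)))"
    by simp
  also have "\<dots> \<le> (\<Sum>S\<in>F. x ^ card S * (1 - x) ^ card (bd S))"
    by (rule sum_mono[OF low])
  also have "\<dots> \<le> 1" using x by (intro sum_clusters_le_1[of _ _ v]) (auto simp: F_def)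
  finally have le: "real (card F) * (x ^ k * ((1 / 2) ^ k * (1 / 4))) \<le> 1" .
  have eq: "x ^ k * ((1 / 2) ^ k * (1 / 4)) = 1 / (4 * (4 * (real d - 1)) ^ k)"
    by (simp add: x_def power_divide power_mult_distrib field_simps flip: power_mult_distrib)
  have "real (card F) * (1 / (4 * (4 * (real d - 1)) ^ k)) \<le> 1" using le unfolding eq .
  moreover have "0 < 4 * (4 * (real d - 1)) ^ k" using d1 by simp
  ultimately show ?thesis unfolding F_def[symmetric]
    by (metis times_divide_eq_right mult_1_right pos_divide_le_eq mult_1_left)
qed

text \<open>A singleton has at most one set of \<open>d\<close> neighbours, which gives the exact
  leading term \<open>q\<close>. For \<open>k >= 2\<close> the cluster count, the weight
  \<open>q ^ k\<close> and the polynomial \<open>(d * k) ^ d\<close> for the neighbour sets combine,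
  through \<open>B\<close>, to \<open>B * r ^ k\<close> with \<open>r = 8 * (d - 1) * q\<close>. The
  geometric series starts at \<open>r ^ 2\<close>, hence the square in the bound.\<close>

lemma sum_over_clusters_le:
  fixes q B :: real
  assumes q: "0 \<le> q" "8 * (real d - 1) * q < 1"
    and B: "\<And>k. 4 * (real d * real k) ^ d \<le> B * 2 ^ k"
  shows "(\<Sum>S\<in>{S. S \<subseteq> V \<and> S \<noteq> {} \<and> linked E S}. q ^ card S * real (card (bd S) choose d))
    \<le> real (card V) * (q + (8 * (real d - 1) * q)\<^sup>2 * B / (1 - 8 * (real d - 1) * q))"
proof -
  define r where "r = 8 * (real d - 1) * q"
  have r: "0 \<le> r" "r < 1" using q d2 by (auto simp: r_def)
  define g where "g S = q ^ card S * real (card (bd S) choose d)" for S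
  have g0: "0 \<le> g S" for S using q by (simp add: g_def)
  have one: "(\<Sum>S\<in>{S. S \<subseteq> V \<and> v \<in> S \<and> linked E S}. g S) \<le> q + r\<^sup>2 * B / (1 - r)" if v: "v \<in> V" for v
  proof -
    define F where "F k = {S. S \<subseteq> V \<and> v \<in> S \<and> linked E S \<and> card S = k}" for k
    have finF: "finite (F k)" for k by (rule finite_subset[of _ "Pow V"]) (auto simp: F_def fin)
    have F1: "sum g (F 1) \<le> q"
    proof -
      have "F 1 \<subseteq> {{v}}" by (auto simp: F_def card_1_singleton_iff)
      then have "sum g (F 1) \<le> sum g {{v}}" using g0 by (intro sum_mono2) auto
      also have "\<dots> = q * real (card (bd {v}) choose d)" by (simp add: g_def)
      also have "\<dots> \<le> q * 1"
      proof (intro mult_left_mono q(1))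
        have "card (bd {v}) \<le> d" using deg[OF v] by (simp add: bd_singleton)
        then show "real (card (bd {v}) choose d) \<le> 1"
          by (cases "card (bd {v}) = d") (auto simp: binomial_eq_0)
      qed
      finally show ?thesis by simp
    qed
    have Fk: "sum g (F k) \<le> B * r ^ k" if k: "2 \<le> k" for k
    proof -
      have gk: "g S \<le> q ^ k * (real d * real k) ^ d" if "S \<in> F k" for S
      proof -
        have S: "S \<subseteq> V" "S \<noteq> {}" "linked E S" "card S = k" using that by (auto simp: F_def)
        have "card (bd S) choose d \<le> card (bd S) ^ d"
          by (cases "d \<le> card (bd S)") (auto simp: binomial_le_pow binomial_eq_0)
        also have "\<dots> \<le> (d * k) ^ d"
        proof (rule power_mono)
          obtain e where "d = e + 2" using d2 by (metis add.commute le_add_diff_inverse)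
          then show "card (bd S) \<le> d * k" using card_bd[OF S(1-3)] S(4) k by (simp add: algebra_simps)
        qed simp
        finally have "real (card (bd S) choose d) \<le> (real d * real k) ^ d"
          by (metis of_nat_le_iff of_nat_mult of_nat_power)
        then show ?thesis using q S by (simp add: g_def mult_left_mono)
      qed
      have "sum g (F k) \<le> real (card (F k)) * (q ^ k * (real d * real k) ^ d)"
        using sum_mono[OF gk] by simp
      also have "\<dots> \<le> (4 * (4 * (real d - 1)) ^ k) * (q ^ k * (real d * real k) ^ d)"
        using card_clusters[of k v] k q d2 unfolding F_def by (intro mult_right_mono) auto
      also have "\<dots> = (4 * (real d - 1) * q) ^ k * (4 * (real d * real k) ^ d)"
        by (simp add: power_mult_distrib)
      also have "\<dots> \<le> (4 * (real d - 1) * q) ^ k * (B * 2 ^ k)"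
        using q d2 by (intro mult_left_mono B) auto
      also have "\<dots> = B * ((4 * (real d - 1) * q) * 2) ^ k"
        unfolding power_mult_distrib[of "4 * (real d - 1) * q" 2 k] by (simp only: mult_ac)
      also have "(4 * (real d - 1) * q) * 2 = r" by (simp add: r_def)
      finally show ?thesis .
    qed
    have B0: "0 \<le> B" using B[of 0] d2 by (simp add: power_0_left)
    have "{S. S \<subseteq> V \<and> v \<in> S \<and> linked E S} = (\<Union>k\<in>{1..card V}. F k)"
      by (auto simp: F_def Suc_le_eq card_gt_0_iff card_mono[OF fin] finite_subset[OF _ fin])
    then have "(\<Sum>S\<in>{S. S \<subseteq> V \<and> v \<in> S \<and> linked E S}. g S) = (\<Sum>k\<in>{1..card V}. sum g (F k))"
      using finF by (simp, subst sum.UNION_disjoint) (auto simp: F_def)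
    also have "\<dots> \<le> (\<Sum>k\<in>{1..card V}. if k = 1 then q else B * r ^ k)"
      using F1 Fk by (intro sum_mono) (auto simp del: One_nat_def)
    also have "\<dots> \<le> (\<Sum>k\<in>{1..<card V + 2}. if k = 1 then q else B * r ^ k)"
      using q B0 r by (intro sum_mono2) auto
    also have "\<dots> = q + (\<Sum>k\<in>{2..<card V + 2}. B * r ^ k)"
    proof -
      have "{1..<card V + 2} = insert 1 {2..<card V + 2}" by auto
      then show ?thesis by simp
    qed
    also have "(\<Sum>k\<in>{2..<card V + 2}. B * r ^ k) = (\<Sum>k<card V. B * r ^ (k + 2))"
      by (rule sum.reindex_bij_witness[of _ "\<lambda>k. k + 2" "\<lambda>k. k - 2"]) (auto simp del: add_2_eq_Suc')
    also have "\<dots> = B * r\<^sup>2 * (\<Sum>k<card V. r ^ k)"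
      by (simp add: sum_distrib_left power_add power2_eq_square mult_ac)
    also have "\<dots> \<le> B * r\<^sup>2 * (1 / (1 - r))"
    proof (intro mult_left_mono)
      show "(\<Sum>k<card V. r ^ k) \<le> 1 / (1 - r)"
        using r by (simp add: sum_gp_strict divide_right_mono)
    qed (use B0 in auto)
    finally show ?thesis by (simp add: mult_ac)
  qed
  define C where "C = {S. S \<subseteq> V \<and> S \<noteq> {} \<and> linked E S}"
  have finC: "finite C" by (rule finite_subset[of _ "Pow V"]) (auto simp: C_def fin)
  \<comment> \<open>Each nonempty set is counted once for each of its vertices, hence at least once.
    This reduces the sum to clusters through a given vertex.\<close>
  have "(\<Sum>S\<in>C. g S) \<le> (\<Sum>S\<in>C. \<Sum>v\<in>V. if v \<in> S then g S else 0)"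
  proof (rule sum_mono)
    fix S assume "S \<in> C"
    then obtain v where v: "v \<in> S" "v \<in> V" by (auto simp: C_def)
    have "g S = (\<Sum>v\<in>{v}. if v \<in> S then g S else 0)" using v by simp
    also have "\<dots> \<le> (\<Sum>v\<in>V. if v \<in> S then g S else 0)"
      using v fin g0 by (intro sum_mono2) auto
    finally show "g S \<le> (\<Sum>v\<in>V. if v \<in> S then g S else 0)" .
  qed
  also have "\<dots> = (\<Sum>v\<in>V. \<Sum>S\<in>C. if v \<in> S then g S else 0)" by (rule sum.swap)
  also have "\<dots> = (\<Sum>v\<in>V. \<Sum>S\<in>{S. S \<subseteq> V \<and> v \<in> S \<and> linked E S}. g S)"
  proof (rule sum.cong[OF refl])
    fix v
    have "{S. S \<subseteq> V \<and> v \<in> S \<and> linked E S} = {S \<in> C. v \<in> S}" by (auto simp: C_def)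
    then show "(\<Sum>S\<in>C. if v \<in> S then g S else 0) = (\<Sum>S\<in>{S. S \<subseteq> V \<and> v \<in> S \<and> linked E S}. g S)"
      using finC by (simp add: sum.inter_filter)
  qed
  also have "\<dots> \<le> (\<Sum>v\<in>V. q + r\<^sup>2 * B / (1 - r))" by (intro sum_mono one)
  finally show ?thesis by (simp add: g_def r_def C_def)
qed

text \<open>\<open>K\<close> bounds the contribution of the selections that miss a vertex of every closed neighbourhood.
  In the application only these give a lower-dimensional hull. If \<open>r\<close> vertices are discarded in such
  a selection, then \<open>(d + 1) r \<ge> n\<close>. The base comes from the exponential moment
  \<open>E 2\<^sup>r = (1 + q)\<^sup>n\<close>.\<close>

lemma expectation_selection_le:
  fixes q B K m :: real and f :: "'v set \<Rightarrow> real"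
  assumes q: "0 \<le> q" "q \<le> 1" "8 * (real d - 1) * q < 1"
    and B: "\<And>k. 4 * (real d * real k) ^ d \<le> B * 2 ^ k"
    and K: "\<And>n. (real n + 1) ^ d * ((1 + q) / root (d + 1) 2) ^ n \<le> K"
    and f: "\<And>R. R \<subseteq> V \<Longrightarrow> f R \<le> m
      + real (card {(S, D). S \<subseteq> V \<and> S \<noteq> {} \<and> linked E S \<and> D \<subseteq> bd S \<and> card D = d \<and> S \<inter> R = {} \<and> D \<subseteq> R})
      + (if \<exists>v\<in>V. insert v {w \<in> V. E v w} \<subseteq> R then 0 else (real (card V) + 1) ^ d)"
  shows "measure_pmf.expectation (Pi_pmf V False (\<lambda>_. bernoulli_pmf (1 - q))) (\<lambda>b. f {v \<in> V. b v})
    \<le> m + real (card V) * (1 - q) ^ d * (q + (8 * (real d - 1) * q)\<^sup>2 * B / (1 - 8 * (real d - 1) * q)) + K"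
proof -
  let ?P = "Pi_pmf V False (\<lambda>_. bernoulli_pmf (1 - q))"
  let ?R = "\<lambda>b. {v \<in> V. b v}"
  define n where "n = card V"
  define U where "U = (SIGMA S:{S. S \<subseteq> V \<and> S \<noteq> {} \<and> linked E S}. {D. D \<subseteq> bd S \<and> card D = d})"
  define W where "W b = card {(S, D). S \<subseteq> V \<and> S \<noteq> {} \<and> linked E S \<and> D \<subseteq> bd S \<and> card D = d
    \<and> S \<inter> ?R b = {} \<and> D \<subseteq> ?R b}" for b
  define t where "t = root (d + 1) (2::real)"
  have t1: "1 < t" by (simp add: t_def)
  have td: "t ^ (d + 1) = 2" by (simp add: t_def del: power_Suc)
  define h where "h b = (\<Prod>v\<in>V. if b v then 1 else (2::real))" for b :: "'v \<Rightarrow> bool"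
  have finP: "finite (set_pmf ?P)" 
    by (rule finite_subset[OF set_Pi_pmf_subset'[OF fin]]) (auto intro!: finite_PiE_dflt fin)
  have int: "integrable ?P g" for g :: "_ \<Rightarrow> real" by (rule integrable_measure_pmf_finite[OF finP])
  have finU: "finite U" unfolding U_def by (intro finite_SigmaI finite_subset[OF _ finite_Pow_iff[THEN iffD2, OF fin]]) (auto simp: outer_boundary_def)
  \<comment> \<open>Written as a sum of indicators over a fixed finite set of pairs, so that
    linearity of expectation leaves only products of \<open>d\<close> factors \<open>1 - q\<close>
    and \<open>card S\<close> factors \<open>q\<close>.\<close>
  have W: "real (W b) = (\<Sum>(S, D)\<in>U. indicator {b. (\<forall>u\<in>D. b u) \<and> (\<forall>u\<in>S. \<not> b u)} b)" for b
  proof -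
    have "{(S, D). S \<subseteq> V \<and> S \<noteq> {} \<and> linked E S \<and> D \<subseteq> bd S \<and> card D = d \<and> S \<inter> ?R b = {} \<and> D \<subseteq> ?R b}
      = {SD \<in> U. b \<in> {b. (\<forall>u\<in>snd SD. b u) \<and> (\<forall>u\<in>fst SD. \<not> b u)}}"
      unfolding U_def outer_boundary_def
      by (intro set_eqI, simp only: split_paired_all mem_Sigma_iff mem_Collect_eq case_prod_conv fst_conv snd_conv) blast
    then have "real (W b) = real (card {SD \<in> U. b \<in> {b. (\<forall>u\<in>snd SD. b u) \<and> (\<forall>u\<in>fst SD. \<not> b u)}})"
      unfolding W_def by (rule arg_cong)
    also have "\<dots> = (\<Sum>SD\<in>U. indicator {b. (\<forall>u\<in>snd SD. b u) \<and> (\<forall>u\<in>fst SD. \<not> b u)} b)"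
      using finU by (simp add: indicator_def sum.If_cases Int_def)
    finally show ?thesis by (simp add: case_prod_beta)
  qed
  have EW: "measure_pmf.expectation ?P (\<lambda>b. real (W b))
     \<le> (1 - q) ^ d * (real n * (q + (8 * (real d - 1) * q)\<^sup>2 * B / (1 - 8 * (real d - 1) * q)))"
  proof -
    have "measure_pmf.expectation ?P (\<lambda>b. real (W b))
      = (\<Sum>SD\<in>U. measure_pmf.prob ?P {b. (\<forall>u\<in>snd SD. b u) \<and> (\<forall>u\<in>fst SD. \<not> b u)})"
      unfolding W by (subst Bochner_Integration.integral_sum) (auto simp: case_prod_beta int)
    also have "\<dots> = (\<Sum>(S, D)\<in>U. (1 - q) ^ d * q ^ card S)"
    proof (intro sum.cong refl, clarify)
      fix S D assume SD: "(S, D) \<in> U"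
      have "measure_pmf.prob ?P {b. (\<forall>u\<in>D. b u) \<and> (\<forall>u\<in>S. \<not> b u)} = (1 - q) ^ card D * (1 - (1 - q)) ^ card S"
        using SD bd_sub q by (intro prob_Pi_bernoulli fin) (auto simp: U_def outer_boundary_def)
      then show "measure_pmf.prob ?P {b. (\<forall>u\<in>snd (S, D). b u) \<and> (\<forall>u\<in>fst (S, D). \<not> b u)} = (1 - q) ^ d * q ^ card S"
        using SD by (simp add: U_def)
    qed
    also have "\<dots> = (\<Sum>S\<in>{S. S \<subseteq> V \<and> S \<noteq> {} \<and> linked E S}. \<Sum>D\<in>{D. D \<subseteq> bd S \<and> card D = d}. (1 - q) ^ d * q ^ card S)"
      unfolding U_def by (subst sum.Sigma) (auto intro: finite_subset[OF _ finite_Pow_iff[THEN iffD2, OF fin]] finite_subset[OF _ finite_Pow_iff[THEN iffD2, OF fin_bd]])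
    also have "\<dots> = (1 - q) ^ d * (\<Sum>S\<in>{S. S \<subseteq> V \<and> S \<noteq> {} \<and> linked E S}. q ^ card S * real (card (bd S) choose d))"
      by (simp add: n_subsets sum_distrib_left mult_ac)
    also have "\<dots> \<le> (1 - q) ^ d * (real n * (q + (8 * (real d - 1) * q)\<^sup>2 * B / (1 - 8 * (real d - 1) * q)))"
      unfolding n_def using q by (intro mult_left_mono sum_over_clusters_le B) auto
    finally show ?thesis .
  qed
  have Eh: "measure_pmf.expectation ?P h = (1 + q) ^ n"
    unfolding h_def using q by (subst expectation_prod_Pi_pmf) (auto simp: fin n_def add.commute intro: integrable_measure_pmf_finite)
  \<comment> \<open>Markov's inequality in pointwise form: \<open>h b\<close> is 2 to the number of
    discarded vertices, and it reaches \<open>t ^ n\<close> on every exceptional selection.\<close>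
  have low: "(if \<exists>v\<in>V. insert v {w \<in> V. E v w} \<subseteq> ?R b then 0 else 1) \<le> h b / t ^ n" for b
  proof (cases "\<exists>v\<in>V. insert v {w \<in> V. E v w} \<subseteq> ?R b")
    case True
    then show ?thesis using t1 by (simp add: h_def prod_nonneg)
  next
    case False
    define Z where "Z = V - ?R b"
    \<comment> \<open>The discarded vertices dominate the graph: the closed neighbourhood of
      \<open>v\<close> contains a discarded \<open>w\<close>, and by symmetry \<open>v\<close> lies
      in the closed neighbourhood of \<open>w\<close>.\<close>
    have "V \<subseteq> (\<Union>z\<in>Z. insert z {w \<in> V. E z w})"
    proof
      fix v assume v: "v \<in> V"
      then obtain w where w: "w \<in> V" "w = v \<or> E v w" "w \<notin> ?R b" using False by blast
      then have "v \<in> insert w {u \<in> V. E w u}" using v sym[of v w] by blast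
      then show "v \<in> (\<Union>z\<in>Z. insert z {w \<in> V. E z w})" using w by (auto simp: Z_def)
    qed
    then have "n \<le> card (\<Union>z\<in>Z. insert z {w \<in> V. E z w})"
      unfolding n_def using fin by (intro card_mono) (auto simp: Z_def)
    also have "\<dots> \<le> (\<Sum>z\<in>Z. card (insert z {w \<in> V. E z w}))"
      using fin by (intro card_UN_le) (auto simp: Z_def)
    also have "\<dots> \<le> (\<Sum>z\<in>Z. d + 1)"
      using fin deg by (intro sum_mono order_trans[OF card_insert_le_m1]) (auto simp: Z_def)
    finally have nZ: "n \<le> card Z * (d + 1)" by simp
    have "t ^ n \<le> t ^ ((d + 1) * card Z)" using t1 nZ by (intro power_increasing) (auto simp: mult.commute)
    also have "\<dots> = 2 ^ card Z" by (simp only: power_mult td)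
    also have "\<dots> = h b"
    proof -
      have "Z = {v \<in> V. \<not> b v}" by (auto simp: Z_def)
      then show ?thesis using fin by (simp add: h_def prod.If_cases Int_def)
    qed
    finally have "1 \<le> h b / t ^ n" using t1 by simp
    then show ?thesis using False by (simp only: if_False)
  qed
  have "measure_pmf.expectation ?P (\<lambda>b. f (?R b))
    \<le> measure_pmf.expectation ?P (\<lambda>b. m + real (W b) + (real n + 1) ^ d * (h b / t ^ n))"
  proof (intro integral_mono int)
    fix b
    have "f (?R b) \<le> m + real (W b) + (if \<exists>v\<in>V. insert v {w \<in> V. E v w} \<subseteq> ?R b then 0 else (real n + 1) ^ d)"
      unfolding W_def n_def by (rule f) auto
    also have "\<dots> = m + real (W b) + (real n + 1) ^ d * (if \<exists>v\<in>V. insert v {w \<in> V. E v w} \<subseteq> ?R b then 0 else 1)"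
      by simp
    also have "\<dots> \<le> m + real (W b) + (real n + 1) ^ d * (h b / t ^ n)"
      by (intro add_left_mono mult_left_mono low) auto
    finally show "f (?R b) \<le> m + real (W b) + (real n + 1) ^ d * (h b / t ^ n)" .
  qed
  also have "\<dots> = m + measure_pmf.expectation ?P (\<lambda>b. real (W b)) + (real n + 1) ^ d * (measure_pmf.expectation ?P h / t ^ n)"
    by (simp add: int)
  also have "\<dots> \<le> m + (1 - q) ^ d * (real n * (q + (8 * (real d - 1) * q)\<^sup>2 * B / (1 - 8 * (real d - 1) * q))) + K"
    using EW K[of n] unfolding Eh t_def by (simp add: power_divide)
  finally show ?thesis by (simp add: n_def mult_ac)
qed

end

subsection \<open>The dual of a polytope in general position\<close>

text \<open>A subset of size at most \<open>k\<close> is read off from a list of length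
  \<open>k\<close> over \<open>A\<close> enlarged by the padding symbol \<open>None\<close>.\<close>

lemma card_subsets_le:
  assumes "finite A"
  shows "card {B. B \<subseteq> A \<and> card B \<le> k} \<le> (card A + 1) ^ k"
proof -
  define g where "g a = (case a of None \<Rightarrow> {} | Some b \<Rightarrow> {b})" for a :: "'a option"
  let ?L = "{xs. set xs \<subseteq> insert None (Some ` A) \<and> length xs = k}"
  have "{B. B \<subseteq> A \<and> card B \<le> k} \<subseteq> (\<lambda>xs. \<Union> (g ` set xs)) ` ?L"
  proof
    fix B assume B: "B \<in> {B. B \<subseteq> A \<and> card B \<le> k}"
    then have "finite B" using assms finite_subset by auto
    then obtain bs where bs: "set bs = B" "length bs = card B"
      by (metis finite_distinct_list distinct_card)
    let ?xs = "map Some bs @ replicate (k - card B) None"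
    have "?xs \<in> ?L" using B bs by auto
    moreover have "\<Union> (g ` set ?xs) = B" using bs by (auto simp: g_def)
    ultimately show "B \<in> (\<lambda>xs. \<Union> (g ` set xs)) ` ?L" by blast
  qed
  moreover have fL: "finite ?L" using assms by (intro finite_lists_length_eq) auto
  ultimately have "card {B. B \<subseteq> A \<and> card B \<le> k} \<le> card ?L"
    by (meson surj_card_le)
  also have "\<dots> = card (insert None (Some ` A)) ^ k" using assms by (intro card_lists_length_eq) auto
  also have "card (insert None (Some ` A)) = card A + 1"
    using assms by (subst card_insert_disjoint) (auto simp: card_image)
  finally show ?thesis .
qed

text \<open>A facet is the hull of some points of \<open>A\<close>, so an affine basis of its span
  can be taken from \<open>A\<close>. A facet has codimension one, so this basis has exactly as many
  elements as the dimension of the whole hull. Facets are counted through such bases.\<close>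

lemma facet_affine_basis:
  fixes A :: "'a::euclidean_space set"
  assumes A: "finite A" and F: "F facet_of (convex hull A)"
  obtains D where "D \<subseteq> A \<inter> F" "affine hull D = affine hull F" "int (card D) = aff_dim (convex hull A)"
proof -
  have "F face_of (convex hull A)" using F by (simp add: facet_of_def)
  then obtain S where S: "S \<subseteq> A" "F = convex hull S"
    using face_of_convex_hull_subset[OF finite_imp_compact[OF A]] by metis
  obtain D where D: "\<not> affine_dependent D" "D \<subseteq> S" "affine hull S = affine hull D"
    using affine_basis_exists by blast
  have "aff_dim F = aff_dim D" using D S by (metis aff_dim_affine_hull affine_hull_convex_hull)
  also have "\<dots> = int (card D) - 1" using D by (simp add: aff_dim_affine_independent)
  finally have "int (card D) = aff_dim (convex hull A)" using F by (simp add: facet_of_def)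
  moreover have "D \<subseteq> A \<inter> F" using D S hull_subset by fast
  moreover have "affine hull D = affine hull F" using D S by simp
  ultimately show ?thesis using that by blast
qed

lemma facet_eq_affine_hull_Int:
  assumes "convex K" "F facet_of K"
  shows "F = affine hull F \<inter> K"
  by (rule face_of_imp_eq_affine_Int[OF assms(1) facet_of_imp_face_of[OF assms(2)]])

lemma finite_facets_convex_hull: "finite A \<Longrightarrow> finite {F. F facet_of (convex hull A)}"
  for A :: "'a::euclidean_space set"
  by (simp add: finite_polytope_facets polytope_convex_hull)

text \<open>A facet is recovered from its affine hull by intersecting with the body, hence from any
  affine basis, which is a set of at most \<open>DIM('a)\<close> points of \<open>A\<close>.\<close>

lemma num_facets_convex_hull_le:
  fixes A :: "'a::euclidean_space set"
  assumes A: "finite A"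
  shows "num_facets (convex hull A) \<le> (card A + 1) ^ DIM('a)"
proof -
  let ?FF = "{F. F facet_of (convex hull A)}"
  have "\<forall>F\<in>?FF. \<exists>D. D \<subseteq> A \<and> affine hull D = affine hull F \<and> card D \<le> DIM('a)"
  proof
    fix F assume "F \<in> ?FF"
    then obtain D where "D \<subseteq> A \<inter> F" "affine hull D = affine hull F" "int (card D) = aff_dim (convex hull A)"
      using facet_affine_basis[OF A] by blast
    then show "\<exists>D. D \<subseteq> A \<and> affine hull D = affine hull F \<and> card D \<le> DIM('a)"
      using aff_dim_le_DIM[of "convex hull A"] by (intro exI[of _ D]) auto
  qed
  then obtain g where g: "\<And>F. F \<in> ?FF \<Longrightarrow> g F \<subseteq> A \<and> affine hull (g F) = affine hull F \<and> card (g F) \<le> DIM('a)"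
    by metis
  have "inj_on g ?FF"
  proof (rule inj_onI)
    fix F F' assume F: "F \<in> ?FF" "F' \<in> ?FF" "g F = g F'"
    then have "affine hull F = affine hull F'" using g by metis
    then show "F = F'" using F facet_eq_affine_hull_Int[OF convex_convex_hull] by blast
  qed
  then have "card ?FF \<le> card {B. B \<subseteq> A \<and> card B \<le> DIM('a)}"
    using g A by (intro card_inj_on_le[of g]) (auto intro: finite_subset[of _ "Pow A"])
  then show ?thesis using card_subsets_le[OF A] by (auto simp: num_facets_def intro: order_trans)
qed

lemma dual_convex_hull: "dual_polytope (convex hull A) = {y. \<forall>x\<in>A. x \<bullet> y \<le> 1}"
proof -
  have "convex {x. x \<bullet> y \<le> 1}" for y :: 'a by (simp add: inner_commute[of _ y] convex_halfspace_le)
  then have "(\<forall>x\<in>convex hull A. x \<bullet> y \<le> 1) \<longleftrightarrow> (\<forall>x\<in>A. x \<bullet> y \<le> 1)" for y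
    using hull_minimal[of A "{x. x \<bullet> y \<le> 1}" convex] hull_inc[of _ A convex] by fastforce
  then show ?thesis by (simp add: dual_polytope_def)
qed

text \<open>The two almost sure properties of the sample that make its dual simple: any
  \<open>DIM('a)\<close> sample points are linearly independent, and no hyperplane missing the
  origin contains more than \<open>DIM('a)\<close> of them. Nothing is assumed about the origin
  being inside the hull, so the dual may be unbounded here.\<close>

locale general_position =
  fixes x :: "nat \<Rightarrow> 'a::euclidean_space" and m :: nat
  assumes indep: "I \<subseteq> {..<m} \<Longrightarrow> card I = DIM('a) \<Longrightarrow> (\<And>i. i \<in> I \<Longrightarrow> x i \<bullet> u = 0) \<Longrightarrow> u = 0"
    and few: "card {i. i < m \<and> x i \<bullet> y = 1} \<le> DIM('a)"
begin

definition K where "K = dual_polytope (sample_hull m x)"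
definition act where "act y = {i. i < m \<and> x i \<bullet> y = 1}"
abbreviation "V \<equiv> vertices K"

lemma finite_act [simp]: "finite (act y)" and act_sub: "act y \<subseteq> {..<m}"
  by (auto simp: act_def)

lemma in_K: "y \<in> K \<longleftrightarrow> (\<forall>i<m. x i \<bullet> y \<le> 1)"
  by (auto simp: K_def sample_hull_def dual_convex_hull)

lemma convex_K: "convex K"
proof -
  have "K = (\<Inter>i<m. {y. x i \<bullet> y \<le> 1})" by (auto simp: in_K)
  then show ?thesis by (auto intro!: convex_INT convex_halfspace_le)
qed

lemma closed_K: "closed K"
proof -
  have "K = (\<Inter>i<m. {y. x i \<bullet> y \<le> 1})" by (auto simp: in_K)
  then show ?thesis by (auto intro!: closed_INT closed_halfspace_le)
qed

lemma V_sub_K: "v \<in> V \<Longrightarrow> v \<in> K"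
  by (auto simp: vertices_def extreme_point_of_def)

text \<open>Only constraints that are inactive at \<open>y\<close> can be approached. They have
  positive slack and there are finitely many, so a common positive step length exists.\<close>

lemma move_into_K:
  assumes y: "y \<in> K" and u: "\<And>i. i \<in> act y \<Longrightarrow> x i \<bullet> u \<le> 0"
  obtains e where "e > 0" "y + e *\<^sub>R u \<in> K"
proof -
  define J where "J = {i. i < m \<and> x i \<bullet> u > 0}"
  \<comment> \<open>The value 1 serves only when no constraint is approached and the set of ratios
    is empty.\<close>
  define e where "e = Min (insert 1 ((\<lambda>i. (1 - x i \<bullet> y) / (x i \<bullet> u)) ` J))"
  have fin: "finite J" by (simp add: J_def)
  have lt: "x i \<bullet> y < 1" if "i \<in> J" for i
    using that y u[of i] by (force simp: J_def in_K act_def)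
  have "e > 0" unfolding e_def using fin lt by (subst Min_gr_iff) (auto simp: J_def)
  moreover have "x i \<bullet> (y + e *\<^sub>R u) \<le> 1" if i: "i < m" for i
  proof (cases "i \<in> J")
    case True
    then have "e \<le> (1 - x i \<bullet> y) / (x i \<bullet> u)" unfolding e_def using fin by (intro Min_le) auto
    then show ?thesis using True by (simp add: J_def inner_add_right field_simps)
  next
    case False
    then have "e * (x i \<bullet> u) \<le> 0" using i \<open>e > 0\<close> by (simp add: J_def mult_nonneg_nonpos)
    then show ?thesis using y i by (simp add: in_K inner_add_right add_increasing2 order_trans[of _ "x i \<bullet> y"])
  qed
  ultimately show ?thesis using that by (auto simp: in_K)
qed

lemma act_eq_imp_eq:
  assumes "card (act y) = DIM('a)" "\<And>i. i \<in> act y \<Longrightarrow> x i \<bullet> w = 1"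
  shows "w = y"
proof -
  have "w - y = 0"
    by (rule indep[OF act_sub assms(1)]) (use assms(2) in \<open>auto simp: act_def inner_diff_right\<close>)
  then show ?thesis by simp
qed

lemma orthogonal_exists:
  assumes "I \<subseteq> {..<m}" "card I < DIM('a)"
  obtains u where "u \<noteq> 0" "\<And>i. i \<in> I \<Longrightarrow> x i \<bullet> u = 0"
proof -
  have finI: "finite I" using assms finite_subset by auto
  have "dim (span (x ` I)) \<le> card (x ` I)" using finI by (simp add: dim_le_card')
  also have "\<dots> < DIM('a)" using assms card_image_le[OF finI, of x] by linarith
  finally have "span (x ` I) \<noteq> UNIV" by (metis dim_UNIV less_irrefl)
  then obtain u where "u \<noteq> 0" "\<And>z. z \<in> span (x ` I) \<Longrightarrow> u \<bullet> z = 0"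
    by (metis span_not_UNIV_orthogonal)
  then have "x i \<bullet> u = 0" if "i \<in> I" for i using that by (metis inner_commute span_base imageI)
  then show ?thesis using that[of u] \<open>u \<noteq> 0\<close> by blast
qed

text \<open>With fewer active constraints there is a direction orthogonal to all of them, and
  \<open>y\<close> can move both ways along it. With \<open>DIM('a)\<close> active ones, the ends of
  a segment of \<open>K\<close> through \<open>y\<close> make all of them active too, and
  independence forces the ends to be \<open>y\<close>.\<close>

lemma vertex_iff: "y \<in> V \<longleftrightarrow> y \<in> K \<and> card (act y) = DIM('a)"
proof
  assume y: "y \<in> V"
  have yK: "y \<in> K" using y by (rule V_sub_K)
  have "\<not> card (act y) < DIM('a)"
  proof
    assume "card (act y) < DIM('a)"
    then obtain u where u: "u \<noteq> 0" "\<And>i. i \<in> act y \<Longrightarrow> x i \<bullet> u = 0"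
      by (metis orthogonal_exists[OF act_sub])
    obtain e where e: "e > 0" "y + e *\<^sub>R u \<in> K" using move_into_K[OF yK] u(2) by (metis order_refl)
    obtain e' where e': "e' > 0" "y + e' *\<^sub>R (- u) \<in> K"
      using move_into_K[OF yK, of "- u"] u(2) by auto
    have "y \<in> open_segment (y + e' *\<^sub>R (- u)) (y + e *\<^sub>R u)"
    proof -
      \<comment> \<open>The weight at which the two moves, by \<open>e\<close> along
        \<open>u\<close> and by \<open>e'\<close> against it, cancel.\<close>
      let ?t = "e' / (e + e')"
      have "(1 - t) *\<^sub>R (y + e' *\<^sub>R (- u)) + t *\<^sub>R (y + e *\<^sub>R u) = y + (t * e - (1 - t) * e') *\<^sub>R u" for t
        by (simp add: algebra_simps)
      moreover have "?t * e - (1 - ?t) * e' = 0" using e e' by (simp add: field_simps)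
      ultimately have "y = (1 - ?t) *\<^sub>R (y + e' *\<^sub>R (- u)) + ?t *\<^sub>R (y + e *\<^sub>R u)"
        by simp
      moreover have "y + e' *\<^sub>R (- u) \<noteq> y + e *\<^sub>R u"
      proof
        assume "y + e' *\<^sub>R (- u) = y + e *\<^sub>R u"
        then have "(e + e') *\<^sub>R u = 0" by (simp add: algebra_simps)
        then show False using u e e' by auto
      qed
      ultimately show ?thesis using e e' by (auto simp: in_segment intro!: exI[of _ ?t])
    qed
    then show False using y e e' by (auto simp: vertices_def extreme_point_of_def)
  qed
  moreover have "card (act y) \<le> DIM('a)" unfolding act_def by (rule few)
  ultimately show "y \<in> K \<and> card (act y) = DIM('a)" using yK by simp
next
  assume y: "y \<in> K \<and> card (act y) = DIM('a)"
  have "y \<notin> open_segment a b" if ab: "a \<in> K" "b \<in> K" for a b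
  proof
    assume "y \<in> open_segment a b"
    then obtain t where t: "0 < t" "t < 1" "y = (1 - t) *\<^sub>R a + t *\<^sub>R b" "a \<noteq> b" by (auto simp: in_segment)
    have "x i \<bullet> a = 1" if i: "i \<in> act y" for i
    proof -
      have le: "x i \<bullet> a \<le> 1" "x i \<bullet> b \<le> 1" and eq: "(1 - t) * (x i \<bullet> a) + t * (x i \<bullet> b) = 1"
        using i ab t(3) by (auto simp: in_K act_def inner_add_right)
      have "t * (x i \<bullet> b) \<le> t" using le t by simp
      then have "(1 - t) * (x i \<bullet> a) \<ge> (1 - t) * 1" using eq by (simp add: algebra_simps)
      then show ?thesis using le t by simp
    qed
    then have "a = y" using y act_eq_imp_eq by blast
    then show False using t by (simp add: algebra_simps)
  qed
  then show "y \<in> V" using y by (auto simp: vertices_def extreme_point_of_def)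
qed

lemma vertexD: "v \<in> V \<Longrightarrow> card (act v) = DIM('a)" "v \<in> V \<Longrightarrow> i < m \<Longrightarrow> x i \<bullet> v \<le> 1"
  by (auto simp: vertex_iff in_K)

lemma inj_on_act: "inj_on act V"
proof (rule inj_onI)
  fix v w assume v: "v \<in> V" and w: "w \<in> V" and eq: "act v = act w"
  show "v = w"
  proof (rule act_eq_imp_eq)
    show "card (act w) = DIM('a)" by (rule vertexD[OF w])
    show "x i \<bullet> v = 1" if "i \<in> act w" for i using that unfolding eq[symmetric] by (simp add: act_def)
  qed
qed

lemma finite_V [simp]: "finite V"
  by (rule inj_on_finite[OF inj_on_act, of "Pow {..<m}"]) (use act_sub in auto)

lemma card_V_le: "card V \<le> (m + 1) ^ DIM('a)"
proof -
  have "card V \<le> card {I. I \<subseteq> {..<m} \<and> card I \<le> DIM('a)}"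
    using act_sub vertexD by (intro card_inj_on_le[OF inj_on_act]) auto
  also have "\<dots> \<le> (card {..<m} + 1) ^ DIM('a)" by (rule card_subsets_le) simp
  finally show ?thesis by simp
qed

text \<open>The edge relation of a simple polytope in combinatorial form: an edge is where all but
  one of the constraints active at its end remain active. This avoids handling edges as
  faces.\<close>

definition adj where
  "adj v w \<longleftrightarrow> v \<in> V \<and> w \<in> V \<and> v \<noteq> w \<and> card (act v \<inter> act w) = DIM('a) - 1"

lemma adj_sym: "adj v w \<Longrightarrow> adj w v"
  by (auto simp: adj_def Int_commute)

lemma adj_missing:
  assumes "adj v w"
  obtains i where "i \<in> act v" "i \<notin> act w" "act v - {i} \<subseteq> act w"
proof -
  have vw: "v \<in> V" "w \<in> V" "v \<noteq> w" "card (act v \<inter> act w) = DIM('a) - 1" using assms by (auto simp: adj_def)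
  have "card (act v - act w) = card (act v) - card (act v \<inter> act w)"
    by (metis card_Diff_subset_Int finite_Int finite_act)
  also have "\<dots> = 1" using vw vertexD(1)[OF vw(1)] DIM_positive[where 'a = 'a] by simp
  finally obtain i where "act v - act w = {i}" by (metis card_1_singletonE)
  then show ?thesis using that[of i] by blast
qed

text \<open>Both neighbours lie on the edge line through \<open>v\<close> on which all constraints active at \<open>v\<close> other
  than \<open>i\<close> are active, so a constraint that becomes active at the nearer one is violated at the
  farther one.\<close>

lemma neighbour_unique:
  assumes vw: "adj v w" "i \<notin> act w" "act v - {i} \<subseteq> act w"
    and vw': "adj v w'" "i \<notin> act w'" "act v - {i} \<subseteq> act w'"
    and i: "i \<in> act v"
  shows "w = w'"
proof -
  have V: "v \<in> V" "w \<in> V" "w' \<in> V" using vw vw' by (auto simp: adj_def)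
  have im: "i < m" using i by (simp add: act_def)
  have neg: "x i \<bullet> (w - v) < 0" if "w \<in> V" "i \<notin> act w" for w
    using vertexD(2)[OF that(1) im] that(2) i im by (auto simp: act_def inner_diff_right)
  \<comment> \<open>Both neighbours lie on one line through \<open>v\<close>; \<open>c\<close> is
    the ratio of their distances from \<open>v\<close>, measured by the slack of the abandoned
    constraint \<open>i\<close>.\<close>
  define c where "c = (x i \<bullet> (w - v)) / (x i \<bullet> (w' - v))"
  have cpos: "c > 0" using neg[OF V(2) vw(2)] neg[OF V(3) vw'(2)] by (simp add: c_def zero_less_divide_iff)
  have "(w - v) - c *\<^sub>R (w' - v) = 0"
  proof (rule indep[OF act_sub vertexD(1)[OF V(1)]])
    fix j assume j: "j \<in> act v"
    show "x j \<bullet> (w - v - c *\<^sub>R (w' - v)) = 0"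
    proof (cases "j = i")
      case True
      then show ?thesis using neg[OF V(3) vw'(2)] by (simp add: inner_diff_right[of _ "w - v"] c_def del: inner_diff_right)
    next
      case False
      then have "j \<in> act w" "j \<in> act w'" using j vw vw' by auto
      then show ?thesis using j by (simp add: act_def inner_diff_right)
    qed
  qed
  then have weq: "w = v + c *\<^sub>R (w' - v)" by (simp add: algebra_simps)
  \<comment> \<open>Here \<open>u'\<close> is a neighbour of \<open>v\<close> and \<open>u\<close>
    lies beyond it. Applied with the two neighbours in both orders, this leaves only
    \<open>c = 1\<close>.\<close>
  have key: "\<not> e > 1" if e: "u = v + e *\<^sub>R (u' - v)" "u \<in> V" "u' \<in> V" "adj v u'" for e u u'
  proof
    assume e1: "e > 1"
    have "act u' \<noteq> act v" using inj_on_act V(1) e(3,4) by (auto simp: inj_on_def adj_def)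
    moreover have "card (act u') = card (act v)" using vertexD(1) V e by simp
    ultimately obtain k where k: "k \<in> act u'" "k \<notin> act v"
      by (metis card_subset_eq finite_act subsetI)
    then have km: "k < m" and ku: "x k \<bullet> u' = 1" by (auto simp: act_def)
    have "x k \<bullet> v < 1" using vertexD(2)[OF V(1) km] k km by (auto simp: act_def)
    then have "1 * (x k \<bullet> (u' - v)) < e * (x k \<bullet> (u' - v))"
      using e1 ku by (intro mult_strict_right_mono) (auto simp: inner_diff_right)
    then have "x k \<bullet> u > 1" using ku by (simp add: e(1) inner_add_right inner_diff_right)
    then show False using vertexD(2)[OF e(2) km] by simp
  qed
  have "\<not> c > 1" by (rule key[OF weq V(2,3) vw'(1)])
  moreover have "\<not> 1 / c > 1"
  proof (rule key[OF _ V(3,2) vw(1)])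
    show "w' = v + (1 / c) *\<^sub>R (w - v)" using weq cpos by simp
  qed
  ultimately have "c = 1" using cpos by simp
  then show ?thesis using weq by simp
qed

text \<open>A neighbour of \<open>v\<close> is determined by the one active constraint that it gives
  up, and \<open>v\<close> has \<open>DIM('a)\<close> active constraints.\<close>

lemma degree_le: "card {w \<in> V. adj v w} \<le> DIM('a)"
proof (cases "v \<in> V")
  case False
  then show ?thesis by (simp add: adj_def)
next
  case v: True
  have "\<forall>w\<in>{w \<in> V. adj v w}. \<exists>i. i \<in> act v \<and> i \<notin> act w \<and> act v - {i} \<subseteq> act w"
    using adj_missing by blast
  then obtain g where g: "\<And>w. w \<in> {w \<in> V. adj v w} \<Longrightarrow> g w \<in> act v \<and> g w \<notin> act w \<and> act v - {g w} \<subseteq> act w"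
    by metis
  have "inj_on g {w \<in> V. adj v w}"
  proof (rule inj_onI)
    fix w w' assume w: "w \<in> {w \<in> V. adj v w}" "w' \<in> {w \<in> V. adj v w}" "g w = g w'"
    show "w = w'"
      using w g[OF w(1)] g[OF w(2)] by (intro neighbour_unique[of v w "g w" w']) auto
  qed
  then have "card {w \<in> V. adj v w} \<le> card (act v)"
    using g by (intro card_inj_on_le[of g]) auto
  then show ?thesis using vertexD(1)[OF v] by simp
qed

text \<open>The edge at \<open>v\<close> that gives up constraint \<open>i\<close>. The value
  \<open>-1\<close> normalises its direction so that the slack of \<open>i\<close> grows at unit
  rate.\<close>

lemma edge_direction:
  assumes v: "v \<in> V" and i: "i \<in> act v"
  obtains u where "x i \<bullet> u = -1" "\<And>j. j \<in> act v \<Longrightarrow> j \<noteq> i \<Longrightarrow> x j \<bullet> u = 0"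
proof -
  have "card (act v - {i}) < DIM('a)" using i vertexD(1)[OF v] by (simp add: card_Diff_singleton)
  then obtain u where u: "u \<noteq> 0" "\<And>j. j \<in> act v - {i} \<Longrightarrow> x j \<bullet> u = 0"
    using orthogonal_exists[of "act v - {i}"] act_sub[of v] by blast
  have "x i \<bullet> u \<noteq> 0" using u indep[OF act_sub vertexD(1)[OF v], of u] by blast
  then show ?thesis using u by (intro that[of "(- 1 / (x i \<bullet> u)) *\<^sub>R u"]) auto
qed

text \<open>The edge directions are, up to sign, the basis dual to the active constraints, so the
  coordinates of \<open>w - v\<close> are the slacks at \<open>w\<close>. On \<open>K\<close> these
  are nonnegative: seen from \<open>v\<close>, the polytope lies in the cone spanned by the
  edges.\<close>

lemma edge_expansion:
  assumes v: "v \<in> V"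
    and u: "\<And>i. i \<in> act v \<Longrightarrow> x i \<bullet> u i = -1" "\<And>i j. i \<in> act v \<Longrightarrow> j \<in> act v \<Longrightarrow> j \<noteq> i \<Longrightarrow> x j \<bullet> u i = 0"
  shows "w - v = (\<Sum>i\<in>act v. (1 - x i \<bullet> w) *\<^sub>R u i)"
proof -
  have "w - v - (\<Sum>i\<in>act v. (1 - x i \<bullet> w) *\<^sub>R u i) = 0"
  proof (rule indep[OF act_sub vertexD(1)[OF v]])
    fix j assume j: "j \<in> act v"
    have "(\<Sum>i\<in>act v. (1 - x i \<bullet> w) * (x j \<bullet> u i)) = (\<Sum>i\<in>act v. if i = j then - (1 - x j \<bullet> w) else 0)"
      using u j by (intro sum.cong) auto
    then show "x j \<bullet> (w - v - (\<Sum>i\<in>act v. (1 - x i \<bullet> w) *\<^sub>R u i)) = 0"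
      using j by (simp add: inner_diff_right inner_sum_right act_def)
  qed
  then show ?thesis by simp
qed

end

text \<open>The additional condition says that every open half-space with the origin on its boundary
  contains a sample point, equivalently that the origin is interior to the sample hull.\<close>

locale bounded_dual = general_position +
  assumes bdd: "u \<noteq> 0 \<Longrightarrow> \<exists>i<m. x i \<bullet> u > 0"
begin

text \<open>By boundedness the ray meets a new constraint. At the first one,
  \<open>DIM('a) - 1\<close> old constraints and at least one new one are active, and
  \<open>few\<close> forbids more, so the point is a vertex adjacent to \<open>v\<close>.\<close>

lemma edge_endpoint:
  assumes v: "v \<in> V" and i: "i \<in> act v"
    and u: "x i \<bullet> u = -1" "\<And>j. j \<in> act v \<Longrightarrow> j \<noteq> i \<Longrightarrow> x j \<bullet> u = 0"
  obtains t where "t > 0" "adj v (v + t *\<^sub>R u)"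
proof -
  define J where "J = {j. j < m \<and> x j \<bullet> u > 0}"
  define h where "h j = (1 - x j \<bullet> v) / (x j \<bullet> u)" for j
  have "u \<noteq> 0" using u by auto
  then have J: "finite J" "J \<noteq> {}" using bdd[of u] by (auto simp: J_def)
  have nact: "j \<notin> act v" if "j \<in> J" for j using that u by (cases "j = i") (auto simp: J_def)
  have hpos: "h j > 0" if "j \<in> J" for j
    using that nact[OF that] vertexD(2)[OF v, of j] by (auto simp: J_def h_def act_def)
  define t where "t = Min (h ` J)"
  have "t \<in> h ` J" unfolding t_def using J by (intro Min_in) auto
  then obtain k where k: "k \<in> J" "t = h k" by auto
  have tpos: "t > 0" using k hpos by simp
  define w where "w = v + t *\<^sub>R u"
  have wK: "w \<in> K" unfolding in_K
  proof (intro allI impI)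
    fix j assume j: "j < m"
    show "x j \<bullet> w \<le> 1"
    proof (cases "j \<in> J")
      case True
      then have "t \<le> h j" unfolding t_def using J by (intro Min_le) auto
      then show ?thesis using True by (simp add: J_def h_def w_def inner_add_right field_simps)
    next
      case False
      then have "t * (x j \<bullet> u) \<le> 0" using j tpos by (simp add: J_def mult_nonneg_nonpos)
      moreover have "x j \<bullet> v \<le> 1" by (rule vertexD(2)[OF v j])
      ultimately show ?thesis by (simp add: w_def inner_add_right)
    qed
  qed
  have kw: "k \<in> act w" using k by (simp add: act_def w_def J_def h_def inner_add_right)
  have sub: "act v - {i} \<subseteq> act w" using u by (auto simp: act_def w_def inner_add_right)
  have iw: "i \<notin> act w" using u i tpos by (auto simp: act_def w_def inner_add_right)
  have cv: "card (act v) = DIM('a)" by (rule vertexD(1)[OF v])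
  have "DIM('a) = card (insert k (act v - {i}))"
    using i cv nact[OF k(1)] DIM_positive[where 'a = 'a] by (simp add: card_Diff_singleton)
  also have "\<dots> \<le> card (act w)" using kw sub by (intro card_mono) auto
  finally have "card (act w) = DIM('a)" using few[of w] by (simp add: act_def)
  then have "w \<in> V" using wK by (simp add: vertex_iff)
  moreover have "act v \<inter> act w = act v - {i}" using sub iw by auto
  moreover have "v \<noteq> w" using iw i by auto
  ultimately have "adj v w" using v i cv by (simp add: adj_def card_Diff_singleton)
  then show ?thesis using that tpos by (simp add: w_def)
qed

text \<open>The step of the simplex method. Since \<open>w - v\<close> is a combination of edge
  directions with nonnegative coefficients, an objective that increases towards \<open>w\<close>
  increases along some edge.\<close>

lemma improving_neighbour:
  assumes v: "v \<in> V" and w: "w \<in> K" and lt: "a \<bullet> v < a \<bullet> w"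
  obtains v' where "adj v v'" "a \<bullet> v < a \<bullet> v'"
proof -
  have "\<forall>i\<in>act v. \<exists>u. x i \<bullet> u = -1 \<and> (\<forall>j\<in>act v. j \<noteq> i \<longrightarrow> x j \<bullet> u = 0)"
    by (meson edge_direction[OF v])
  then obtain u where u: "\<And>i. i \<in> act v \<Longrightarrow> x i \<bullet> u i = -1"
      "\<And>i j. i \<in> act v \<Longrightarrow> j \<in> act v \<Longrightarrow> j \<noteq> i \<Longrightarrow> x j \<bullet> u i = 0" by metis
  have "0 < a \<bullet> (w - v)" using lt by (simp add: inner_diff_right)
  also have "\<dots> = (\<Sum>i\<in>act v. (1 - x i \<bullet> w) * (a \<bullet> u i))"
    by (subst edge_expansion[OF v u]) (auto simp: inner_sum_right)
  finally obtain i where i: "i \<in> act v" "0 < (1 - x i \<bullet> w) * (a \<bullet> u i)"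
    by (meson not_le sum_nonpos)
  have "0 \<le> 1 - x i \<bullet> w" using w i by (auto simp: in_K act_def)
  then have pos: "0 < a \<bullet> u i" using i(2) by (simp add: zero_less_mult_iff)
  obtain t where "t > 0" "adj v (v + t *\<^sub>R u i)" using edge_endpoint[OF v i(1) u(1)[OF i(1)] u(2)[OF i(1)]] by metis
  then show ?thesis using pos by (intro that[of "v + t *\<^sub>R u i"]) (auto simp: inner_add_right)
qed

text \<open>A hyperplane through \<open>v\<close> and all its neighbours would be parallel to every
  edge direction at \<open>v\<close>, and these span the space.\<close>

lemma closed_neighbourhood_full_dim:
  assumes v: "v \<in> V" and R: "insert v {w \<in> V. adj v w} \<subseteq> R"
  shows "aff_dim R = int DIM('a)"
proof (rule ccontr)
  assume "aff_dim R \<noteq> int DIM('a)"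
  then have "aff_dim R < int DIM('a)" using aff_dim_le_DIM[of R] by linarith
  then obtain a b where a: "a \<noteq> 0" "R \<subseteq> {z. a \<bullet> z = b}" by (metis aff_lowdim_subset_hyperplane)
  have "\<forall>i\<in>act v. \<exists>u. x i \<bullet> u = -1 \<and> (\<forall>j\<in>act v. j \<noteq> i \<longrightarrow> x j \<bullet> u = 0)"
    by (meson edge_direction[OF v])
  then obtain u where u: "\<And>i. i \<in> act v \<Longrightarrow> x i \<bullet> u i = -1"
      "\<And>i j. i \<in> act v \<Longrightarrow> j \<in> act v \<Longrightarrow> j \<noteq> i \<Longrightarrow> x j \<bullet> u i = 0" by metis
  have au: "a \<bullet> u i = 0" if i: "i \<in> act v" for i
  proof -
    obtain t where t: "t > 0" "adj v (v + t *\<^sub>R u i)" using edge_endpoint[OF v i u(1)[OF i] u(2)[OF i]] by metis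
    then have "v + t *\<^sub>R u i \<in> R" "v \<in> R" using R by (auto simp: adj_def)
    then have "a \<bullet> (v + t *\<^sub>R u i) = a \<bullet> v" using a(2) by auto
    then show ?thesis using t by (simp add: inner_add_right)
  qed
  have "a \<bullet> a = a \<bullet> ((v + a) - v)" by simp
  also have "\<dots> = 0" by (subst edge_expansion[OF v u]) (auto simp: inner_sum_right au)
  finally show False using a by simp
qed

text \<open>An unbounded sequence in \<open>K\<close>, normalised, accumulates at a unit vector on
  which no sample point has positive inner product, contrary to \<open>bdd\<close>.\<close>

lemma bounded_K: "bounded K"
proof (rule ccontr)
  assume "\<not> bounded K"
  then have "\<forall>n. \<exists>y\<in>K. norm y > real n" by (auto simp: bounded_iff not_le)
  then obtain y where y: "\<And>n. y n \<in> K" "\<And>n. norm (y n) > real n" by metis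
  have ne: "y n \<noteq> 0" for n using y(2)[of n] by auto
  define u where "u n = y n /\<^sub>R norm (y n)" for n
  have "u n \<in> sphere 0 1" for n using ne by (simp add: u_def)
  then obtain l r where l: "l \<in> sphere 0 1" "strict_mono r" "(u \<circ> r) \<longlonglongrightarrow> l"
    using compact_sphere[of "0::'a" 1] unfolding compact_def by metis
  have "l \<noteq> 0" using l by auto
  then obtain i where i: "i < m" "x i \<bullet> l > 0" using bdd by blast
  have "x i \<bullet> l \<le> 0"
  proof (rule tendsto_le[OF sequentially_bot])
    show "(\<lambda>n. x i \<bullet> (u \<circ> r) n) \<longlonglongrightarrow> x i \<bullet> l" by (intro tendsto_intros l)
    have "filterlim (\<lambda>n. real (r n)) at_top sequentially"
      by (rule filterlim_compose[OF filterlim_real_sequentially filterlim_subseq[OF l(2)]])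
    then show "(\<lambda>n. 1 / real (r n)) \<longlonglongrightarrow> 0" by (intro tendsto_divide_0[OF tendsto_const] filterlim_at_top_imp_at_infinity)
    have "x i \<bullet> u n \<le> 1 / real n" if n: "n > 0" for n
    proof -
      have "x i \<bullet> u n = (x i \<bullet> y n) / norm (y n)" by (simp add: u_def divide_inverse mult.commute)
      also have "\<dots> \<le> 1 / norm (y n)" using y(1)[of n] i by (intro divide_right_mono) (auto simp: in_K)
      also have "\<dots> \<le> 1 / real n" using y(2)[of n] n ne[of n] by (intro divide_left_mono mult_pos_pos) auto
      finally show ?thesis .
    qed
    moreover have "eventually (\<lambda>n. r n > 0) sequentially"
      using seq_suble[OF l(2)] by (intro eventually_sequentiallyI[of 1]) (metis One_nat_def Suc_le_eq less_le_trans)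
    ultimately show "eventually (\<lambda>n. x i \<bullet> (u \<circ> r) n \<le> 1 / real (r n)) sequentially"
      by (auto elim: eventually_mono)
  qed
  then show False using i by simp
qed

lemma K_eq_hull: "K = convex hull V"
proof -
  have "compact K" using bounded_K closed_K by (simp add: compact_eq_bounded_closed)
  then show ?thesis using Krein_Milman_Minkowski[OF _ convex_K] by (simp add: vertices_def)
qed

end

text \<open>The finitely many strict inequalities to be preserved define an open set containing
  \<open>a\<close>, while the directions with ties lie in finitely many hyperplanes, which are
  negligible and cannot cover it.\<close>

lemma generic_direction:
  fixes a :: "'a::euclidean_space"
  assumes "finite A"
  obtains a' where "inj_on ((\<bullet>) a') A"
    "\<And>v w. v \<in> A \<Longrightarrow> w \<in> A \<Longrightarrow> a \<bullet> w < a \<bullet> v \<Longrightarrow> a' \<bullet> w < a' \<bullet> v"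
proof -
  have eq: "(w - v) \<bullet> c = c \<bullet> w - c \<bullet> v" for v w c :: 'a
    by (metis inner_commute inner_diff_right)
  define P where "P = {(v, w) \<in> A \<times> A. a \<bullet> w < a \<bullet> v}"
  define Q where "Q = {(v, w) \<in> A \<times> A. v \<noteq> w}"
  have fin: "finite P" "finite Q"
    using assms by (auto simp: P_def Q_def intro: finite_subset[of _ "A \<times> A"])
  define O' where "O' = (\<Inter>(v, w)\<in>P. {c. (w - v) \<bullet> c < 0})"
  have "open O'" unfolding O'_def using fin by (intro open_INT) (auto intro: open_halfspace_lt)
  moreover have "a \<in> O'" by (auto simp: O'_def P_def inner_diff_left inner_commute[of _ a])
  ultimately have "\<not> negligible O'" using open_not_negligible by blast
  moreover have "negligible (\<Union>(v, w)\<in>Q. {c. (w - v) \<bullet> c = 0})"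
    using fin by (intro negligible_Union finite_imageI) (auto simp: Q_def intro!: negligible_hyperplane)
  ultimately obtain c where c: "c \<in> O'" "c \<notin> (\<Union>(v, w)\<in>Q. {c. (w - v) \<bullet> c = 0})"
    using negligible_subset[of _ O'] by blast
  show ?thesis
  proof
    show "inj_on ((\<bullet>) c) A"
      using c(2) by (intro inj_onI) (auto simp: Q_def eq)
    show "c \<bullet> w < c \<bullet> v" if "v \<in> A" "w \<in> A" "a \<bullet> w < a \<bullet> v" for v w
      using c(1) that by (auto simp: O'_def P_def eq)
  qed
qed

section \<open>Facets of the hull of selected vertices\<close>

context bounded_dual
begin

text \<open>Simplex steps connect the vertices beyond a hyperplane. A step exists only towards a
  strictly better vertex, so \<open>a\<close> is replaced by an objective \<open>a'\<close> without
  ties that refines its order.\<close>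

lemma linked_cut: "linked adj {v \<in> V. b < a \<bullet> v}"
proof -
  define S where "S = {v \<in> V. b < a \<bullet> v}"
  have finS: "finite S" by (simp add: S_def)
  obtain a' where a': "inj_on ((\<bullet>) a') V"
    "\<And>v w. v \<in> V \<Longrightarrow> w \<in> V \<Longrightarrow> a \<bullet> w < a \<bullet> v \<Longrightarrow> a' \<bullet> w < a' \<bullet> v"
    using generic_direction[OF finite_V] by metis
  have max: "\<exists>v\<in>B. \<forall>w\<in>B. a' \<bullet> w \<le> a' \<bullet> v" if "B \<subseteq> S" "B \<noteq> {}" for B
  proof -
    have "finite B" using that finS finite_subset by auto
    then have "Max ((\<bullet>) a' ` B) \<in> (\<bullet>) a' ` B" using that by (intro Max_in) auto
    moreover have "\<forall>w\<in>B. a' \<bullet> w \<le> Max ((\<bullet>) a' ` B)" using \<open>finite B\<close> by auto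
    ultimately show ?thesis by (metis imageE)
  qed
  have edge: "\<exists>v\<in>B. \<exists>v'\<in>S - B. adj v v'" if B: "B \<subseteq> S" "B \<noteq> {}" and z: "z \<in> S - B" "\<forall>w\<in>S. a' \<bullet> w \<le> a' \<bullet> z" for B z
  proof -
    obtain v where v: "v \<in> B" "\<forall>w\<in>B. a' \<bullet> w \<le> a' \<bullet> v" using max[OF B] by blast
    have vz: "v \<in> V" "z \<in> V" "v \<noteq> z" using v B z by (auto simp: S_def)
    have "a' \<bullet> v \<noteq> a' \<bullet> z" using a'(1) vz by (auto simp: inj_on_def)
    moreover have "a' \<bullet> v \<le> a' \<bullet> z" using z v B by auto
    ultimately have "a' \<bullet> v < a' \<bullet> z" by simp
    then obtain v' where v': "adj v v'" "a' \<bullet> v < a' \<bullet> v'"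
      using improving_neighbour[OF vz(1) V_sub_K[OF vz(2)]] by metis
    have "v' \<in> V" using v' by (simp add: adj_def)
    \<comment> \<open>A vertex outside \<open>S\<close> has a smaller \<open>a\<close>-value than
      \<open>v\<close>, hence a smaller \<open>a'\<close>-value, so the improvement stays beyond the
      hyperplane.\<close>
    have "v' \<in> S"
    proof (rule ccontr)
      assume "v' \<notin> S"
      then have "a \<bullet> v' < a \<bullet> v" using v B \<open>v' \<in> V\<close> by (auto simp: S_def)
      then show False using a'(2)[OF vz(1) \<open>v' \<in> V\<close>] v'(2) by simp
    qed
    moreover have "v' \<notin> B" using v(2) v'(2) by force
    ultimately show ?thesis using v v' by blast
  qed
  have "linked adj S"
    unfolding linked_def
  proof (intro allI impI)
    fix A assume A: "A \<subseteq> S" "A \<noteq> {} \<and> A \<noteq> S"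
    then obtain z where z: "z \<in> S" "\<forall>w\<in>S. a' \<bullet> w \<le> a' \<bullet> z" using max[of S] by blast
    show "\<exists>v\<in>A. \<exists>w\<in>S - A. adj v w"
    proof (cases "z \<in> A")
      case False
      then show ?thesis using edge[of A z] A z by blast
    next
      \<comment> \<open>The step leads out of the part that misses the maximiser \<open>z\<close>.
        If \<open>z\<close> is in \<open>A\<close>, this part is the complement, and symmetry turns
        the edge around.\<close>
      case True
      then obtain v v' where "v \<in> S - A" "v' \<in> S - (S - A)" "adj v v'"
        using edge[of "S - A" z] A z by blast
      then show ?thesis using adj_sym by blast
    qed
  qed
  then show ?thesis by (simp add: S_def)
qed

text \<open>If no vertex lies beyond the hyperplane of \<open>F\<close>, it supports
  \<open>K\<close>. A relatively interior point of \<open>F\<close> is then on the boundary of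
  \<open>K\<close>, so some constraint is active there and consequently on all of \<open>F\<close>.
  Equal dimensions make this constraint cut out exactly \<open>F\<close>. This is why at most
  \<open>m\<close> facets are of this kind.\<close>

lemma facet_on_constraint:
  assumes a: "a \<noteq> 0" and Rle: "R \<subseteq> V" and full: "aff_dim R = int DIM('a)"
    and F: "F facet_of (convex hull R)" "F = convex hull R \<inter> {z. a \<bullet> z = b}"
    and max: "\<And>v. v \<in> V \<Longrightarrow> a \<bullet> v \<le> b"
  shows "\<exists>i<m. F = convex hull R \<inter> {z. x i \<bullet> z = 1}"
proof -
  have Kle: "a \<bullet> z \<le> b" if "z \<in> K" for z
  proof -
    have "convex hull V \<subseteq> {z. a \<bullet> z \<le> b}"
      using max by (intro hull_minimal convex_halfspace_le) auto
    then show ?thesis using that K_eq_hull by auto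
  qed
  have RK: "convex hull R \<subseteq> K" using Rle hull_mono K_eq_hull by metis
  have Fc: "F face_of convex hull R" and Fne: "F \<noteq> {}" and Fdim: "aff_dim F = int DIM('a) - 1"
    using F(1) full by (auto simp: facet_of_def aff_dim_convex_hull)
  have cF: "convex F" using face_of_imp_convex[OF Fc] .
  obtain z0 where z0: "z0 \<in> rel_interior F" using rel_interior_eq_empty[OF cF] Fne by blast
  have z0F: "z0 \<in> F" using z0 rel_interior_subset by blast
  have z0K: "z0 \<in> K" using z0F RK F(2) by auto
  have "act z0 \<noteq> {}"
  proof
    assume "act z0 = {}"
    then obtain e where "e > 0" "z0 + e *\<^sub>R a \<in> K" using move_into_K[OF z0K, of a] by auto
    then have "a \<bullet> z0 + e * (a \<bullet> a) \<le> b" using Kle by (metis inner_add_right inner_scaleR_right)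
    moreover have "a \<bullet> z0 = b" using z0F F(2) by auto
    ultimately show False using \<open>e > 0\<close> a by (metis add_le_same_cancel1 inner_gt_zero_iff mult_pos_pos not_le)
  qed
  then obtain i where i: "i < m" "x i \<bullet> z0 = 1" by (auto simp: act_def)
  have Fi: "x i \<bullet> z = 1" if z: "z \<in> F" for z
  proof -
    have zK: "x i \<bullet> w \<le> 1" if "w \<in> F" for w using that i RK F(2) by (auto simp: in_K)
    \<comment> \<open>The segment from \<open>z\<close> to the relatively interior point
      \<open>z0\<close> can be prolonged inside \<open>F\<close>. As \<open>x i\<close> takes its
      maximal value 1 at \<open>z0\<close>, it cannot be smaller at \<open>z\<close>.\<close>
    obtain e where e: "e > 1" "(1 - e) *\<^sub>R z + e *\<^sub>R z0 \<in> F"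
      using convex_rel_interior_iff[OF cF Fne, of z0] z0 z by blast
    have "(1 - e) * (x i \<bullet> z) + e \<le> 1" using zK[OF e(2)] i by (simp add: inner_add_right)
    then have "(e - 1) * 1 \<le> (e - 1) * (x i \<bullet> z)" by (simp add: algebra_simps)
    then have "1 \<le> x i \<bullet> z" using e(1) by simp
    then show ?thesis using zK[OF z] by simp
  qed
  have xi: "x i \<noteq> 0" using i by auto
  have sub: "F \<subseteq> {z. x i \<bullet> z = 1}" using Fi by auto
  have "aff_dim F = aff_dim {z. x i \<bullet> z = 1}" using Fdim xi by (simp add: aff_dim_hyperplane)
  then have "affine hull F = affine hull {z. x i \<bullet> z = 1}" using aff_dim_eq_full_gen[OF sub] by simp
  also have "\<dots> = {z. x i \<bullet> z = 1}" by (simp add: affine_hyperplane)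
  finally have "F = convex hull R \<inter> {z. x i \<bullet> z = 1}"
    using facet_eq_affine_hull_Int[OF convex_convex_hull F(1)] by blast
  then show ?thesis using i by blast
qed

text \<open>The facets not lying on a constraint inject into pairs of a discarded cluster and
  \<open>d\<close> kept neighbours of it, because the second component spans the facet. If no closed
  neighbourhood is kept entirely, the hull may be lower-dimensional, and the polynomial bound for
  the hull of finitely many points is used.\<close>

lemma num_facets_selection_le:
  assumes R: "R \<subseteq> V"
  shows "num_facets (convex hull R) \<le> m
    + card {(S, D). S \<subseteq> V \<and> S \<noteq> {} \<and> linked adj S \<and> D \<subseteq> outer_boundary V adj S
        \<and> card D = DIM('a) \<and> S \<inter> R = {} \<and> D \<subseteq> R}
    + (if \<exists>v\<in>V. insert v {w \<in> V. adj v w} \<subseteq> R then 0 else (card V + 1) ^ DIM('a))"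
proof (cases "\<exists>v\<in>V. insert v {w \<in> V. adj v w} \<subseteq> R")
  case False
  have finR: "finite R" using R finite_V finite_subset by blast
  have "num_facets (convex hull R) \<le> (card R + 1) ^ DIM('a)" by (rule num_facets_convex_hull_le[OF finR])
  also have "\<dots> \<le> (card V + 1) ^ DIM('a)" using R by (intro power_mono add_right_mono card_mono) auto
  finally show ?thesis unfolding if_not_P[OF False] by simp
next
  case True
  then have full: "aff_dim R = int DIM('a)" using closed_neighbourhood_full_dim by blast
  have finR: "finite R" using R finite_V finite_subset by blast
  define FF where "FF = {F. F facet_of (convex hull R)}"
  define F1 where "F1 = (\<lambda>i. convex hull R \<inter> {z. x i \<bullet> z = 1}) ` {..<m}"
  define U where "U = {(S, D). S \<subseteq> V \<and> S \<noteq> {} \<and> linked adj S \<and> D \<subseteq> outer_boundary V adj S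
        \<and> card D = DIM('a) \<and> S \<inter> R = {} \<and> D \<subseteq> R}"
  have finU: "finite U"
    by (rule finite_subset[of _ "Pow V \<times> Pow V"]) (auto simp: U_def outer_boundary_def)
  have "\<forall>F\<in>FF - F1. \<exists>SD\<in>U. affine hull (snd SD) = affine hull F"
  proof
    fix F assume F: "F \<in> FF - F1"
    then have facet: "F facet_of (convex hull R)" by (simp add: FF_def)
    obtain a b where ab: "a \<noteq> 0" "convex hull R \<subseteq> {z. a \<bullet> z \<le> b}" "F = convex hull R \<inter> {z. a \<bullet> z = b}"
      using facet_of_polyhedron[OF polytope_imp_polyhedron[OF polytope_convex_hull[OF finR]] facet] by metis
    obtain D where D: "D \<subseteq> R \<inter> F" "affine hull D = affine hull F" "int (card D) = aff_dim (convex hull R)"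
      using facet_affine_basis[OF finR facet] by metis
    have cD: "card D = DIM('a)" using D(3) full by (simp add: aff_dim_convex_hull)
    define S where "S = {v \<in> V. b < a \<bullet> v}"
    have Sne: "S \<noteq> {}"
    proof
      assume "S = {}"
      then have "\<And>v. v \<in> V \<Longrightarrow> a \<bullet> v \<le> b" by (auto simp: S_def not_less)
      then have "\<exists>i<m. F = convex hull R \<inter> {z. x i \<bullet> z = 1}"
        by (rule facet_on_constraint[OF ab(1) R full facet ab(3)])
      then show False using F by (auto simp: F1_def)
    qed
    then obtain z where z: "z \<in> V" "b < a \<bullet> z" by (auto simp: S_def)
    \<comment> \<open>A vertex on the hyperplane is not optimal for \<open>a\<close>, since
      \<open>z\<close> lies strictly beyond. Hence it has a neighbour with a larger value, which
      belongs to \<open>S\<close>.\<close>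
    have "D \<subseteq> outer_boundary V adj S"
    proof
      fix v assume "v \<in> D"
      then have v: "v \<in> V" "a \<bullet> v = b" using D(1) R ab(3) by auto
      then obtain v' where v': "adj v v'" "a \<bullet> v < a \<bullet> v'"
        using improving_neighbour[OF v(1) V_sub_K[OF z(1)]] z by metis
      then have "v' \<in> S" using v by (auto simp: S_def adj_def)
      then show "v \<in> outer_boundary V adj S" using v v' adj_sym by (auto simp: outer_boundary_def S_def)
    qed
    moreover have "S \<inter> R = {}" using ab(2) hull_subset[of R convex] by (force simp: S_def)
    moreover have "linked adj S" unfolding S_def by (rule linked_cut)
    ultimately have "(S, D) \<in> U" using Sne D cD by (auto simp: U_def S_def)
    then show "\<exists>SD\<in>U. affine hull (snd SD) = affine hull F" using D(2) by force
  qed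
  then obtain g where g: "\<And>F. F \<in> FF - F1 \<Longrightarrow> g F \<in> U \<and> affine hull (snd (g F)) = affine hull F" by metis
  have "inj_on g (FF - F1)"
  proof (rule inj_onI)
    fix F F' assume F: "F \<in> FF - F1" "F' \<in> FF - F1" "g F = g F'"
    then have "affine hull F = affine hull F'" using g by metis
    then show "F = F'" using F facet_eq_affine_hull_Int[OF convex_convex_hull] unfolding FF_def by blast
  qed
  then have "card (FF - F1) \<le> card U" using g finU by (intro card_inj_on_le[of g]) auto
  moreover have "card F1 \<le> m" unfolding F1_def using card_image_le[of "{..<m}"] by simp
  moreover have "card FF \<le> card (FF - F1) + card F1"
  proof -
    have "finite FF" using finite_facets_convex_hull[OF finR] by (simp add: FF_def)
    then have "card FF \<le> card ((FF - F1) \<union> F1)" by (intro card_mono) (auto simp: F1_def)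
    then show ?thesis using card_Un_le order_trans by blast
  qed
  ultimately show ?thesis using True by (simp add: num_facets_def FF_def U_def)
qed

lemma expectation_num_facets_le:
  fixes q B C :: real
  assumes d: "2 \<le> DIM('a)" and q: "0 \<le> q" "q \<le> 1" "8 * (real DIM('a) - 1) * q < 1"
    and B: "\<And>k. 4 * (real DIM('a) * real k) ^ DIM('a) \<le> B * 2 ^ k"
    and C: "\<And>n. (real n + 1) ^ DIM('a) * ((1 + q) / root (DIM('a) + 1) 2) ^ n \<le> C"
  shows "measure_pmf.expectation (vertex_subset_hull K (1 - q)) (\<lambda>Q. real (num_facets Q))
    \<le> real m + real (card V) * (1 - q) ^ DIM('a)
        * (q + (8 * (real DIM('a) - 1) * q)\<^sup>2 * B / (1 - 8 * (real DIM('a) - 1) * q)) + C"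
proof -
  interpret bounded_degree_graph V adj "DIM('a)"
  proof
    show "adj v w \<Longrightarrow> adj w v" for v w by (rule adj_sym)
    show "card {w \<in> V. adj v w} \<le> DIM('a)" for v by (rule degree_le)
    show "\<not> adj v v" for v by (simp add: adj_def)
  qed (use d in auto)
  have "measure_pmf.expectation (vertex_subset_hull K (1 - q)) (\<lambda>Q. real (num_facets Q))
    = measure_pmf.expectation (Pi_pmf V False (\<lambda>_. bernoulli_pmf (1 - q)))
        (\<lambda>b. real (num_facets (convex hull {v \<in> V. b v})))"
    by (simp add: vertex_subset_hull_def)
  also have "\<dots> \<le> real m + real (card V) * (1 - q) ^ DIM('a)
        * (q + (8 * (real DIM('a) - 1) * q)\<^sup>2 * B / (1 - 8 * (real DIM('a) - 1) * q)) + C"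
  proof (rule expectation_selection_le[OF q B C])
    fix R assume "R \<subseteq> V"
    from num_facets_selection_le[OF this]
    show "real (num_facets (convex hull R)) \<le> real m
      + real (card {(S, D). S \<subseteq> V \<and> S \<noteq> {} \<and> linked adj S \<and> D \<subseteq> outer_boundary V adj S
          \<and> card D = DIM('a) \<and> S \<inter> R = {} \<and> D \<subseteq> R})
      + (if \<exists>v\<in>V. insert v {w \<in> V. adj v w} \<subseteq> R then 0 else (real (card V) + 1) ^ DIM('a))"
      by (rule order_trans[OF of_nat_mono]) simp
  qed
  finally show ?thesis .
qed

end

context general_position
begin

text \<open>The bound for samples whose dual may be unbounded; \<open>K\<close> still has at most
  \<open>(m + 1) ^ DIM('a)\<close> vertices.\<close>

lemma expectation_num_facets_crude:
  "measure_pmf.expectation (vertex_subset_hull K p) (\<lambda>Q. real (num_facets Q))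
    \<le> ((real m + 1) ^ DIM('a) + 1) ^ DIM('a)"
proof -
  let ?P = "Pi_pmf V False (\<lambda>_. bernoulli_pmf p)"
  have le: "real (num_facets (convex hull {v \<in> V. b v})) \<le> ((real m + 1) ^ DIM('a) + 1) ^ DIM('a)" for b
  proof -
    have "num_facets (convex hull {v \<in> V. b v}) \<le> (card {v \<in> V. b v} + 1) ^ DIM('a)"
      by (rule num_facets_convex_hull_le) simp
    also have "\<dots> \<le> ((m + 1) ^ DIM('a) + 1) ^ DIM('a)"
    proof (intro power_mono add_right_mono)
      have "card {v \<in> V. b v} \<le> card V" by (intro card_mono) auto
      then show "card {v \<in> V. b v} \<le> (m + 1) ^ DIM('a)" using card_V_le by linarith
    qed simp
    finally have "real (num_facets (convex hull {v \<in> V. b v})) \<le> real (((m + 1) ^ DIM('a) + 1) ^ DIM('a))"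
      by (rule of_nat_mono)
    then show ?thesis by (simp add: add.commute)
  qed
  have finP: "finite (set_pmf ?P)"
    by (rule finite_subset[OF set_Pi_pmf_subset'[OF finite_V]]) (auto intro!: finite_PiE_dflt)
  have "measure_pmf.expectation (vertex_subset_hull K p) (\<lambda>Q. real (num_facets Q))
    = measure_pmf.expectation ?P (\<lambda>b. real (num_facets (convex hull {v \<in> V. b v})))"
    by (simp add: vertex_subset_hull_def)
  also have "\<dots> \<le> measure_pmf.expectation ?P (\<lambda>_. ((real m + 1) ^ DIM('a) + 1) ^ DIM('a))"
    using le by (intro integral_mono integrable_measure_pmf_finite[OF finP]) auto
  finally show ?thesis by simp
qed

end

section \<open>Polarity between vertices of the dual and facets of the sample hull\<close>

context bounded_dual
begin

lemma aff_dim_sample_hull: "aff_dim (convex hull (x ` {..<m})) = int DIM('a)"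
proof (rule ccontr)
  assume "aff_dim (convex hull (x ` {..<m})) \<noteq> int DIM('a)"
  then have "aff_dim (convex hull (x ` {..<m})) < int DIM('a)"
    using aff_dim_le_DIM[of "convex hull (x ` {..<m})"] by linarith
  then obtain a b where a: "a \<noteq> 0" "convex hull (x ` {..<m}) \<subseteq> {z. a \<bullet> z = b}"
    by (metis aff_lowdim_subset_hyperplane)
  then have eq: "x i \<bullet> a = b" if "i < m" for i
  proof -
    have "x i \<in> convex hull (x ` {..<m})" using that by (simp add: hull_inc)
    then show ?thesis using a(2) by (auto simp: inner_commute[of a])
  qed
  obtain i j where "i < m" "x i \<bullet> a > 0" "j < m" "x j \<bullet> (- a) > 0"
    using bdd[OF a(1)] bdd[of "- a"] a(1) by auto
  then show False using eq[of i] eq[of j] by simp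
qed

lemma hull_le_of_dual: "v \<in> K \<Longrightarrow> z \<in> convex hull (x ` {..<m}) \<Longrightarrow> v \<bullet> z \<le> 1"
  by (simp add: K_def dual_polytope_def sample_hull_def inner_commute[of v])

text \<open>The hyperplane dual to a vertex \<open>v\<close> supports the sample hull and contains
  the \<open>DIM('a)\<close> independent points active at \<open>v\<close>, so it cuts out a facet.
  The hyperplane determines \<open>v\<close>.\<close>

lemma card_vertices_le_num_facets: "card V \<le> num_facets (sample_hull m x)"
proof -
  let ?P = "convex hull (x ` {..<m})"
  define g where "g v = ?P \<inter> {z. v \<bullet> z = 1}" for v
  have g: "g v facet_of ?P \<and> affine hull (g v) = {z. v \<bullet> z = 1}" if v: "v \<in> V" for v
  proof -
    have face: "g v face_of ?P" unfolding g_def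
      using hull_le_of_dual[OF V_sub_K[OF v]] by (intro face_of_Int_supporting_hyperplane_le convex_convex_hull) auto
    have ing: "x i \<in> g v" if "i \<in> act v" for i
      using that by (auto simp: g_def act_def inner_commute[of v] hull_inc)
    have "act v \<noteq> {}" using vertexD(1)[OF v] by force
    then obtain i where i: "i \<in> act v" by blast
    then have v0: "v \<noteq> 0" by (auto simp: act_def)
    have "\<not> aff_dim (g v) < int DIM('a) - 1"
    proof
      assume "aff_dim (g v) < int DIM('a) - 1"
      \<comment> \<open>Adding the origin raises the dimension by at most one. The resulting
        hyperplane contains the origin, so its normal is orthogonal to all active points, against
        independence.\<close>
      then have "aff_dim (insert 0 (g v)) < int DIM('a)" by (simp add: aff_dim_insert)
      then obtain a b where a: "a \<noteq> 0" "insert 0 (g v) \<subseteq> {z. a \<bullet> z = b}"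
        by (metis aff_lowdim_subset_hyperplane)
      have "x i \<bullet> a = 0" if "i \<in> act v" for i using ing[OF that] a(2) by (auto simp: inner_commute[of a])
      then show False using indep[OF act_sub vertexD(1)[OF v]] a(1) by blast
    qed
    moreover have sub: "g v \<subseteq> {z. v \<bullet> z = 1}" by (auto simp: g_def)
    then have "aff_dim (g v) \<le> int DIM('a) - 1" using aff_dim_subset[OF sub] v0 by (simp add: aff_dim_hyperplane)
    ultimately have dim: "aff_dim (g v) = int DIM('a) - 1" by simp
    then have "affine hull (g v) = affine hull {z. v \<bullet> z = 1}"
      using aff_dim_eq_full_gen[OF sub] v0 by (simp add: aff_dim_hyperplane)
    then have "affine hull (g v) = {z. v \<bullet> z = 1}" by (simp add: affine_hyperplane)
    then show ?thesis using face dim aff_dim_sample_hull ing[OF i] by (auto simp: facet_of_def)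
  qed
  have "inj_on g V"
  proof (rule inj_onI)
    fix v w assume vw: "v \<in> V" "w \<in> V" "g v = g w"
    then have eq: "{z. v \<bullet> z = 1} = {z. w \<bullet> z = 1}" using g by metis
    show "v = w"
    proof (rule act_eq_imp_eq[OF vertexD(1)[OF vw(2)]])
      fix i assume "i \<in> act w"
      then have "x i \<in> {z. w \<bullet> z = 1}" by (auto simp: act_def inner_commute[of w])
      then show "x i \<bullet> v = 1" using eq by (auto simp: inner_commute[of v])
    qed
  qed
  then show ?thesis using g finite_facets_convex_hull[of "x ` {..<m}"]
    by (auto simp: num_facets_def sample_hull_def intro!: card_inj_on_le[of g])
qed

lemma num_facets_le_card_vertices: "num_facets (sample_hull m x) \<le> card V"
proof -
  let ?P = "convex hull (x ` {..<m})"
  have fin: "finite (x ` {..<m})" by simp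
  have "{F. F facet_of ?P} \<subseteq> (\<lambda>v. ?P \<inter> {z. v \<bullet> z = 1}) ` V"
  proof clarify
    fix F assume F: "F facet_of ?P"
    obtain a b where ab: "a \<noteq> 0" "?P \<subseteq> {z. a \<bullet> z \<le> b}" "F = ?P \<inter> {z. a \<bullet> z = b}"
      using facet_of_polyhedron[OF polytope_imp_polyhedron[OF polytope_convex_hull[OF fin]] F] by metis
    have le: "x i \<bullet> a \<le> b" if "i < m" for i
    proof -
      have "x i \<in> ?P" using that by (simp add: hull_inc)
      then show ?thesis using ab(2) by (auto simp: inner_commute[of a])
    qed
    \<comment> \<open>The origin is interior, so the offset \<open>b\<close> is positive and the
      facet equation can be normalised to offset 1. The rescaled normal is the dual vertex.\<close>
    obtain i where "i < m" "x i \<bullet> a > 0" using bdd[OF ab(1)] by blast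
    then have b: "b > 0" using le by force
    define v where "v = a /\<^sub>R b"
    have Fv: "F = ?P \<inter> {z. v \<bullet> z = 1}" using ab(3) b by (auto simp: v_def field_simps)
    have vK: "v \<in> K" using le b by (auto simp: in_K v_def field_simps)
    obtain D where D: "D \<subseteq> x ` {..<m} \<inter> F" "int (card D) = aff_dim ?P"
      using facet_affine_basis[OF fin F] by metis
    have "D \<subseteq> x ` act v"
    proof
      fix z assume z: "z \<in> D"
      then obtain i where "i < m" "z = x i" using D(1) by auto
      moreover have "v \<bullet> z = 1" using z D(1) Fv by blast
      ultimately show "z \<in> x ` act v" by (auto simp: act_def inner_commute[of v])
    qed
    then have "card D \<le> card (x ` act v)" by (intro card_mono) auto
    also have "\<dots> \<le> card (act v)" by (rule card_image_le) simp
    finally have "DIM('a) \<le> card (act v)" using D(2) aff_dim_sample_hull by simp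
    then have "card (act v) = DIM('a)" using few[of v] by (simp add: act_def)
    then have "v \<in> V" using vK by (simp add: vertex_iff)
    then show "F \<in> (\<lambda>v. ?P \<inter> {z. v \<bullet> z = 1}) ` V" using Fv by blast
  qed
  then have "card {F. F facet_of ?P} \<le> card ((\<lambda>v. ?P \<inter> {z. v \<bullet> z = 1}) ` V)" by (intro card_mono) auto
  also have "\<dots> \<le> card V" by (rule card_image_le) simp
  finally show ?thesis by (simp add: num_facets_def sample_hull_def)
qed

lemma num_facets_sample_hull: "num_facets (sample_hull m x) = card V"
  using card_vertices_le_num_facets num_facets_le_card_vertices by (rule antisym[rotated])

end

subsection \<open>Measurability of the number of facets\<close>

text \<open>A face is encoded by the indices of the sample points on it. Whether a given index set
  is a face is a solvability question for linear inequalities in the sample, so the number of facets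
  becomes a finite sum of indicators, which gives measurability. The empty face and, with
  \<open>a = 0\<close>, the whole hull are included.\<close>

definition face_index :: "nat \<Rightarrow> (nat \<Rightarrow> 'a::euclidean_space) \<Rightarrow> nat set \<Rightarrow> bool" where
  "face_index m X I \<longleftrightarrow> I \<subseteq> {..<m} \<and> (\<exists>a b. (\<forall>i\<in>I. a \<bullet> X i = b) \<and> (\<forall>j\<in>{..<m} - I. a \<bullet> X j < b))"

definition facet_index :: "nat \<Rightarrow> (nat \<Rightarrow> 'a::euclidean_space) \<Rightarrow> nat set \<Rightarrow> bool" where
  "facet_index m X I \<longleftrightarrow> face_index m X I \<and> I \<noteq> {} \<and> I \<noteq> {..<m}
    \<and> (\<forall>J\<in>Pow {..<m}. I \<subset> J \<and> face_index m X J \<longrightarrow> J = {..<m})"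

text \<open>Every face of a polytope is exposed, so a supporting functional is available.\<close>

lemma face_index_of_face:
  assumes "F face_of sample_hull m X"
  shows "face_index m X {i. i < m \<and> X i \<in> F}"
proof -
  let ?P = "sample_hull m X"
  have "F exposed_face_of ?P"
    using assms by (simp add: sample_hull_def exposed_face_of_polyhedron polytope_imp_polyhedron polytope_convex_hull)
  then obtain a b where ab: "?P \<subseteq> {z. a \<bullet> z \<le> b}" "F = ?P \<inter> {z. a \<bullet> z = b}"
    by (auto simp: exposed_face_of_def)
  have "X i \<in> ?P" if "i < m" for i using that by (auto simp: sample_hull_def hull_inc)
  then have "X i \<in> ?P" "a \<bullet> X i \<le> b" if "i < m" for i using that ab(1) by auto
  then show ?thesis using ab(2) unfolding face_index_def
    by (intro conjI exI[of _ a] exI[of _ b]) (auto intro: le_neq_trans)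
qed

lemma face_of_face_index:
  assumes "face_index m X I"
  obtains F where "F face_of sample_hull m X" "{i. i < m \<and> X i \<in> F} = I"
proof -
  obtain a b where I: "I \<subseteq> {..<m}" and ab: "\<forall>i\<in>I. a \<bullet> X i = b" "\<forall>j\<in>{..<m} - I. a \<bullet> X j < b"
    using assms by (auto simp: face_index_def)
  let ?P = "sample_hull m X"
  have "?P \<subseteq> {z. a \<bullet> z \<le> b}" unfolding sample_hull_def
  proof (intro hull_minimal convex_halfspace_le image_subsetI)
    fix i assume "i \<in> {..<m}"
    then show "X i \<in> {z. a \<bullet> z \<le> b}" using ab by (cases "i \<in> I") (auto intro: less_imp_le)
  qed
  then have "?P \<inter> {z. a \<bullet> z = b} face_of ?P"
    by (intro face_of_Int_supporting_hyperplane_le) (auto simp: sample_hull_def)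
  moreover have "X i \<in> ?P" if "i < m" for i using that by (auto simp: sample_hull_def hull_inc)
  then have "{i. i < m \<and> X i \<in> ?P \<inter> {z. a \<bullet> z = b}} = I" using ab I by force
  ultimately show ?thesis using that by blast
qed

lemma face_eq_hull_index:
  assumes F: "F face_of sample_hull m X"
  shows "F = convex hull (X ` {i. i < m \<and> X i \<in> F})"
proof
  obtain S where S: "S \<subseteq> X ` {..<m}" "F = convex hull S"
    using F face_of_convex_hull_subset[OF finite_imp_compact] unfolding sample_hull_def by (metis finite_imageI finite_lessThan)
  have "S \<subseteq> X ` {i. i < m \<and> X i \<in> F}" using S hull_subset[of S convex] by auto
  then show "F \<subseteq> convex hull (X ` {i. i < m \<and> X i \<in> F})" using S hull_mono by metis
  show "convex hull (X ` {i. i < m \<and> X i \<in> F}) \<subseteq> F"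
    using face_of_imp_convex[OF F] by (intro hull_minimal) (auto simp: sample_hull_def)
qed

lemma facet_subset_eq:
  fixes F :: "'a::euclidean_space set"
  assumes "convex P" "F facet_of P" "F' facet_of P" "F \<subseteq> F'"
  shows "F = F'"
proof -
  have "aff_dim F = aff_dim F'" using assms by (simp add: facet_of_def)
  then have "affine hull F = affine hull F'" using aff_dim_eq_full_gen[OF assms(4)] by simp
  then show ?thesis using facet_eq_affine_hull_Int[OF assms(1)] assms(2,3) by blast
qed

text \<open>A face is the hull of the sample points it contains, so inclusion of faces is inclusion
  of index sets, and facets are the maximal nonempty proper faces on either side.\<close>

lemma bij_betw_facet_index:
  fixes X :: "nat \<Rightarrow> 'a::euclidean_space"
  shows "bij_betw (\<lambda>F. {i. i < m \<and> X i \<in> F}) {F. F facet_of sample_hull m X} {I. I \<subseteq> {..<m} \<and> facet_index m X I}"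
proof -
  let ?P = "sample_hull m X"
  let ?h = "\<lambda>F. {i. i < m \<and> X i \<in> F}"
  have cP: "convex ?P" by (simp add: sample_hull_def)
  have pP: "polyhedron ?P" by (simp add: sample_hull_def polytope_imp_polyhedron polytope_convex_hull)
  have PP: "F = ?P" if "F face_of ?P" "?h F = {..<m}" for F
    using face_eq_hull_index[OF that(1)] that(2) by (simp add: sample_hull_def)
  have hP: "?h ?P = {..<m}" by (auto simp: sample_hull_def hull_inc)
  have sub: "F \<subseteq> G" if "F face_of ?P" "G face_of ?P" "?h F \<subseteq> ?h G" for F G
    using hull_mono[OF image_mono[OF that(3)], of convex X]
    unfolding face_eq_hull_index[OF that(1), symmetric] face_eq_hull_index[OF that(2), symmetric] .
  have facet_neq: "?h F \<noteq> {} \<and> ?h F \<noteq> {..<m}" if F: "F facet_of ?P" for F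
  proof
    show "?h F \<noteq> {}"
    proof
      assume "?h F = {}"
      then have "F = {}" using face_eq_hull_index[OF facet_of_imp_face_of[OF F]] by (simp only: image_empty convex_hull_empty)
      then show False using F by (simp add: facet_of_def)
    qed
    show "?h F \<noteq> {..<m}" using PP[OF facet_of_imp_face_of[OF F]] F by (metis facet_of_irrefl)
  qed
  have "?h F \<in> {I. I \<subseteq> {..<m} \<and> facet_index m X I}" if F: "F facet_of ?P" for F
  proof -
    have Ff: "F face_of ?P" using F by (simp add: facet_of_def)
    have "J = {..<m}" if J: "?h F \<subset> J" "face_index m X J" for J
    proof (rule ccontr)
      assume Jm: "J \<noteq> {..<m}"
      obtain G where G: "G face_of ?P" "?h G = J" using face_of_face_index[OF J(2)] .
      have "F \<subseteq> G" using sub[OF Ff G(1)] G(2) J(1) by blast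
      moreover have "G \<noteq> {}" using G(2) J(1) by auto
      moreover have "G \<noteq> ?P" using hP G(2) Jm by auto
      ultimately obtain F' where F': "F' facet_of ?P" "G \<subseteq> F'"
        using face_of_polyhedron_subset_facet[OF pP G(1)] by metis
      have "F = F'" using facet_subset_eq[OF cP F F'(1)] \<open>F \<subseteq> G\<close> F'(2) by blast
      then have "F = G" using \<open>F \<subseteq> G\<close> F'(2) by blast
      then show False using G(2) J(1) by blast
    qed
    then have "facet_index m X (?h F)"
      unfolding facet_index_def using face_index_of_face[OF Ff] facet_neq[OF F] by blast
    then show ?thesis by simp blast
  qed
  moreover have "I \<in> ?h ` {F. F facet_of ?P}" if I: "I \<subseteq> {..<m}" "facet_index m X I" for I
  proof -
    obtain G where G: "G face_of ?P" "?h G = I" using face_of_face_index I(2) unfolding facet_index_def by metis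
    have "G \<noteq> {}" "G \<noteq> ?P" using I(2) G(2) hP by (auto simp: facet_index_def)
    then obtain F where F: "F facet_of ?P" "G \<subseteq> F" using face_of_polyhedron_subset_facet[OF pP G(1)] by metis
    have "I \<subseteq> ?h F" using G(2) F(2) by auto
    moreover have "\<not> I \<subset> ?h F"
      using I(2) face_index_of_face[OF facet_of_imp_face_of[OF F(1)]] facet_neq[OF F(1)] unfolding facet_index_def by blast
    ultimately show ?thesis using F(1) by blast
  qed
  moreover have "inj_on ?h {F. F facet_of ?P}"
  proof (rule inj_onI)
    fix F G assume "F \<in> {F. F facet_of ?P}" "G \<in> {F. F facet_of ?P}" "?h F = ?h G"
    then show "F = G" using sub[of F G] sub[of G F] by (auto simp: facet_of_def)
  qed
  ultimately show ?thesis by (auto simp: bij_betw_def)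
qed

text \<open>Compactness makes the infimum attained. Thus an uncountable existential quantifier is
  replaced by countable ones when \<open>T\<close> is countable.\<close>

lemma ex_nonpos_iff_dense:
  fixes f :: "'b::metric_space \<Rightarrow> real"
  assumes K: "compact K" and T: "T \<subseteq> K" "K \<subseteq> closure T" and f: "continuous_on K f"
  shows "(\<exists>p\<in>K. f p \<le> 0) \<longleftrightarrow> (\<forall>k::nat. \<exists>p\<in>T. f p < 1 / Suc k)"
proof
  assume "\<exists>p\<in>K. f p \<le> 0"
  then obtain p where p: "p \<in> K" "f p \<le> 0" by blast
  show "\<forall>k::nat. \<exists>p\<in>T. f p < 1 / Suc k"
  proof
    fix k :: nat
    obtain e where e: "e > 0" "\<And>q. q \<in> K \<Longrightarrow> dist q p < e \<Longrightarrow> dist (f q) (f p) < 1 / Suc k"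
      using f p(1) unfolding continuous_on_iff by (metis of_nat_0_less_iff zero_less_Suc zero_less_divide_1_iff)
    obtain q where "q \<in> T" "dist q p < e" using p(1) T(2) e(1) closure_approachable by blast
    then have "\<bar>f q - f p\<bar> < 1 / Suc k" using e(2)[of q] T(1) by (auto simp: dist_real_def)
    then show "\<exists>p\<in>T. f p < 1 / Suc k" using \<open>q \<in> T\<close> p(2) by (intro bexI[of _ q]) auto
  qed
next
  assume *: "\<forall>k::nat. \<exists>p\<in>T. f p < 1 / Suc k"
  then have "K \<noteq> {}" using T(1) by blast
  then obtain p where p: "p \<in> K" "\<And>q. q \<in> K \<Longrightarrow> f p \<le> f q" using continuous_attains_inf[OF K _ f] by blast
  have "f p < 1 / Suc k" for k using * p(2) T(1) by (meson le_less_trans subsetD)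
  then have "\<not> f p > 0" by (metis nat_approx_posE not_less_iff_gr_or_eq)
  then show "\<exists>p\<in>K. f p \<le> 0" using p(1) by (intro bexI[of _ p]) auto
qed

text \<open>Scaling \<open>(a, b)\<close> turns the strict inequalities into inequalities with gap
  1. The system then says that a continuous nonnegative penalty vanishes somewhere, and the closed
  balls exhaust the space of parameters by compact sets.\<close>

lemma face_index_iff:
  fixes X :: "nat \<Rightarrow> 'a::euclidean_space"
  assumes I: "I \<subseteq> {..<m}"
  defines "g \<equiv> \<lambda>X p. (\<Sum>i\<in>I. \<bar>fst p \<bullet> X i - snd p\<bar>) + (\<Sum>j\<in>{..<m} - I. max 0 (fst p \<bullet> X j - snd p + 1))"
  shows "face_index m X I \<longleftrightarrow> (\<exists>n::nat. \<exists>p\<in>cball 0 (real n). g X p \<le> 0)"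
proof
  have finI: "finite I" using I finite_subset by auto
  assume "face_index m X I"
  then obtain a b where ab: "\<forall>i\<in>I. a \<bullet> X i = b" "\<forall>j\<in>{..<m} - I. a \<bullet> X j < b" by (auto simp: face_index_def)
  \<comment> \<open>The smallest gap, with 1 as a default if there is no index outside
    \<open>I\<close>; dividing by it makes every gap at least 1.\<close>
  define c where "c = Min (insert 1 ((\<lambda>j. b - a \<bullet> X j) ` ({..<m} - I)))"
  have c: "c > 0" unfolding c_def using ab by (subst Min_gr_iff) auto
  have cle: "c \<le> b - a \<bullet> X j" if "j \<in> {..<m} - I" for j unfolding c_def using that by (intro Min_le) auto
  let ?p = "(a /\<^sub>R c, b / c)"
  have "g X ?p = 0"
  proof -
    have "\<bar>fst ?p \<bullet> X i - snd ?p\<bar> = 0" if "i \<in> I" for i using ab that by (simp add: field_simps)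
    moreover have "max 0 (fst ?p \<bullet> X j - snd ?p + 1) = 0" if "j \<in> {..<m} - I" for j
      using cle[OF that] c by (simp add: field_simps max_def)
    ultimately show ?thesis unfolding g_def by (simp add: sum.neutral)
  qed
  moreover obtain n where "norm ?p \<le> real n" using real_arch_simple by blast
  ultimately show "\<exists>n::nat. \<exists>p\<in>cball 0 (real n). g X p \<le> 0" by (intro exI[of _ n] bexI[of _ ?p]) auto
next
  have finI: "finite I" using I finite_subset by auto
  assume "\<exists>n::nat. \<exists>p\<in>cball 0 (real n). g X p \<le> 0"
  then obtain p where p: "g X p \<le> 0" by blast
  have nn: "0 \<le> (\<Sum>i\<in>I. \<bar>fst p \<bullet> X i - snd p\<bar>)" "0 \<le> (\<Sum>j\<in>{..<m} - I. max 0 (fst p \<bullet> X j - snd p + 1))"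
    by (auto intro: sum_nonneg)
  then have "(\<Sum>i\<in>I. \<bar>fst p \<bullet> X i - snd p\<bar>) = 0" "(\<Sum>j\<in>{..<m} - I. max 0 (fst p \<bullet> X j - snd p + 1)) = 0"
    using p unfolding g_def by linarith+
  then have "\<forall>i\<in>I. \<bar>fst p \<bullet> X i - snd p\<bar> = 0" "\<forall>j\<in>{..<m} - I. max 0 (fst p \<bullet> X j - snd p + 1) = 0"
    using finI by (simp_all add: sum_nonneg_eq_0_iff)
  moreover have "y < 0" if "max 0 (y + 1) = 0" for y :: real using that by (simp add: max_def split: if_splits)
  ultimately have "\<forall>i\<in>I. fst p \<bullet> X i = snd p" "\<forall>j\<in>{..<m} - I. fst p \<bullet> X j - snd p < 0"
    by (auto simp del: diff_less_0_iff_less)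
  then show "face_index m X I" unfolding face_index_def using I by auto
qed

lemma pred_face_index [measurable]:
  "Measurable.pred (PiM {..<m} (\<lambda>_. borel :: 'a::euclidean_space measure)) (\<lambda>X. face_index m X I)"
proof (cases "I \<subseteq> {..<m}")
  case False
  then show ?thesis by (simp add: face_index_def)
next
  case I: True
  define g :: "(nat \<Rightarrow> 'a) \<Rightarrow> 'a \<times> real \<Rightarrow> real" where
    "g = (\<lambda>X p. (\<Sum>i\<in>I. \<bar>fst p \<bullet> X i - snd p\<bar>) + (\<Sum>j\<in>{..<m} - I. max 0 (fst p \<bullet> X j - snd p + 1)))"
  have "\<forall>n::nat. \<exists>T :: ('a \<times> real) set. countable T \<and> T \<subseteq> cball 0 (real n) \<and> cball 0 (real n) \<subseteq> closure T"
    using separable by metis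
  then obtain T :: "nat \<Rightarrow> ('a \<times> real) set" where
    T: "\<And>n. countable (T n)" "\<And>n. T n \<subseteq> cball 0 (real n)" "\<And>n. cball 0 (real n) \<subseteq> closure (T n)" by metis
  have cont: "continuous_on S (g X)" for S X
    unfolding g_def by (intro continuous_intros continuous_on_max)
  have "(\<lambda>X. face_index m X I) = (\<lambda>X. \<exists>n. \<forall>k::nat. \<exists>p\<in>T n. g X p < 1 / Suc k)"
  proof
    fix X
    show "face_index m X I = (\<exists>n. \<forall>k::nat. \<exists>p\<in>T n. g X p < 1 / Suc k)"
      using face_index_iff[OF I, of X] ex_nonpos_iff_dense[OF compact_cball T(2) T(3) cont[of _ X]]
      unfolding g_def by simp
  qed
  moreover have "Measurable.pred (PiM {..<m} (\<lambda>_. borel)) (\<lambda>X. g X p < 1 / Suc k)" for p k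
  proof -
    have comp: "(\<lambda>X. X i) \<in> measurable (PiM {..<m} (\<lambda>_. borel :: 'a measure)) borel" if "i < m" for i
      by (rule measurable_component_singleton) (simp add: that)
    have "(\<lambda>X. \<bar>fst p \<bullet> X i - snd p\<bar>) \<in> borel_measurable (PiM {..<m} (\<lambda>_. borel :: 'a measure))"
      "(\<lambda>X. max 0 (fst p \<bullet> X i - snd p + 1)) \<in> borel_measurable (PiM {..<m} (\<lambda>_. borel :: 'a measure))"
      if "i < m" for i
      using comp[OF that] by measurable
    then have "(\<lambda>X. g X p) \<in> borel_measurable (PiM {..<m} (\<lambda>_. borel :: 'a measure))"
      unfolding g_def using I by (intro borel_measurable_add borel_measurable_sum) auto
    then show ?thesis by measurable
  qed
  ultimately show ?thesis
    using T(1) by (simp only:) (intro pred_intros_countable pred_intros_countable_bounded; simp)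
qed

lemma borel_measurable_num_facets:
  "(\<lambda>X. real (num_facets (sample_hull m X)))
    \<in> borel_measurable (PiM {..<m} (\<lambda>_. borel :: 'a::euclidean_space measure))"
proof -
  have "real (num_facets (sample_hull m X)) = (\<Sum>I\<in>Pow {..<m}. if facet_index m X I then 1 else 0)"
    for X :: "nat \<Rightarrow> 'a"
  proof -
    have "num_facets (sample_hull m X) = card {I. I \<subseteq> {..<m} \<and> facet_index m X I}"
      unfolding num_facets_def using bij_betw_same_card[OF bij_betw_facet_index] .
    also have "{I. I \<subseteq> {..<m} \<and> facet_index m X I} = {I \<in> Pow {..<m}. facet_index m X I}" by auto
    finally show ?thesis by (simp add: sum.If_cases Int_def)
  qed
  moreover have [measurable]: "Measurable.pred (PiM {..<m} (\<lambda>_. borel :: 'a measure)) (\<lambda>X. facet_index m X I)" for I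
    unfolding facet_index_def by measurable
  ultimately show ?thesis by simp
qed

subsection \<open>The uniform distribution on the sphere\<close>

lemma distr_lborel_reflect: "distr lborel borel (\<lambda>y. t - y) = (lborel :: 'a::euclidean_space measure)"
  using lborel_affine[of "-1" t] by (simp add: density_1)

text \<open>The image measure \<open>N\<close> is again translation invariant, and Fubini shows that
  two such measures are proportional. The unit ball is mapped to itself and has finite positive
  volume, so the factor is 1.\<close>

lemma distr_lborel_orthogonal:
  fixes R :: "'a::euclidean_space \<Rightarrow> 'a"
  assumes R: "orthogonal_transformation R"
  shows "distr lborel borel R = (lborel :: 'a measure)"
proof -
  define N where "N = distr lborel borel R"
  have lin: "linear R" using R by (rule orthogonal_transformation_linear)
  then have mR [measurable]: "R \<in> borel_measurable borel"
    by (intro borel_measurable_continuous_onI linear_continuous_on linear_conv_bounded_linear[THEN iffD1])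
  have bij: "bij R" using R by (rule orthogonal_transformation_bij)
  have linv: "linear (inv R)" using orthogonal_transformation_inv[OF R] by (rule orthogonal_transformation_linear)
  then have mRi [measurable]: "inv R \<in> borel_measurable borel"
    by (intro borel_measurable_continuous_onI linear_continuous_on linear_conv_bounded_linear[THEN iffD1])
  have setsN [measurable_cong]: "sets N = sets borel" by (simp add: N_def)
  \<comment> \<open>Fubini needs \<open>N\<close> to be sigma-finite; this is inherited from its
    image under the inverse map, which is \<open>lborel\<close>.\<close>
  have "distr N lborel (inv R) = lborel"
  proof -
    have "distr N lborel (inv R) = distr lborel lborel (inv R \<circ> R)"
      unfolding N_def by (rule distr_distr) simp_all
    also have "inv R \<circ> R = (\<lambda>x. x)" using bij by (simp add: bij_is_inj id_def)
    finally show ?thesis by (simp add: distr_id2)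
  qed
  then have "sigma_finite_measure (distr N lborel (inv R))"
    by (simp add: lborel.sigma_finite_measure_axioms)
  then interpret N: sigma_finite_measure N
    by (rule sigma_finite_measure_distr) measurable
  interpret pair_sigma_finite N lborel ..
  have Nplus: "distr N borel ((+) c) = N" for c
  proof -
    have "distr N borel ((+) c) = distr lborel borel (\<lambda>x. c + R x)"
      unfolding N_def by (subst distr_distr) (auto simp: o_def)
    also have "(\<lambda>x. c + R x) = R \<circ> ((+) (inv R c))"
      using lin bij by (auto simp: linear_add bij_is_surj surj_f_inv_f)
    also have "distr lborel borel (R \<circ> ((+) (inv R c))) = distr (distr lborel borel ((+) (inv R c))) borel R"
      by (subst distr_distr) auto
    finally show ?thesis by (simp add: lborel_distr_plus N_def)
  qed
  have key: "emeasure N A * emeasure lborel B = emeasure N B * emeasure lborel A"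
    if [measurable]: "A \<in> sets borel" "B \<in> sets borel" for A B
  proof -
    have "emeasure N A * emeasure lborel B = (\<integral>\<^sup>+x. indicator A x * emeasure lborel B \<partial>N)"
      by (simp add: nn_integral_multc)
    also have "\<dots> = (\<integral>\<^sup>+x. \<integral>\<^sup>+y. indicator A x * indicator B (x + y) \<partial>lborel \<partial>N)"
    proof (rule nn_integral_cong)
      fix x
      have "emeasure lborel B = (\<integral>\<^sup>+y. indicator B y \<partial>distr lborel borel ((+) x))"
        by (simp add: lborel_distr_plus)
      also have "\<dots> = (\<integral>\<^sup>+y. indicator B (x + y) \<partial>lborel)" by (subst nn_integral_distr) auto
      finally show "indicator A x * emeasure lborel B = (\<integral>\<^sup>+y. indicator A x * indicator B (x + y) \<partial>lborel)"
        by (simp add: nn_integral_cmult)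
    qed
    also have "\<dots> = (\<integral>\<^sup>+y. \<integral>\<^sup>+x. indicator A x * indicator B (x + y) \<partial>N \<partial>lborel)"
      by (rule Fubini'[symmetric]) measurable
    also have "\<dots> = (\<integral>\<^sup>+y. \<integral>\<^sup>+x. indicator A (x - y) * indicator B x \<partial>N \<partial>lborel)"
    proof (rule nn_integral_cong)
      fix y
      have "(\<integral>\<^sup>+x. indicator A (x - y) * indicator B x \<partial>N) = (\<integral>\<^sup>+x. indicator A (x - y) * indicator B x \<partial>distr N borel ((+) y))"
        by (simp add: Nplus)
      also have "\<dots> = (\<integral>\<^sup>+x. indicator A x * indicator B (x + y) \<partial>N)"
        by (subst nn_integral_distr) (auto simp: add.commute)
      finally show "(\<integral>\<^sup>+x. indicator A x * indicator B (x + y) \<partial>N) = (\<integral>\<^sup>+x. indicator A (x - y) * indicator B x \<partial>N)" by simp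
    qed
    also have "\<dots> = (\<integral>\<^sup>+x. \<integral>\<^sup>+y. indicator A (x - y) * indicator B x \<partial>lborel \<partial>N)"
      by (rule Fubini') measurable
    also have "\<dots> = (\<integral>\<^sup>+x. emeasure lborel A * indicator B x \<partial>N)"
    proof (rule nn_integral_cong)
      fix x
      have "emeasure lborel A = (\<integral>\<^sup>+y. indicator A y \<partial>distr lborel borel (\<lambda>y. x - y))"
        by (simp add: distr_lborel_reflect)
      also have "\<dots> = (\<integral>\<^sup>+y. indicator A (x - y) \<partial>lborel)" by (subst nn_integral_distr) auto
      finally show "(\<integral>\<^sup>+y. indicator A (x - y) * indicator B x \<partial>lborel) = emeasure lborel A * indicator B x"
        by (simp add: nn_integral_multc)
    qed
    also have "\<dots> = emeasure N B * emeasure lborel A" by (simp add: nn_integral_cmult mult.commute[of "emeasure N B"])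
    finally show ?thesis .
  qed
  let ?B = "ball 0 1 :: 'a set"
  have "R -` ?B = ?B" using R by (auto simp: orthogonal_transformation_norm)
  then have NB: "emeasure N ?B = emeasure lborel ?B" unfolding N_def by (subst emeasure_distr) auto
  have B0: "emeasure lborel ?B \<noteq> 0" "emeasure lborel ?B \<noteq> \<infinity>"
    using content_ball_pos[of 1 "0::'a"] emeasure_bounded_finite[of ?B] by (auto simp: measure_def)
  show ?thesis
  proof (rule measure_eqI)
    fix A assume "A \<in> sets (distr lborel borel R)"
    then have "emeasure N A * emeasure lborel ?B = emeasure lborel ?B * emeasure lborel A"
      using key[of A ?B] by (simp add: NB)
    then have "emeasure N A = emeasure lborel A"
      using B0 by (simp add: mult.commute[of "emeasure N A"] ennreal_mult_cancel_left)
    then show "emeasure (distr lborel borel R) A = emeasure lborel A" by (simp add: N_def)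
  qed simp
qed

interpretation uniform_sphere: prob_space "uniform_sphere :: 'a::euclidean_space measure"
  by (rule prob_space_uniform_sphere)

lemma sets_uniform_sphere [simp, measurable_cong]: "sets uniform_sphere = sets borel"
  by (simp add: uniform_sphere_def)

lemma space_uniform_sphere [simp]: "space uniform_sphere = UNIV"
  by (simp add: uniform_sphere_def)

abbreviation "proj_sphere \<equiv> \<lambda>x::'a::euclidean_space. x /\<^sub>R norm x"

lemma emeasure_uniform_sphere:
  fixes A :: "'a::euclidean_space set"
  assumes [measurable]: "A \<in> sets borel"
  shows "emeasure uniform_sphere A
    = emeasure lborel (ball 0 1 \<inter> proj_sphere -` A) / emeasure lborel (ball 0 1 :: 'a set)"
proof -
  have [measurable]: "proj_sphere -` A \<in> sets (borel :: 'a measure)"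
    using measurable_sets[of proj_sphere borel borel A] by simp
  show ?thesis unfolding uniform_sphere_def
    by (subst emeasure_distr) (auto simp: Int_commute)
qed

lemma distr_uniform_sphere_orthogonal:
  fixes R :: "'a::euclidean_space \<Rightarrow> 'a"
  assumes R: "orthogonal_transformation R"
  shows "distr uniform_sphere borel R = (uniform_sphere :: 'a measure)"
proof (rule measure_eqI)
  have lin: "linear R" using R by (rule orthogonal_transformation_linear)
  then have mR [measurable]: "R \<in> borel_measurable borel"
    by (intro borel_measurable_continuous_onI linear_continuous_on linear_conv_bounded_linear[THEN iffD1])
  fix A assume "A \<in> sets (distr uniform_sphere borel R)"
  then have A [measurable]: "A \<in> sets borel" by simp
  have RA [measurable]: "R -` A \<in> sets borel" using measurable_sets[OF mR A] by simp
  have pA [measurable]: "proj_sphere -` A \<in> sets (borel :: 'a measure)"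
    using measurable_sets[of proj_sphere borel borel A] by simp
  have "ball 0 1 \<inter> proj_sphere -` (R -` A) = R -` (ball 0 1 \<inter> proj_sphere -` A)"
    using R lin by (auto simp: orthogonal_transformation_norm linear_scale)
  then have "emeasure lborel (ball 0 1 \<inter> proj_sphere -` (R -` A)) = emeasure (distr lborel borel R) (ball 0 1 \<inter> proj_sphere -` A)"
    by (subst emeasure_distr) auto
  then show "emeasure (distr uniform_sphere borel R) A = emeasure uniform_sphere A"
    by (subst emeasure_distr) (auto simp: emeasure_uniform_sphere distr_lborel_orthogonal[OF R])
qed simp

section \<open>Decomposition along a unit vector, and cones over caps\<close>

definition perp :: "'a::euclidean_space \<Rightarrow> 'a \<Rightarrow> 'a" where
  "perp e V = V - (V \<bullet> e) *\<^sub>R e"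

text \<open>A linear map of determinant \<open>t ^ (DIM('a) - 1)\<close>. For small \<open>t\<close>
  it turns directions at a bounded slope to \<open>e\<close> into directions at slope of order
  \<open>t\<close>, so it resolves the sphere near \<open>e\<close>.\<close>

definition squeeze :: "'a::euclidean_space \<Rightarrow> real \<Rightarrow> 'a \<Rightarrow> 'a" where
  "squeeze e t V = (V \<bullet> e) *\<^sub>R e + t *\<^sub>R perp e V"

lemma continuous_perp [continuous_intros]: "continuous_on S f \<Longrightarrow> continuous_on S (\<lambda>x. perp e (f x))"
  unfolding perp_def by (intro continuous_intros)

lemma continuous_squeeze [continuous_intros]: "continuous_on S f \<Longrightarrow> continuous_on S (\<lambda>x. squeeze e t (f x))"
  unfolding squeeze_def by (intro continuous_intros)

lemma borel_measurable_perp [measurable]: "perp e \<in> borel_measurable borel"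
  by (intro borel_measurable_continuous_onI continuous_intros)

lemma borel_measurable_squeeze [measurable]: "squeeze e t \<in> borel_measurable borel"
  by (intro borel_measurable_continuous_onI continuous_intros)

context
  fixes e :: "'a::euclidean_space"
  assumes e: "norm e = 1"
begin

lemma inner_self_1: "e \<bullet> e = 1" using e by (simp add: norm_eq_1)

lemma perp_inner [simp]: "perp e V \<bullet> e = 0" "e \<bullet> perp e V = 0"
  by (simp_all add: perp_def inner_diff_left inner_diff_right inner_self_1 inner_commute)

lemma squeeze_inner [simp]: "squeeze e t V \<bullet> e = V \<bullet> e"
  by (simp add: squeeze_def inner_add_left inner_self_1)

lemma perp_squeeze [simp]: "perp e (squeeze e t V) = t *\<^sub>R perp e V"
  using squeeze_inner[of t V] by (simp add: perp_def[of e "squeeze e t V"]) (simp add: squeeze_def)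

lemma norm_perp: "(norm V)\<^sup>2 = (V \<bullet> e)\<^sup>2 + (norm (perp e V))\<^sup>2"
proof -
  have "V = (V \<bullet> e) *\<^sub>R e + perp e V" by (simp add: perp_def)
  then have "(norm V)\<^sup>2 = (norm ((V \<bullet> e) *\<^sub>R e + perp e V))\<^sup>2" by simp
  also have "\<dots> = (norm ((V \<bullet> e) *\<^sub>R e))\<^sup>2 + (norm (perp e V))\<^sup>2"
    by (rule norm_add_Pythagorean) (simp add: orthogonal_def)
  finally show ?thesis using e by simp
qed

lemma norm_squeeze: "(norm (squeeze e t V))\<^sup>2 = (V \<bullet> e)\<^sup>2 + t\<^sup>2 * (norm (perp e V))\<^sup>2"
  by (simp add: norm_perp[of "squeeze e t V"] power_mult_distrib)

lemma norm_perp_le: "norm (perp e V) \<le> norm V"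
  by (rule power2_le_imp_le) (simp_all add: norm_perp[of V])

lemma perp_add: "perp e (V + W) = perp e V + perp e W"
  by (simp add: perp_def inner_add_left algebra_simps)

lemma perp_scale: "perp e (c *\<^sub>R V) = c *\<^sub>R perp e V"
  by (simp add: perp_def algebra_simps)

lemma perp_self: "perp e e = 0"
  by (simp add: perp_def inner_self_1)

text \<open>The proof uses that the cone \<open>|perp e U| = t (U \<bullet> e)\<close> is starlike with centre \<open>-e\<close>.\<close>

lemma negligible_cone:
  assumes d: "2 \<le> DIM('a)"
  shows "negligible {U. norm (perp e U) = t * (U \<bullet> e)}"
proof (cases "t = 0")
  case True
  obtain a where a: "a \<noteq> 0" "e \<bullet> a = 0"
  proof -
    have "dim (span {e}) < DIM('a)" using dim_le_card[of "{e}"] d by simp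
    then show ?thesis using orthogonal_to_subspace_exists[of "{e}"] that
      by (metis dim_span insertI1 orthogonal_def span_base inner_commute)
  qed
  have "{U. norm (perp e U) = t * (U \<bullet> e)} \<subseteq> {U. a \<bullet> U = 0}"
  proof clarify
    fix U assume "norm (perp e U) = t * (U \<bullet> e)"
    then have "U = (U \<bullet> e) *\<^sub>R e" using True by (simp add: perp_def)
    then show "a \<bullet> U = 0" using a by (metis inner_commute inner_scaleR_right mult_zero_right)
  qed
  then show ?thesis using negligible_hyperplane[of a 0] a negligible_subset by blast
next
  case False
  show ?thesis
  proof (rule starlike_negligible[of _ "- e"])
    show "closed {U. norm (perp e U) = t * (U \<bullet> e)}"
      by (intro closed_Collect_eq continuous_intros)
    fix c :: real and x
    assume 1: "- e + c *\<^sub>R x \<in> {U. norm (perp e U) = t * (U \<bullet> e)}" "0 \<le> c"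
      and 2: "- e + x \<in> {U. norm (perp e U) = t * (U \<bullet> e)}"
    have p: "perp e (- e + c *\<^sub>R x) = c *\<^sub>R perp e x" for c
      using perp_add[of "- e" "c *\<^sub>R x"] perp_scale[of "-1" e] by (simp add: perp_scale perp_self)
    have "c * norm (perp e x) = t * (c * (x \<bullet> e) - 1)" using 1 p[of c] by (simp add: inner_add_left inner_self_1 algebra_simps)
    moreover have "norm (perp e x) = t * (x \<bullet> e - 1)" using 2 p[of 1] by (simp add: inner_add_left inner_self_1 algebra_simps)
    ultimately have "t * c = t" by (simp add: algebra_simps)
    then show "c = 1" using False by simp
  qed
qed

text \<open>With \<open>U = s e + w\<close>, \<open>w\<close> orthogonal to \<open>e\<close>, the condition \<open>proj U \<bullet> (r e) \<ge> 1\<close>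
  says \<open>|w| \<le> sqrt(r^2 - 1) s\<close>.\<close>

lemma cap_cone:
  assumes r: "1 < r"
  shows "r * (U \<bullet> e) \<ge> norm U \<longleftrightarrow> norm (perp e U) \<le> sqrt (r\<^sup>2 - 1) * (U \<bullet> e)" (is "?L = ?R")
proof (cases "0 \<le> U \<bullet> e")
  case True
  have r1: "1 \<le> r\<^sup>2" using r by (simp add: one_le_power)
  have "?L \<longleftrightarrow> (norm U)\<^sup>2 \<le> (r * (U \<bullet> e))\<^sup>2"
    using True r by (intro iffI power_mono) (auto intro: power2_le_imp_le)
  also have "\<dots> \<longleftrightarrow> (norm (perp e U))\<^sup>2 \<le> (sqrt (r\<^sup>2 - 1) * (U \<bullet> e))\<^sup>2"
    using r1 by (simp add: norm_perp[of U] power_mult_distrib algebra_simps)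
  also have "\<dots> \<longleftrightarrow> ?R"
    using True r1 by (intro iffI power_mono) (auto intro: power2_le_imp_le)
  finally show ?thesis .
next
  case False
  have "0 < sqrt (r\<^sup>2 - 1)" using r by (simp add: one_less_power)
  then have "sqrt (r\<^sup>2 - 1) * (U \<bullet> e) < 0" using False by (simp add: mult_less_0_iff)
  moreover have "r * (U \<bullet> e) < 0" using False r by (simp add: mult_less_0_iff)
  ultimately have "\<not> r * (U \<bullet> e) \<ge> norm U" "\<not> norm (perp e U) \<le> sqrt (r\<^sup>2 - 1) * (U \<bullet> e)"
    using norm_ge_zero[of U] norm_ge_zero[of "perp e U"] by linarith+
  then show ?thesis by simp
qed

end

text \<open>For a basis vector \<open>e\<close> the map is diagonal, so coordinatewise scaling of
  Lebesgue measure applies.\<close>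

lemma emeasure_squeeze:
  fixes A :: "'a::euclidean_space set"
  assumes e: "e \<in> Basis" and t: "t > 0" and A [measurable]: "A \<in> sets borel"
  shows "emeasure lborel A = ennreal (t ^ (DIM('a) - 1)) * emeasure lborel (squeeze e t -` A)"
proof -
  define c where "c j = (if j = e then 1 else t)" for j :: 'a
  have sq: "0 + (\<Sum>j\<in>Basis. (c j * (V \<bullet> j)) *\<^sub>R j) = squeeze e t V" for V
  proof -
    have "(\<Sum>j\<in>Basis. (c j * (V \<bullet> j)) *\<^sub>R j) = (V \<bullet> e) *\<^sub>R e + (\<Sum>j\<in>Basis - {e}. t *\<^sub>R (V \<bullet> j) *\<^sub>R j)"
      using e by (subst sum.remove[of _ e]) (auto simp: c_def intro!: sum.cong)
    also have "(\<Sum>j\<in>Basis - {e}. t *\<^sub>R (V \<bullet> j) *\<^sub>R j) = t *\<^sub>R (\<Sum>j\<in>Basis - {e}. (V \<bullet> j) *\<^sub>R j)"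
      by (simp only: scaleR_sum_right)
    also have "(\<Sum>j\<in>Basis - {e}. (V \<bullet> j) *\<^sub>R j) = perp e V"
      using e by (simp add: sum_diff1 euclidean_representation perp_def)
    finally show ?thesis by (simp add: squeeze_def)
  qed
  have pr: "(\<Prod>j\<in>Basis. \<bar>c j\<bar>) = t ^ (DIM('a) - 1)"
    using e t by (subst prod.remove[of _ e]) (auto simp: c_def)
  have "lborel = density (distr lborel borel (squeeze e t)) (\<lambda>_. ennreal (t ^ (DIM('a) - 1)))"
    using lborel_affine_euclidean[of c 0] t unfolding sq pr by (auto simp: c_def)
  then have "emeasure lborel A = emeasure (density (distr lborel borel (squeeze e t)) (\<lambda>_. ennreal (t ^ (DIM('a) - 1)))) A"
    by (rule arg_cong)
  also have "\<dots> = ennreal (t ^ (DIM('a) - 1)) * emeasure (distr lborel borel (squeeze e t)) A"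
    by (subst emeasure_density) (auto simp: nn_integral_cmult)
  also have "emeasure (distr lborel borel (squeeze e t)) A = emeasure lborel (squeeze e t -` A)"
    by (subst emeasure_distr) auto
  finally show ?thesis .
qed

lemma emeasure_scale:
  fixes A :: "'a::euclidean_space set"
  assumes c: "c > 0" and A [measurable]: "A \<in> sets borel"
  shows "emeasure lborel A = ennreal (c ^ DIM('a)) * emeasure lborel ((\<lambda>x. c *\<^sub>R x) -` A)"
proof -
  have "emeasure lborel A = emeasure (density (distr lborel borel (\<lambda>x. 0 + c *\<^sub>R x)) (\<lambda>_. ennreal (\<bar>c\<bar> ^ DIM('a)))) A"
    using lborel_affine[of c "0 :: 'a"] c by (metis less_irrefl)
  also have "\<dots> = ennreal (c ^ DIM('a)) * emeasure (distr lborel borel (\<lambda>x. c *\<^sub>R x)) A"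
    using c by (subst emeasure_density) (auto simp: nn_integral_cmult)
  also have "emeasure (distr lborel borel (\<lambda>x. c *\<^sub>R x)) A = emeasure lborel ((\<lambda>x. c *\<^sub>R x) -` A)"
    by (subst emeasure_distr) auto
  finally show ?thesis .
qed

abbreviation ball_vol :: "'a::euclidean_space itself \<Rightarrow> real" where
  "ball_vol _ \<equiv> measure lborel (ball 0 1 :: 'a set)"

lemma ball_vol_pos: "ball_vol TYPE('a::euclidean_space) > 0"
  using content_ball_pos[of 1 "0::'a"] by simp

lemma emeasure_ball_vol: "emeasure lborel (ball 0 1 :: 'a::euclidean_space set) = ennreal (ball_vol TYPE('a))"
  using emeasure_bounded_finite[of "ball 0 1 :: 'a set"] by (simp add: emeasure_eq_ennreal_measure)

section \<open>Measure of spherical caps\<close>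

definition cap :: "'a::euclidean_space \<Rightarrow> real" where
  "cap y = measure uniform_sphere {x. 1 \<le> x \<bullet> y}"

lemma cap_bounds: "0 \<le> cap y" "cap y \<le> 1"
  by (simp_all add: cap_def)

lemma cap_orthogonal:
  fixes R :: "'a::euclidean_space \<Rightarrow> 'a"
  assumes R: "orthogonal_transformation R"
  shows "cap (R y) = cap y"
proof -
  have mR [measurable]: "R \<in> borel_measurable borel"
    using orthogonal_transformation_linear[OF R]
    by (intro borel_measurable_continuous_onI linear_continuous_on linear_conv_bounded_linear[THEN iffD1])
  have "cap (R y) = measure (distr uniform_sphere borel R) {x. 1 \<le> x \<bullet> R y}"
    by (simp add: cap_def distr_uniform_sphere_orthogonal[OF R])
  also have "\<dots> = measure uniform_sphere (R -` {x. 1 \<le> x \<bullet> R y})"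
    by (subst measure_distr) auto
  also have "R -` {x. 1 \<le> x \<bullet> R y} = {x. 1 \<le> x \<bullet> y}"
    using R by (auto simp: orthogonal_transformation_def)
  finally show ?thesis by (simp add: cap_def)
qed

lemma cap_mono_scale:
  assumes "0 < s" "s \<le> t"
  shows "cap (s *\<^sub>R y) \<le> cap (t *\<^sub>R y)"
proof -
  have "{x. 1 \<le> x \<bullet> (s *\<^sub>R y)} \<subseteq> {x. 1 \<le> x \<bullet> (t *\<^sub>R y)}"
  proof clarify
    fix x assume 1: "1 \<le> x \<bullet> (s *\<^sub>R y)"
    then have "0 \<le> s * (x \<bullet> y)" by simp
    then have "0 \<le> x \<bullet> y" using assms by (simp add: zero_le_mult_iff)
    then have "s * (x \<bullet> y) \<le> t * (x \<bullet> y)" using assms by (intro mult_right_mono)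
    then show "1 \<le> x \<bullet> (t *\<^sub>R y)" using 1 by simp
  qed
  then show ?thesis unfolding cap_def by (intro uniform_sphere.finite_measure_mono) auto
qed

text \<open>The cone over a cap after \<open>squeeze\<close> has opened it to slope 1, truncated at
  height 1 instead of by the sphere. It is the limit shape for shrinking caps, so its volume
  supplies the constant of the cap asymptotics. The apex is removed because
  \<open>proj_sphere\<close> sends 0 to 0, which lies in no cap.\<close>

definition unit_cone :: "'a::euclidean_space \<Rightarrow> 'a set" where
  "unit_cone e = {V. norm (perp e V) \<le> V \<bullet> e \<and> V \<bullet> e < 1 \<and> V \<noteq> 0}"

context
  fixes e :: "'a::euclidean_space"
  assumes eB: "e \<in> Basis"
begin

lemma norm_e: "norm e = 1" using eB by simp

lemma unit_cone_sets [measurable]: "unit_cone e \<in> sets borel"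
  unfolding unit_cone_def by measurable

lemma unit_cone_bounded: "unit_cone e \<subseteq> ball 0 2"
proof
  fix V assume "V \<in> unit_cone e"
  then have V: "norm (perp e V) \<le> V \<bullet> e" "V \<bullet> e < 1" by (auto simp: unit_cone_def)
  then have 0: "0 \<le> V \<bullet> e" using norm_ge_zero order_trans by blast
  have "(norm V)\<^sup>2 = (V \<bullet> e)\<^sup>2 + (norm (perp e V))\<^sup>2" by (rule norm_perp[OF norm_e])
  also have "\<dots> \<le> 1\<^sup>2 + 1\<^sup>2" using V 0 by (intro add_mono power_mono) auto
  also have "\<dots> < 2\<^sup>2" by simp
  finally have "norm V < 2" by (rule power2_less_imp_less) simp
  then show "V \<in> ball 0 2" by simp
qed

lemma unit_cone_finite: "emeasure lborel (unit_cone e) = ennreal (measure lborel (unit_cone e))"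
proof -
  have "emeasure lborel (unit_cone e) < \<infinity>"
    using unit_cone_bounded by (intro emeasure_bounded_finite) (rule bounded_subset[OF bounded_ball])
  then show ?thesis by (simp add: emeasure_eq_ennreal_measure)
qed

lemma unit_cone_pos: "measure lborel (unit_cone e) > 0"
proof -
  let ?B = "ball ((1/2) *\<^sub>R e) (1/8)"
  have "?B \<subseteq> unit_cone e"
  proof
    fix V assume "V \<in> ?B"
    then have n: "norm (V - (1/2) *\<^sub>R e) < 1/8" by (simp add: dist_norm norm_minus_commute)
    have "\<bar>(V - (1/2) *\<^sub>R e) \<bullet> e\<bar> \<le> norm (V - (1/2) *\<^sub>R e)"
      using Cauchy_Schwarz_ineq2[of "V - (1/2) *\<^sub>R e" e] norm_e by simp
    then have 1: "\<bar>V \<bullet> e - 1/2\<bar> < 1/8" using n by (simp add: inner_diff_left inner_self_1[OF norm_e])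
    have "perp e V = perp e (V - (1/2) *\<^sub>R e)"
      by (simp add: perp_def inner_diff_left inner_self_1[OF norm_e] algebra_simps)
    then have "norm (perp e V) < 1/8" using norm_perp_le[OF norm_e, of "V - (1/2) *\<^sub>R e"] n by simp
    moreover have "V \<bullet> e > 3/8" "V \<bullet> e < 1" using 1 by linarith+
    ultimately show "V \<in> unit_cone e" by (auto simp: unit_cone_def)
  qed
  then have "emeasure lborel ?B \<le> emeasure lborel (unit_cone e)" by (intro emeasure_mono) auto
  moreover have "0 < emeasure lborel ?B"
    using content_ball_pos[of "1/8" "(1/2) *\<^sub>R e"] by (simp add: measure_def enn2real_positive_iff)
  ultimately have "0 < emeasure lborel (unit_cone e)" by simp
  then show ?thesis by (simp add: unit_cone_finite)
qed

text \<open>The measure of the cap is the volume fraction of the cone over it in the ball. In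
  squeezed coordinates the slope is 1 and the ball becomes an ellipsoid. The resulting set lies
  inside \<open>unit_cone e\<close> and contains the copy of that cone scaled by
  \<open>1 / r\<close>, which explains the factor \<open>(1 / r) ^ DIM('a)\<close>.\<close>

lemma cap_axis:
  assumes r: "1 < r"
  defines "t \<equiv> sqrt (r\<^sup>2 - 1)" and "k \<equiv> measure lborel (unit_cone e) / ball_vol TYPE('a)"
  shows "cap (r *\<^sub>R e) \<le> k * t ^ (DIM('a) - 1)" (is ?upper)
    and "k * t ^ (DIM('a) - 1) * (1 / r) ^ DIM('a) \<le> cap (r *\<^sub>R e)" (is ?lower)
proof -
  have t: "t > 0" using r by (simp add: t_def one_less_power)
  have rt: "r\<^sup>2 = 1 + t\<^sup>2" using r by (simp add: t_def one_le_power)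
  define A where "A = {V. norm (squeeze e t V) < 1 \<and> norm (perp e V) \<le> V \<bullet> e \<and> V \<noteq> 0}"
  have A [measurable]: "A \<in> sets borel" unfolding A_def by measurable
  have Ri: "V \<bullet> (r *\<^sub>R e) = r * (V \<bullet> e)" for V by simp
  have sq0: "squeeze e t V = 0 \<longleftrightarrow> V = 0" for V
  proof
    assume "squeeze e t V = 0"
    then have "V \<bullet> e = 0" "t *\<^sub>R perp e V = 0"
      using squeeze_inner[OF norm_e, of t V] perp_squeeze[OF norm_e, of t V] by (simp_all add: perp_def)
    then show "V = 0" using t by (simp add: perp_def)
  qed (simp add: squeeze_def perp_def)
  have set_eq: "squeeze e t -` (ball 0 1 \<inter> proj_sphere -` {x. 1 \<le> x \<bullet> (r *\<^sub>R e)}) = A"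
  proof (intro set_eqI)
    fix V
    let ?U = "squeeze e t V"
    have "1 \<le> (?U /\<^sub>R norm ?U) \<bullet> (r *\<^sub>R e) \<longleftrightarrow> norm (perp e V) \<le> V \<bullet> e" if "V \<noteq> 0"
    proof -
      have n: "norm ?U > 0" using that sq0 by simp
      have "1 \<le> (?U /\<^sub>R norm ?U) \<bullet> (r *\<^sub>R e) \<longleftrightarrow> norm ?U \<le> r * (?U \<bullet> e)"
        using n by (simp add: field_simps)
      also have "\<dots> \<longleftrightarrow> norm (perp e ?U) \<le> t * (?U \<bullet> e)" unfolding t_def by (rule cap_cone[OF norm_e r])
      also have "\<dots> \<longleftrightarrow> t * norm (perp e V) \<le> t * (V \<bullet> e)"
        using t by (simp add: perp_squeeze[OF norm_e] squeeze_inner[OF norm_e])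
      also have "\<dots> \<longleftrightarrow> norm (perp e V) \<le> V \<bullet> e" using t by simp
      finally show ?thesis .
    qed
    moreover have "\<not> 1 \<le> (?U /\<^sub>R norm ?U) \<bullet> (r *\<^sub>R e)" if "V = 0"
      using that by (simp add: squeeze_def perp_def)
    ultimately show "V \<in> squeeze e t -` (ball 0 1 \<inter> proj_sphere -` {x. 1 \<le> x \<bullet> (r *\<^sub>R e)}) \<longleftrightarrow> V \<in> A"
      by (auto simp: A_def)
  qed
  have pm [measurable]: "proj_sphere -` {x. 1 \<le> x \<bullet> (r *\<^sub>R e)} \<in> sets (borel :: 'a measure)"
    using measurable_sets[of proj_sphere borel borel "{x :: 'a. 1 \<le> x \<bullet> (r *\<^sub>R e)}"] by simp
  have em: "emeasure uniform_sphere {x. 1 \<le> x \<bullet> (r *\<^sub>R e)}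
     = ennreal (t ^ (DIM('a) - 1)) * emeasure lborel A / ennreal (ball_vol TYPE('a))"
    by (subst emeasure_uniform_sphere, simp, subst emeasure_squeeze[OF eB t]) (simp_all only: set_eq emeasure_ball_vol, measurable)
  have sub: "A \<subseteq> unit_cone e"
  proof
    fix V assume "V \<in> A"
    then have V: "norm (squeeze e t V) < 1" "norm (perp e V) \<le> V \<bullet> e" "V \<noteq> 0" by (auto simp: A_def)
    have "(V \<bullet> e)\<^sup>2 \<le> (norm (squeeze e t V))\<^sup>2" by (simp add: norm_squeeze[OF norm_e])
    then have "\<bar>V \<bullet> e\<bar> \<le> norm (squeeze e t V)" by (metis abs_le_square_iff abs_norm_cancel)
    then show "V \<in> unit_cone e" using V by (auto simp: unit_cone_def)
  qed
  have Ale: "emeasure lborel A \<le> emeasure lborel (unit_cone e)" using sub by (intro emeasure_mono) auto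
  then have Afin: "emeasure lborel A = ennreal (measure lborel A)"
    using unit_cone_finite by (intro emeasure_eq_ennreal_measure) (metis ennreal_neq_top neq_top_trans)
  have cap: "cap (r *\<^sub>R e) = t ^ (DIM('a) - 1) * measure lborel A / ball_vol TYPE('a)"
  proof -
    have "ennreal (cap (r *\<^sub>R e)) = emeasure uniform_sphere {x. 1 \<le> x \<bullet> (r *\<^sub>R e)}"
      by (simp add: cap_def uniform_sphere.emeasure_eq_measure)
    also have "\<dots> = ennreal (t ^ (DIM('a) - 1) * measure lborel A / ball_vol TYPE('a))"
      using t ball_vol_pos[where 'a = 'a] unfolding em Afin
      by (simp add: divide_ennreal ennreal_mult'[symmetric])
    finally show ?thesis using t by (simp add: cap_bounds)
  qed
  have le: "measure lborel A \<le> measure lborel (unit_cone e)"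
    using Ale unfolding Afin unit_cone_finite by simp
  show ?upper unfolding cap k_def using le t ball_vol_pos[where 'a = 'a]
    by (simp add: mult.commute divide_right_mono mult_left_mono)
  define c where "c = 1 / r"
  have c: "c > 0" using r by (simp add: c_def)
  \<comment> \<open>On the cone the squared norm of \<open>squeeze e t V\<close> is at most
    \<open>(1 + t ^ 2) * (V \<bullet> e) ^ 2\<close>, and \<open>1 + t ^ 2\<close> equals
    \<open>r ^ 2\<close>.\<close>
  have "unit_cone e \<subseteq> (\<lambda>x. c *\<^sub>R x) -` A"
  proof
    fix V assume "V \<in> unit_cone e"
    then have V: "norm (perp e V) \<le> V \<bullet> e" "V \<bullet> e < 1" "V \<noteq> 0" by (auto simp: unit_cone_def)
    then have s0: "0 \<le> V \<bullet> e" using norm_ge_zero order_trans by blast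
    have "(norm (squeeze e t (c *\<^sub>R V)))\<^sup>2 = c\<^sup>2 * ((V \<bullet> e)\<^sup>2 + t\<^sup>2 * (norm (perp e V))\<^sup>2)"
      by (simp add: norm_squeeze[OF norm_e] perp_scale[OF norm_e] power_mult_distrib algebra_simps)
    also have "\<dots> \<le> c\<^sup>2 * ((V \<bullet> e)\<^sup>2 + t\<^sup>2 * (V \<bullet> e)\<^sup>2)"
      using V by (intro mult_left_mono add_left_mono power_mono) auto
    also have "\<dots> = c\<^sup>2 * r\<^sup>2 * (V \<bullet> e)\<^sup>2" by (simp add: rt algebra_simps)
    also have "c\<^sup>2 * r\<^sup>2 = 1" using r by (simp add: c_def power_divide)
    also have "1 * (V \<bullet> e)\<^sup>2 < 1\<^sup>2" using V s0 by (simp add: power_less_one_iff abs_square_less_1)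
    finally have "norm (squeeze e t (c *\<^sub>R V)) < 1" by (rule power2_less_imp_less) simp
    then show "V \<in> (\<lambda>x. c *\<^sub>R x) -` A" using V c by (simp add: A_def perp_scale[OF norm_e])
  qed
  then have "ennreal (c ^ DIM('a)) * emeasure lborel (unit_cone e) \<le> ennreal (c ^ DIM('a)) * emeasure lborel ((\<lambda>x. c *\<^sub>R x) -` A)"
    using measurable_sets[of "\<lambda>x. c *\<^sub>R x" borel borel A] by (intro mult_left_mono emeasure_mono) auto
  also have "\<dots> = emeasure lborel A" by (rule emeasure_scale[OF c A, symmetric])
  finally have "c ^ DIM('a) * measure lborel (unit_cone e) \<le> measure lborel A"
    unfolding Afin unit_cone_finite using c by (simp add: ennreal_mult'[symmetric])
  then have "c ^ DIM('a) * measure lborel (unit_cone e) * (t ^ (DIM('a) - 1) / ball_vol TYPE('a))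
    \<le> measure lborel A * (t ^ (DIM('a) - 1) / ball_vol TYPE('a))"
    using t by (intro mult_right_mono) auto
  then show ?lower unfolding cap k_def by (simp add: c_def mult_ac)
qed

end


text \<open>A uniform point of the sphere is the projection of a uniform point of the ball, here
  written in squeezed coordinates. The density is a constant times the indicator of an ellipsoid,
  which makes it a change of variables for integrals over the sphere.\<close>

lemma proj_squeeze_representation:
  fixes e :: "'a::euclidean_space"
  assumes eB: "e \<in> Basis" and t: "t > 0"
  shows "uniform_sphere = distr (density lborel
      (\<lambda>V. ennreal (t ^ (DIM('a) - 1) / ball_vol TYPE('a)) * indicator (ball 0 1) (squeeze e t V)))
    borel (\<lambda>V. proj_sphere (squeeze e t V))" (is "_ = distr (density _ ?f) _ _")
proof (rule measure_eqI)
  fix A :: "'a set" assume "A \<in> sets uniform_sphere"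
  then have A [measurable]: "A \<in> sets borel" by simp
  have pA [measurable]: "proj_sphere -` A \<in> sets (borel :: 'a measure)"
    using measurable_sets[of proj_sphere borel borel A] by simp
  have sA [measurable]: "squeeze e t -` (ball 0 1 \<inter> proj_sphere -` A) \<in> sets borel"
    using measurable_sets[OF borel_measurable_squeeze, of "ball 0 1 \<inter> proj_sphere -` A" e t] by simp
  have fm: "?f \<in> borel_measurable lborel"
  proof -
    have "(\<lambda>V. indicator (ball 0 1) (squeeze e t V) :: ennreal) \<in> borel_measurable borel"
      by (rule measurable_compose[OF borel_measurable_squeeze]) (rule borel_measurable_indicator, rule borel_open, rule open_ball)
    then show ?thesis by measurable
  qed
  have "emeasure (distr (density lborel ?f) borel (\<lambda>V. proj_sphere (squeeze e t V))) A
    = emeasure (density lborel ?f) ((\<lambda>V. proj_sphere (squeeze e t V)) -` A)"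
    by (subst emeasure_distr) auto
  also have "\<dots> = (\<integral>\<^sup>+V. ?f V * indicator ((\<lambda>V. proj_sphere (squeeze e t V)) -` A) V \<partial>lborel)"
  proof (rule emeasure_density[OF fm])
    have "(\<lambda>V. proj_sphere (squeeze e t V)) \<in> borel_measurable borel" by measurable
    from measurable_sets[OF this A] show "(\<lambda>V. proj_sphere (squeeze e t V)) -` A \<in> sets lborel" by simp
  qed
  also have "\<dots> = (\<integral>\<^sup>+V. ennreal (t ^ (DIM('a) - 1) / ball_vol TYPE('a)) * indicator (squeeze e t -` (ball 0 1 \<inter> proj_sphere -` A)) V \<partial>lborel)"
    by (intro nn_integral_cong) (auto simp: indicator_def)
  also have "\<dots> = ennreal (t ^ (DIM('a) - 1) / ball_vol TYPE('a)) * emeasure lborel (squeeze e t -` (ball 0 1 \<inter> proj_sphere -` A))"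
    by (rule nn_integral_cmult_indicator) (use sA in simp)
  also have "\<dots> = emeasure lborel (ball 0 1 \<inter> proj_sphere -` A) / ennreal (ball_vol TYPE('a))"
    using t ball_vol_pos[where 'a = 'a]
    by (subst emeasure_squeeze[OF eB t]) (auto simp: divide_ennreal_def ennreal_mult' inverse_ennreal divide_inverse mult_ac)
  also have "\<dots> = emeasure uniform_sphere A" by (simp add: emeasure_uniform_sphere emeasure_ball_vol)
  finally show "emeasure uniform_sphere A = emeasure (distr (density lborel ?f) borel (\<lambda>V. proj_sphere (squeeze e t V))) A"
    by simp
qed simp

lemma AE_uniform_sphere_iff_negligible:
  fixes P :: "'a::euclidean_space \<Rightarrow> bool"
  assumes [measurable]: "Measurable.pred borel P"
    and N: "negligible {U. U \<noteq> 0 \<and> \<not> P (proj_sphere U)}"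
  shows "AE x in uniform_sphere. P x"
proof -
  have "AE U in lebesgue. \<not> (U \<noteq> 0 \<and> \<not> P (proj_sphere U))"
    using N by (auto simp: negligible_iff_null_sets eventually_ae_filter)
  then have "AE U in completion lborel. \<not> (U \<noteq> 0 \<and> \<not> P (proj_sphere U))" by simp
  then have "AE U in lborel. \<not> (U \<noteq> 0 \<and> \<not> P (proj_sphere U))"
    by (simp add: AE_completion_iff)
  moreover have "AE U in lborel. (U :: 'a) \<noteq> 0" by (rule AE_lborel_singleton)
  ultimately have "AE U in lborel. P (proj_sphere U)" by eventually_elim auto
  then have "AE U in uniform_measure lborel (ball 0 1). P (proj_sphere U)"
    by (intro AE_uniform_measureI) auto
  then show ?thesis unfolding uniform_sphere_def by (subst AE_distr_iff) auto
qed

lemma AE_uniform_sphere_hyperplane_0: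
  fixes a :: "'a::euclidean_space"
  assumes a: "a \<noteq> 0"
  shows "AE x in uniform_sphere. a \<bullet> x \<noteq> 0"
proof (rule AE_uniform_sphere_iff_negligible)
  have "{U. U \<noteq> 0 \<and> \<not> a \<bullet> proj_sphere U \<noteq> 0} \<subseteq> {U. a \<bullet> U = 0}" by auto
  then show "negligible {U. U \<noteq> 0 \<and> \<not> a \<bullet> proj_sphere U \<noteq> 0}"
    using negligible_hyperplane[of a 0] a negligible_subset by blast
qed measurable

text \<open>For \<open>norm y < 1\<close> the hyperplane misses the sphere. Otherwise the cone over
  the section is the boundary cone treated in \<open>negligible_cone\<close>; the case
  \<open>norm y = 1\<close> is its degenerate form with slope 0.\<close>

lemma AE_uniform_sphere_hyperplane_1:
  fixes y :: "'a::euclidean_space"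
  assumes d: "2 \<le> DIM('a)"
  shows "AE x in uniform_sphere. x \<bullet> y \<noteq> 1"
proof (cases "norm y < 1")
  case True
  have "x \<bullet> y \<noteq> 1" if "x \<in> sphere 0 1" for x
    using norm_cauchy_schwarz[of x y] True that by auto
  then show ?thesis using AE_uniform_sphere by (auto elim: eventually_mono)
next
  case False
  define r where "r = norm y"
  define u where "u = y /\<^sub>R r"
  have r: "1 \<le> r" using False by (simp add: r_def)
  have "y \<noteq> 0" using r by (auto simp: r_def)
  then have u: "norm u = 1" "y = r *\<^sub>R u" by (simp_all add: u_def r_def)
  have r1: "1 \<le> r\<^sup>2" using r by (simp add: one_le_power)
  show ?thesis
  proof (rule AE_uniform_sphere_iff_negligible)
    have "{U. U \<noteq> 0 \<and> \<not> proj_sphere U \<bullet> y \<noteq> 1} \<subseteq> {U. norm (perp u U) = sqrt (r\<^sup>2 - 1) * (U \<bullet> u)}"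
    proof
      fix U assume "U \<in> {U. U \<noteq> 0 \<and> \<not> proj_sphere U \<bullet> y \<noteq> 1}"
      then have U: "U \<noteq> 0" "proj_sphere U \<bullet> y = 1" by auto
      then have n: "norm U = r * (U \<bullet> u)" unfolding u(2) by (simp add: field_simps)
      then have "0 \<le> r * (U \<bullet> u)" by (metis norm_ge_zero)
      then have s: "0 \<le> U \<bullet> u" using r by (simp add: zero_le_mult_iff)
      have "(norm (perp u U))\<^sup>2 = (norm U)\<^sup>2 - (U \<bullet> u)\<^sup>2" using norm_perp[OF u(1), of U] by simp
      also have "\<dots> = (sqrt (r\<^sup>2 - 1) * (U \<bullet> u))\<^sup>2" using r1 by (simp add: n power_mult_distrib algebra_simps)
      finally have eq: "(norm (perp u U))\<^sup>2 = (sqrt (r\<^sup>2 - 1) * (U \<bullet> u))\<^sup>2" .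
      have "norm (perp u U) = sqrt (r\<^sup>2 - 1) * (U \<bullet> u)"
        by (rule power2_eq_imp_eq[OF eq norm_ge_zero]) (use s r1 in simp)
      then show "U \<in> {U. norm (perp u U) = sqrt (r\<^sup>2 - 1) * (U \<bullet> u)}" by simp
    qed
    then show "negligible {U. U \<noteq> 0 \<and> \<not> proj_sphere U \<bullet> y \<noteq> 1}"
      using negligible_cone[OF u(1) d] negligible_subset by blast
  qed measurable
qed

text \<open>Rotation invariance reduces to a basis vector. The two bounds share the constant
  \<open>k\<close> and their ratio tends to 1 as \<open>norm y\<close> tends to 1, which fixes the
  leading term.\<close>

lemma cap_asymptotics:
  assumes d: "2 \<le> CARD('n::finite)"
  obtains k where "k > 0"
    "\<And>y :: real ^ 'n. 1 < norm y \<Longrightarrow> cap y \<le> k * sqrt ((norm y)\<^sup>2 - 1) ^ (CARD('n) - 1)"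
    "\<And>y :: real ^ 'n. 1 < norm y \<Longrightarrow> k * sqrt ((norm y)\<^sup>2 - 1) ^ (CARD('n) - 1) * (1 / norm y) ^ CARD('n) \<le> cap y"
proof -
  obtain e :: "real ^ 'n" where e: "e \<in> Basis" using nonempty_Basis by blast
  define k where "k = measure lborel (unit_cone e) / ball_vol TYPE(real ^ 'n)"
  have k: "k > 0" using unit_cone_pos[OF e] ball_vol_pos by (simp add: k_def)
  have rot: "cap y = cap (norm y *\<^sub>R e)" for y :: "real ^ 'n"
  proof -
    obtain R where "orthogonal_transformation R" "R y = norm y *\<^sub>R e"
      using rotation_exists[OF d, of y "norm y *\<^sub>R e"] e by auto
    then show ?thesis using cap_orthogonal by metis
  qed
  show ?thesis
  proof
    fix y :: "real ^ 'n" assume y: "1 < norm y"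
    show "cap y \<le> k * sqrt ((norm y)\<^sup>2 - 1) ^ (CARD('n) - 1)"
      using cap_axis(1)[OF e y] unfolding rot[of y, symmetric] k_def[symmetric] by simp
    show "k * sqrt ((norm y)\<^sup>2 - 1) ^ (CARD('n) - 1) * (1 / norm y) ^ CARD('n) \<le> cap y"
      using cap_axis(2)[OF e y] unfolding rot[of y, symmetric] k_def[symmetric] by simp
  qed (rule k)
qed

text \<open>With \<open>t = sqrt (norm y ^ 2 - 1)\<close>, points on the boundary of the cap are at
  distance at most \<open>min t 1\<close> from its axis, so two of them are at distance at most
  twice this. Up to \<open>t = 1\<close> the lower asymptotic bound applies with
  \<open>norm y\<close> at most \<open>sqrt 2\<close>; both losses go into \<open>c\<close>. Larger
  caps contain the one with \<open>t = 1\<close>. The result provides the integrable majorant of the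
  scaling limit.\<close>

lemma cap_lower_bound:
  assumes d: "2 \<le> CARD('n::finite)"
  obtains c where "c > 0"
    "\<And>x x' y :: real ^ 'n. norm x = 1 \<Longrightarrow> norm x' = 1 \<Longrightarrow> x \<bullet> y = 1 \<Longrightarrow> x' \<bullet> y = 1 \<Longrightarrow> c * norm (x - x') ^ (CARD('n) - 1) \<le> cap y"
proof -
  let ?d = "CARD('n)"
  obtain k where k: "k > 0"
    "\<And>y :: real ^ 'n. 1 < norm y \<Longrightarrow> k * sqrt ((norm y)\<^sup>2 - 1) ^ (CARD('n) - 1) * (1 / norm y) ^ CARD('n) \<le> cap y"
    using cap_asymptotics[OF d] by metis
  define c where "c = k * (1 / sqrt 2) ^ ?d / 2 ^ (?d - 1)"
  have c: "c > 0" using k by (simp add: c_def)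
  show ?thesis
  proof
    show "c > 0" by (rule c)
    fix x x' y :: "real ^ 'n" assume x: "norm x = 1" "norm x' = 1" "x \<bullet> y = 1" "x' \<bullet> y = 1"
    define r where "r = norm y"
    have r: "1 \<le> r" using norm_cauchy_schwarz[of x y] x by (simp add: r_def)
    define u where "u = y /\<^sub>R r"
    have "y \<noteq> 0" using r by (auto simp: r_def)
  then have u: "norm u = 1" "y = r *\<^sub>R u" by (simp_all add: u_def r_def)
    define t where "t = sqrt (r\<^sup>2 - 1)"
    have t0: "0 \<le> t" using r by (simp add: t_def one_le_power)
    have rt: "r\<^sup>2 = 1 + t\<^sup>2" using r by (simp add: t_def one_le_power)
    have xu: "x \<bullet> u = 1 / r" "x' \<bullet> u = 1 / r" using x(3,4) r unfolding u(2) by (auto simp: field_simps)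
    have px: "norm (perp u z) \<le> t" "norm (perp u z) \<le> 1" if z: "norm z = 1" "z \<bullet> u = 1 / r" for z
    proof -
      have "1 = (1 / r)\<^sup>2 + (norm (perp u z))\<^sup>2" using norm_perp[OF u(1), of z] z by simp
      then have "(norm (perp u z))\<^sup>2 = 1 - 1 / r\<^sup>2" by (simp add: power_divide)
      also have "\<dots> = (r\<^sup>2 - 1) / r\<^sup>2" using r by (simp add: diff_divide_distrib)
      also have "r\<^sup>2 - 1 = t\<^sup>2" by (simp add: rt)
      also have "t\<^sup>2 / r\<^sup>2 \<le> t\<^sup>2 / 1" using r by (intro divide_left_mono) (auto simp: one_le_power)
      finally have "(norm (perp u z))\<^sup>2 \<le> t\<^sup>2" by simp
      then show "norm (perp u z) \<le> t" by (rule power2_le_imp_le) (rule t0)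
      show "norm (perp u z) \<le> 1" using norm_perp_le[OF u(1), of z] z by simp
    qed
    have "x - x' = perp u x - perp u x'" using xu by (simp add: perp_def)
    then have nx: "norm (x - x') \<le> norm (perp u x) + norm (perp u x')" by (metis norm_triangle_ineq4)
    show "c * norm (x - x') ^ (?d - 1) \<le> cap y"
    proof (cases "r = 1")
      case True
      then have "t = 0" by (simp add: t_def)
      then have "norm (x - x') = 0" using nx px[OF x(1) xu(1)] px[OF x(2) xu(2)] by simp
      then show ?thesis using d cap_bounds(1)[of y] by (simp add: power_0_left)
    next
      case False
      then have r1: "1 < r" using r by simp
      have main: "c * norm (x - x') ^ (?d - 1) \<le> cap z" if s: "t' = sqrt ((norm z)\<^sup>2 - 1)" "1 < norm z" "t' \<le> 1" and n: "norm (x - x') \<le> 2 * t'" for z :: "real ^ 'n" and t'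
      proof -
        have s0: "0 \<le> t'" using s by (simp add: one_le_power)
        have "(norm z)\<^sup>2 = 1 + t'\<^sup>2" using s by (simp add: one_le_power)
        also have "\<dots> \<le> (sqrt 2)\<^sup>2" using s s0 by (simp add: power_le_one)
        finally have nz: "norm z \<le> sqrt 2" by (rule power2_le_imp_le) simp
        have "c * norm (x - x') ^ (?d - 1) \<le> c * (2 * t') ^ (?d - 1)"
          using c n by (intro mult_left_mono power_mono) auto
        also have "\<dots> = k * t' ^ (?d - 1) * (1 / sqrt 2) ^ ?d" by (simp add: c_def power_mult_distrib)
        also have "\<dots> \<le> k * t' ^ (?d - 1) * (1 / norm z) ^ ?d"
        proof (intro mult_left_mono power_mono divide_left_mono nz)
          show "0 < sqrt 2 * norm z" using s(2) by (auto intro: mult_pos_pos less_trans[OF zero_less_one])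
        qed (use k s0 in auto)
        also have "\<dots> \<le> cap z" using k(2)[OF s(2)] s(1) by simp
        finally show ?thesis .
      qed
      show ?thesis
      proof (cases "t \<le> 1")
        case True
        show ?thesis using nx px[OF x(1) xu(1)] px[OF x(2) xu(2)] True r1
          by (intro main[of t]) (auto simp: t_def r_def)
      next
        case False
        \<comment> \<open>The norm \<open>sqrt 2\<close> corresponds to the threshold
          \<open>t = 1\<close>.\<close>
        define z where "z = sqrt 2 *\<^sub>R u"
        have nz: "norm z = sqrt 2" using u by (simp add: z_def)
        have "sqrt 2 \<le> r"
        proof (rule power2_le_imp_le)
          show "(sqrt 2)\<^sup>2 \<le> r\<^sup>2" using False by (simp add: rt one_le_power)
        qed (use r in simp)
        have "c * norm (x - x') ^ (?d - 1) \<le> cap z"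
          using nx px[OF x(1) xu(1)] px[OF x(2) xu(2)] by (intro main[of 1]) (auto simp: nz)
        also have "\<dots> \<le> cap y" unfolding z_def u(2) by (rule cap_mono_scale) (use \<open>sqrt 2 \<le> r\<close> in auto)
        finally show ?thesis .
      qed
    qed
  qed
qed

subsection \<open>General position of the sample\<close>

lemma (in product_sigma_finite) AE_PiM_insert:
  assumes I: "finite I" "i \<notin> I" and P [measurable]: "Measurable.pred (PiM (insert i I) M) P"
    and AE: "AE X in PiM I M. AE x in M i. P (X(i := x))"
  shows "AE X in PiM (insert i I) M. P X"
proof -
  let ?f = "\<lambda>X. indicator {X. \<not> P X} X :: ennreal"
  have f [measurable]: "?f \<in> borel_measurable (PiM (insert i I) M)" by measurable
  have "(\<integral>\<^sup>+X. ?f X \<partial>PiM (insert i I) M) = (\<integral>\<^sup>+X. (\<integral>\<^sup>+x. ?f (X(i := x)) \<partial>M i) \<partial>PiM I M)"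
    by (rule product_nn_integral_insert[OF I f])
  also have "\<dots> = (\<integral>\<^sup>+X. 0 \<partial>PiM I M)"
  proof (rule nn_integral_cong_AE)
    show "AE X in PiM I M. (\<integral>\<^sup>+x. ?f (X(i := x)) \<partial>M i) = 0"
      using AE
    proof eventually_elim
      case (elim X)
      have "(\<integral>\<^sup>+x. ?f (X(i := x)) \<partial>M i) = (\<integral>\<^sup>+x. 0 \<partial>M i)"
        using elim by (intro nn_integral_cong_AE) auto
      then show ?case by simp
    qed
  qed
  finally have "(\<integral>\<^sup>+X. ?f X \<partial>PiM (insert i I) M) = 0" by simp
  then have "AE X in PiM (insert i I) M. ?f X = 0" by (subst (asm) nn_integral_0_iff_AE) auto
  then show ?thesis by eventually_elim (auto simp: indicator_def split: if_splits)
qed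

lemma AE_PiM_restrict:
  assumes M: "prob_space M" and K: "L \<subseteq> K" and AE: "AE X in PiM L (\<lambda>_. M). P (restrict X L)"
  shows "AE X in PiM K (\<lambda>_. M). P (restrict X L)"
proof -
  have d: "distr (PiM K (\<lambda>_. M)) (PiM L (\<lambda>_. M)) (\<lambda>X. restrict X L) = PiM L (\<lambda>_. M)"
    using distr_PiM_reindex[of K "\<lambda>_. M" "\<lambda>i. i" L] M K by (auto simp: restrict_def)
  have "AE X in distr (PiM K (\<lambda>_. M)) (PiM L (\<lambda>_. M)) (\<lambda>X. restrict X L). P (restrict X L)"
    unfolding d by (rule AE)
  from AE_distrD[OF measurable_restrict_subset[OF K] this] show ?thesis by simp
qed

lemma det_row_linear:
  fixes c :: "'n::finite \<Rightarrow> real ^ 'n"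
  obtains a where "\<And>x. det (\<chi> i. if i = j then x else c i) = a \<bullet> x"
proof
  fix x :: "real ^ 'n"
  have "det (\<chi> i. if i = j then x else c i)
      = det (\<chi> i. if i = j then (\<Sum>k\<in>UNIV. x $ k *s axis k 1) else c i)"
    by (subst basis_expansion) (rule refl)
  also have "\<dots> = (\<Sum>k\<in>UNIV. x $ k * det (\<chi> i. if i = j then axis k 1 else c i))"
    by (simp add: det_linear_row_sum det_row_mul)
  also have "\<dots> = (\<chi> k. det (\<chi> i. if i = j then axis k 1 else c i)) \<bullet> x"
    by (simp add: inner_vec_def mult.commute)
  finally show "det (\<chi> i. if i = j then x else c i) = (\<chi> k. det (\<chi> i. if i = j then axis k 1 else c i)) \<bullet> x" .
qed

definition row_matrix :: "('n::finite \<Rightarrow> nat) \<Rightarrow> (nat \<Rightarrow> real ^ 'n) \<Rightarrow> real ^ 'n ^ 'n" where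
  "row_matrix f X = (\<chi> i. X (f i))"

text \<open>Cramer's formula for the dual point of the hyperplane through the rows. Being explicit,
  it is measurable without further argument. For a singular matrix division by zero makes it
  0.\<close>

definition unit_sol :: "real ^ 'n ^ 'n \<Rightarrow> real ^ 'n::finite" where
  "unit_sol A = (\<chi> k. det (\<chi> i j. if j = k then 1 else A $ i $ j) / det A)"

lemma unit_sol_iff: "det A \<noteq> 0 \<Longrightarrow> (\<forall>i. A $ i \<bullet> y = 1) \<longleftrightarrow> y = unit_sol A"
proof -
  assume d: "det A \<noteq> 0"
  have "(\<forall>i. A $ i \<bullet> y = 1) \<longleftrightarrow> A *v y = (\<chi> i. 1)"
    by (simp add: vec_eq_iff matrix_vector_mult_def inner_vec_def)
  also have "\<dots> \<longleftrightarrow> y = unit_sol A"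
    using cramer[OF d, of y "\<chi> i. 1"] unfolding unit_sol_def by (simp only: vec_lambda_beta)
  finally show ?thesis .
qed

lemma borel_measurable_det:
  fixes A :: "'a \<Rightarrow> real ^ 'n ^ 'n::finite"
  assumes "\<And>i j. (\<lambda>x. A x $ i $ j) \<in> borel_measurable M"
  shows "(\<lambda>x. det (A x)) \<in> borel_measurable M"
  unfolding det_def using assms by (intro borel_measurable_sum borel_measurable_times borel_measurable_prod borel_measurable_const)

lemma borel_measurable_unit_sol:
  fixes A :: "'a \<Rightarrow> real ^ 'n ^ 'n::finite"
  assumes A: "\<And>i j. (\<lambda>x. A x $ i $ j) \<in> borel_measurable M"
  shows "(\<lambda>x. unit_sol (A x)) \<in> borel_measurable M"
proof -
  have "(\<lambda>x. det (\<chi> i j. if j = k then 1 else A x $ i $ j) / det (A x)) \<in> borel_measurable M" for k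
    using A by (intro borel_measurable_divide borel_measurable_det) auto
  then show ?thesis unfolding unit_sol_def
    by (subst borel_measurable_euclidean_space) (auto simp: Basis_vec_def inner_axis)
qed

lemma borel_measurable_component [measurable (raw)]:
  fixes g :: "'a \<Rightarrow> real ^ 'n::finite"
  assumes "g \<in> borel_measurable M"
  shows "(\<lambda>x. g x $ k) \<in> borel_measurable M"
  using measurable_compose[OF assms borel_measurable_continuous_onI[of "\<lambda>x. x $ k"]]
  by (simp add: continuous_on_component)

lemma borel_measurable_row_matrix:
  fixes f :: "'n::finite \<Rightarrow> nat"
  assumes "range f \<subseteq> K"
  shows "(\<lambda>X. row_matrix f X $ i $ j) \<in> borel_measurable (PiM K (\<lambda>_. borel))"
  unfolding row_matrix_def using assms
  by (auto intro!: borel_measurable_component measurable_component_singleton)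

text \<open>Rows are replaced by vectors of the standard basis, one at a time. The determinant is a linear
  function of each new row, and this function is not zero, because it was not zero at the replaced row.\<close>

lemma AE_det_mixed_rows:
  fixes M :: "(real ^ 'n::finite) measure" and f :: "'n \<Rightarrow> nat" and J :: "'n set"
  assumes M: "sigma_finite_measure M" "sets M = sets borel"
    and null: "\<And>a. a \<noteq> 0 \<Longrightarrow> AE x in M. a \<bullet> x \<noteq> 0" and f: "inj_on f J"
  shows "AE X in PiM (f ` J) (\<lambda>_. M). det (\<chi> i. if i \<in> J then X (f i) else axis i 1) \<noteq> 0"
proof -
  interpret sigma_finite_measure M by fact
  interpret product_sigma_finite "\<lambda>_::nat. M" ..
  have "finite J" by simp
  then show ?thesis using f
  proof (induction J rule: finite_induct)
    case empty
    have "(\<chi> i. axis i 1) = (mat 1 :: real ^ 'n ^ 'n)" by (simp add: mat_def axis_def vec_eq_iff)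
    then show ?case by (simp add: det_I)
  next
    case (insert j J)
    define D where "D J X = det (\<chi> i. if i \<in> J then X (f i) else axis i 1)" for J and X :: "nat \<Rightarrow> real ^ 'n"
    have fj: "f j \<notin> f ` J" using insert by (auto simp: inj_on_def)
    have "Measurable.pred (PiM (insert (f j) (f ` J)) (\<lambda>_. M)) (\<lambda>X. D (insert j J) X \<noteq> 0)"
    proof -
      have "(\<lambda>X. (if i \<in> insert j J then X (f i) else axis i 1) $ k) \<in> borel_measurable (PiM (insert (f j) (f ` J)) (\<lambda>_. M))" for i k
        using M(2) measurable_component_singleton[of "f i" "insert (f j) (f ` J)" "\<lambda>_. M"]
        by (cases "i \<in> insert j J") (auto intro!: borel_measurable_component simp: measurable_cong_sets[OF refl M(2)])
      then have "D (insert j J) \<in> borel_measurable (PiM (insert (f j) (f ` J)) (\<lambda>_. M))"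
        unfolding D_def by (intro borel_measurable_det) simp
      then show ?thesis by measurable
    qed
    moreover have "AE X in PiM (f ` J) (\<lambda>_. M). AE x in M. D (insert j J) (X(f j := x)) \<noteq> 0"
    proof -
      have "AE X in PiM (f ` J) (\<lambda>_. M). D J X \<noteq> 0" using insert by (simp add: D_def inj_on_def)
      then show ?thesis
      proof eventually_elim
        case (elim X)
        define c where "c i = (if i \<in> J then X (f i) else axis i 1)" for i
        obtain a where a: "\<And>x. det (\<chi> i. if i = j then x else c i) = a \<bullet> x" using det_row_linear by blast
        have "(\<chi> i. if i = j then axis j 1 else c i) = (\<chi> i. if i \<in> J then X (f i) else axis i 1)"
          using insert(2) by (auto simp: c_def vec_eq_iff)
        then have "a \<bullet> axis j 1 = D J X" using a[of "axis j 1"] by (simp add: D_def)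
        then have "a \<noteq> 0" using elim by auto
        moreover have "D (insert j J) (X(f j := x)) = a \<bullet> x" for x
        proof -
          have "(\<chi> i. if i \<in> insert j J then (X(f j := x)) (f i) else axis i 1) = (\<chi> i. if i = j then x else c i)"
          proof -
            have "f i \<noteq> f j" if "i \<in> J" for i using fj that by (metis imageI)
            then show ?thesis using insert(2) by (auto simp: c_def vec_eq_iff)
          qed
          then show ?thesis using a by (simp add: D_def)
        qed
        ultimately show ?case using null by simp
      qed
    qed
    ultimately have "AE X in PiM (insert (f j) (f ` J)) (\<lambda>_. M). D (insert j J) X \<noteq> 0"
      using insert fj by (intro AE_PiM_insert) auto
    then show ?case by (simp only: D_def image_insert)
  qed
qed

lemma AE_det_row_matrix:
  fixes f :: "'n::finite \<Rightarrow> nat"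
  assumes f: "inj f" "range f \<subseteq> K"
  shows "AE X in PiM K (\<lambda>_. uniform_sphere). det (row_matrix f X) \<noteq> 0"
proof -
  have "AE X in PiM (range f) (\<lambda>_. uniform_sphere). det (row_matrix f X) \<noteq> 0"
    using AE_det_mixed_rows[OF uniform_sphere.sigma_finite_measure_axioms sets_uniform_sphere
        AE_uniform_sphere_hyperplane_0 f(1)]
    by (simp add: row_matrix_def)
  then have "AE X in PiM (range f) (\<lambda>_. uniform_sphere). det (row_matrix f (restrict X (range f))) \<noteq> 0"
    by (simp add: row_matrix_def)
  then have "AE X in PiM K (\<lambda>_. uniform_sphere). det (row_matrix f (restrict X (range f))) \<noteq> 0"
    by (rule AE_PiM_restrict[OF prob_space_uniform_sphere f(2)])
  then show ?thesis by (simp add: row_matrix_def)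
qed

text \<open>The hyperplane depends only on the points in \<open>range f\<close>; the point with
  index \<open>l\<close> is independent of them, and each hyperplane section of the sphere is a null
  set.\<close>

lemma AE_off_hyperplane:
  fixes f :: "'n::finite \<Rightarrow> nat"
  assumes d: "2 \<le> CARD('n)" and f: "range f \<subseteq> K" and l: "l \<in> K" "l \<notin> range f"
  shows "AE X in PiM K (\<lambda>_. uniform_sphere). X l \<bullet> unit_sol (row_matrix f X) \<noteq> 1"
proof -
  let ?M = "\<lambda>_::nat. uniform_sphere :: (real ^ 'n) measure"
  interpret product_sigma_finite ?M ..
  let ?L = "insert l (range f)"
  have sub: "?L \<subseteq> K" using f l by auto
  have "AE X in PiM ?L ?M. X l \<bullet> unit_sol (row_matrix f X) \<noteq> 1"
  proof (rule AE_PiM_insert)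
    have "(\<lambda>X. unit_sol (row_matrix f X)) \<in> borel_measurable (PiM ?L (\<lambda>_. borel))"
      by (intro borel_measurable_unit_sol borel_measurable_row_matrix) auto
    moreover have "(\<lambda>X. X l) \<in> measurable (PiM ?L (\<lambda>_. borel)) (borel :: (real ^ 'n) measure)"
      by (rule measurable_component_singleton) simp
    ultimately have "Measurable.pred (PiM ?L (\<lambda>_. borel)) (\<lambda>X. X l \<bullet> unit_sol (row_matrix f X) \<noteq> 1)"
      by measurable
    moreover have "sets (PiM ?L (\<lambda>_. borel :: (real ^ 'n) measure)) = sets (PiM ?L ?M)"
      by (rule sets_PiM_cong) auto
    ultimately show "Measurable.pred (PiM ?L ?M) (\<lambda>X. X l \<bullet> unit_sol (row_matrix f X) \<noteq> 1)"
      by (simp cong: measurable_cong_sets)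
    have "row_matrix f (X(l := x)) = row_matrix f X" for X :: "nat \<Rightarrow> real ^ 'n" and x
      using l(2) by (auto simp: row_matrix_def vec_eq_iff)
    then show "AE X in PiM (range f) ?M. AE x in ?M l. (X(l := x)) l \<bullet> unit_sol (row_matrix f (X(l := x))) \<noteq> 1"
      using AE_uniform_sphere_hyperplane_1[where 'a = "real ^ 'n"] d by simp
  qed (use l in auto)
  then have "AE X in PiM ?L ?M. (restrict X ?L) l \<bullet> unit_sol (row_matrix f (restrict X ?L)) \<noteq> 1"
    by (simp add: row_matrix_def)
  then have "AE X in PiM K ?M. (restrict X ?L) l \<bullet> unit_sol (row_matrix f (restrict X ?L)) \<noteq> 1"
    by (rule AE_PiM_restrict[OF prob_space_uniform_sphere sub, where P = "\<lambda>X. X l \<bullet> unit_sol (row_matrix f X) \<noteq> 1"])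
  then show ?thesis by (simp add: row_matrix_def)
qed

text \<open>There are only countably many enumerations \<open>f\<close>, so both almost sure
  statements hold for all of them at once. If more than \<open>d\<close> points satisfied
  \<open>X i \<bullet> y = 1\<close>, then \<open>d\<close> of them would determine \<open>y\<close>
  as their \<open>unit_sol\<close>, and another point would lie on that hyperplane.\<close>

lemma AE_general_position:
  assumes d: "2 \<le> CARD('n::finite)"
  shows "AE X in (sphere_sample m :: (nat \<Rightarrow> real ^ 'n) measure). general_position X m"
proof -
  have "AE X in (sphere_sample m :: (nat \<Rightarrow> real ^ 'n) measure).
      \<forall>f :: 'n \<Rightarrow> nat. inj f \<and> range f \<subseteq> {..<m} \<longrightarrow>
        det (row_matrix f X) \<noteq> 0 \<and> (\<forall>l. l \<in> {..<m} \<and> l \<notin> range f \<longrightarrow> X l \<bullet> unit_sol (row_matrix f X) \<noteq> 1)"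
    unfolding AE_all_countable sphere_sample_def
    using AE_det_row_matrix AE_off_hyperplane[OF d] by (auto simp: AE_conj_iff AE_all_countable simp del: split_paired_All)
  then show ?thesis
  proof eventually_elim
    case (elim X)
    have ex: "\<exists>f :: 'n \<Rightarrow> nat. inj f \<and> range f = I" if "card I = CARD('n)" for I
    proof -
      have "finite I" using that by (metis card.infinite finite zero_less_card_finite less_irrefl)
      then have "\<exists>f :: 'n \<Rightarrow> nat. bij_betw f UNIV I" using that by (intro finite_same_card_bij) auto
      then show ?thesis by (auto simp: bij_betw_def)
    qed
    show ?case
    proof
      fix I and u :: "real ^ 'n"
      assume I: "I \<subseteq> {..<m}" "card I = DIM(real ^ 'n)" "\<And>i. i \<in> I \<Longrightarrow> X i \<bullet> u = 0"
      obtain f :: "'n \<Rightarrow> nat" where f: "inj f" "range f = I" using ex[of I] I(2) by auto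
      then have det: "det (row_matrix f X) \<noteq> 0" using elim I(1) by blast
      have "row_matrix f X *v u = 0" using I(3) f(2)
        by (auto simp: vec_eq_iff matrix_vector_mult_def inner_vec_def row_matrix_def)
      then show "u = 0" using det cramer[OF det, of u 0] cramer[OF det, of 0 0] by simp
    next
      fix y :: "real ^ 'n"
      show "card {i. i < m \<and> X i \<bullet> y = 1} \<le> DIM(real ^ 'n)"
      proof (rule ccontr)
        assume "\<not> card {i. i < m \<and> X i \<bullet> y = 1} \<le> DIM(real ^ 'n)"
        then have "CARD('n) < card {i. i < m \<and> X i \<bullet> y = 1}" by simp
        then obtain I where I: "I \<subseteq> {i. i < m \<and> X i \<bullet> y = 1}" "card I = CARD('n)" 
          by (meson less_imp_le obtain_subset_with_card_n)
        then have "I \<noteq> {i. i < m \<and> X i \<bullet> y = 1}" using \<open>CARD('n) < _\<close> by auto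
        then obtain l where l: "l < m" "X l \<bullet> y = 1" "l \<notin> I" using I by blast
        obtain f :: "'n \<Rightarrow> nat" where f: "inj f" "range f = I" using ex[of I] I(2) by auto
        have sub: "range f \<subseteq> {..<m}" using f I by auto
        have det: "det (row_matrix f X) \<noteq> 0" using elim f sub by blast
        have "\<forall>i. row_matrix f X $ i \<bullet> y = 1" using f I(1) by (auto simp: row_matrix_def)
        then have "y = unit_sol (row_matrix f X)" using unit_sol_iff[OF det] by blast
        then have "X l \<bullet> unit_sol (row_matrix f X) = 1" using l by simp
        then show False using elim f sub l by auto
      qed
    qed
  qed
qed

subsection \<open>The scaling limit of the expected number of vertices\<close>

text \<open>Split \<open>\<theta>\<close> into \<open>d + 1\<close> equal factors
  \<open>\<phi>\<close>. Each of the \<open>d\<close> factors \<open>n + 1\<close> is paired with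
  one \<open>\<phi> ^ n\<close>, and \<open>(n + 1) * \<phi> ^ n\<close> is at most the geometric
  series.\<close>

lemma poly_geometric_bounded:
  fixes \<theta> :: real
  assumes \<theta>: "0 \<le> \<theta>" "\<theta> < 1"
  obtains K where "\<And>n::nat. (real n + 1) ^ d * \<theta> ^ n \<le> K"
proof -
  define \<phi> where "\<phi> = root (d + 1) \<theta>"
  have \<phi>: "0 \<le> \<phi>" "\<phi> < 1" using \<theta> by (simp_all add: \<phi>_def)
  have eq: "\<phi> ^ (d + 1) = \<theta>" unfolding \<phi>_def using \<theta> by (intro real_root_pow_pos2) auto
  have lin: "(real n + 1) * \<phi> ^ n \<le> 1 / (1 - \<phi>)" for n
  proof -
    have "(real n + 1) * \<phi> ^ n = (\<Sum>j<Suc n. \<phi> ^ n)" by simp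
    also have "\<dots> \<le> (\<Sum>j<Suc n. \<phi> ^ j)" using \<phi> by (intro sum_mono power_decreasing) auto
    also have "\<dots> = (1 - \<phi> ^ Suc n) / (1 - \<phi>)" using \<phi> by (simp add: sum_gp_strict del: sum.lessThan_Suc power_Suc)
    also have "\<dots> \<le> 1 / (1 - \<phi>)" using \<phi> by (intro divide_right_mono) auto
    finally show ?thesis .
  qed
  have "(real n + 1) ^ d * \<theta> ^ n \<le> (1 / (1 - \<phi>)) ^ d" for n
  proof -
    have "(real n + 1) ^ d * \<theta> ^ n = ((real n + 1) * \<phi> ^ n) ^ d * \<phi> ^ n"
    proof -
      have "\<theta> ^ n = (\<phi> ^ n) ^ d * \<phi> ^ n"
        unfolding eq[symmetric]
        by (simp only: power_mult[symmetric] power_add[symmetric]) (simp add: algebra_simps)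
      then show ?thesis by (simp only: power_mult_distrib mult.assoc)
    qed
    also have "\<dots> \<le> (1 / (1 - \<phi>)) ^ d * 1"
      using \<phi> lin[of n] by (intro mult_mono power_mono) (auto simp: power_le_one)
    finally show ?thesis by simp
  qed
  then show ?thesis using that by blast
qed

text \<open>The logarithm is enclosed by \<open>- u / (1 - u)\<close> and \<open>- u\<close>. The
  shift by \<open>d\<close> in the exponent disappears because \<open>u\<close> tends to 0.\<close>

lemma power_one_minus_tendsto:
  fixes u :: "nat \<Rightarrow> real"
  assumes u: "\<And>m. 0 \<le> u m" and lim: "(\<lambda>m. real m * u m) \<longlonglongrightarrow> l"
  shows "(\<lambda>m. (1 - u m) ^ (m - d)) \<longlonglongrightarrow> exp (- l)"
proof -
  have "(\<lambda>m. (real m * u m) * (1 / real m)) \<longlonglongrightarrow> l * 0"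
    by (intro tendsto_mult lim lim_1_over_n)
  moreover have "eventually (\<lambda>m. (real m * u m) * (1 / real m) = u m) sequentially"
    by (intro eventually_sequentiallyI[of 1]) auto
  ultimately have u0: "u \<longlonglongrightarrow> 0" by (simp add: tendsto_cong)
  have small: "eventually (\<lambda>m. u m < 1 / 2) sequentially" using order_tendstoD(2)[OF u0, of "1/2"] by simp
  have "(\<lambda>m. real m * u m - real d * u m) \<longlonglongrightarrow> l - real d * 0" by (intro tendsto_intros lim u0)
  moreover have "eventually (\<lambda>m. real m * u m - real d * u m = real (m - d) * u m) sequentially"
    by (intro eventually_sequentiallyI[of d]) (simp add: of_nat_diff algebra_simps)
  ultimately have nu: "(\<lambda>m. real (m - d) * u m) \<longlonglongrightarrow> l" by (simp add: tendsto_cong)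
  have "(\<lambda>m. real (m - d) * ln (1 - u m)) \<longlonglongrightarrow> - l"
  proof (rule tendsto_sandwich)
    have "(\<lambda>m. - (real (m - d) * u m) / (1 - u m)) \<longlonglongrightarrow> - l / (1 - 0)" by (intro tendsto_intros nu u0) simp
    then show "(\<lambda>m. - (real (m - d) * u m) / (1 - u m)) \<longlonglongrightarrow> - l" by simp
    show "(\<lambda>m. - (real (m - d) * u m)) \<longlonglongrightarrow> - l" by (intro tendsto_intros nu)
    show "eventually (\<lambda>m. - (real (m - d) * u m) / (1 - u m) \<le> real (m - d) * ln (1 - u m)) sequentially"
      using small
    proof eventually_elim
      case (elim m)
      have "- ln (1 - u m) = ln (1 / (1 - u m))" using elim by (simp add: ln_div)
      also have "\<dots> \<le> 1 / (1 - u m) - 1" using elim by (intro ln_le_minus_one) auto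
      also have "\<dots> = u m / (1 - u m)" using elim by (simp add: field_simps)
      finally have "- (u m / (1 - u m)) \<le> ln (1 - u m)" by simp
      then have "real (m - d) * (- (u m / (1 - u m))) \<le> real (m - d) * ln (1 - u m)" by (intro mult_left_mono) auto
      then show ?case by simp
    qed
    show "eventually (\<lambda>m. real (m - d) * ln (1 - u m) \<le> - (real (m - d) * u m)) sequentially"
      using small
    proof eventually_elim
      case (elim m)
      have "ln (1 - u m) \<le> - u m" using ln_le_minus_one[of "1 - u m"] elim by simp
      then have "real (m - d) * ln (1 - u m) \<le> real (m - d) * (- u m)" by (intro mult_left_mono) auto
      then show ?case by simp
    qed
  qed
  then have "(\<lambda>m. exp (real (m - d) * ln (1 - u m))) \<longlonglongrightarrow> exp (- l)" by (rule tendsto_exp)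
  moreover have "eventually (\<lambda>m. exp (real (m - d) * ln (1 - u m)) = (1 - u m) ^ (m - d)) sequentially"
    using small by eventually_elim (simp add: exp_of_nat_mult)
  ultimately show ?thesis by (simp add: tendsto_cong)
qed

lemma PiM_density_lborel:
  fixes w :: "'a::euclidean_space \<Rightarrow> ennreal" and I :: "nat set"
  assumes I: "finite I" and w [measurable]: "w \<in> borel_measurable lborel" and P: "prob_space (density lborel w)"
  shows "PiM I (\<lambda>_. density lborel w) = density (PiM I (\<lambda>_. lborel)) (\<lambda>X. \<Prod>i\<in>I. w (X i))"
proof -
  interpret P: prob_space "density lborel w" by fact
  interpret D: product_sigma_finite "\<lambda>_::nat. density lborel w" ..
  interpret L: product_sigma_finite "\<lambda>_::nat. lborel :: 'a measure" ..
  have m [measurable]: "(\<lambda>X. \<Prod>i\<in>I. w (X i)) \<in> borel_measurable (PiM I (\<lambda>_. lborel))"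
    using I by measurable
  show ?thesis
  proof (rule D.PiM_eqI[symmetric])
    show "sets (density (PiM I (\<lambda>_. lborel)) (\<lambda>X. \<Prod>i\<in>I. w (X i))) = sets (PiM I (\<lambda>_. density lborel w))"
      by (simp, intro sets_PiM_cong) auto
    fix A :: "nat \<Rightarrow> 'a set" assume "\<And>i. i \<in> I \<Longrightarrow> A i \<in> sets (density lborel w)"
    then have A: "\<And>i. i \<in> I \<Longrightarrow> A i \<in> sets lborel" by simp
    have "emeasure (density (PiM I (\<lambda>_. lborel)) (\<lambda>X. \<Prod>i\<in>I. w (X i))) (Pi\<^sub>E I A)
      = (\<integral>\<^sup>+X. (\<Prod>i\<in>I. w (X i)) * indicator (Pi\<^sub>E I A) X \<partial>PiM I (\<lambda>_. lborel))"
      using A I by (intro emeasure_density m sets_PiM_I_finite) auto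
    also have "\<dots> = (\<integral>\<^sup>+X. (\<Prod>i\<in>I. w (X i) * indicator (A i) (X i)) \<partial>PiM I (\<lambda>_. lborel))"
    proof (rule nn_integral_cong)
      fix X assume "X \<in> space (PiM I (\<lambda>_. lborel :: 'a measure))"
      then have "X \<in> extensional I" by (simp add: space_PiM PiE_def)
      then have "indicator (Pi\<^sub>E I A) X = (\<Prod>i\<in>I. indicator (A i) (X i) :: ennreal)"
        using I by (auto simp: indicator_def PiE_def Pi_def prod_zero_iff intro!: prod.neutral)
      then show "(\<Prod>i\<in>I. w (X i)) * indicator (Pi\<^sub>E I A) X = (\<Prod>i\<in>I. w (X i) * indicator (A i) (X i))"
        by (simp add: prod.distrib)
    qed
    also have "\<dots> = (\<Prod>i\<in>I. \<integral>\<^sup>+x. w x * indicator (A i) x \<partial>lborel)"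
      using A by (intro L.product_nn_integral_prod I) auto
    also have "\<dots> = (\<Prod>i\<in>I. emeasure (density lborel w) (A i))"
      using A by (intro prod.cong refl emeasure_density[symmetric] w) auto
    finally show "emeasure (density (PiM I (\<lambda>_. lborel)) (\<lambda>X. \<Prod>i\<in>I. w (X i))) (Pi\<^sub>E I A)
      = (\<Prod>i\<in>I. emeasure (density lborel w) (A i))" .
  qed (rule I)
qed

text \<open>The slab is exhausted by cylinders of radius \<open>k + 1\<close> around the axis. Their
  volumes grow polynomially in \<open>k\<close>, whereas the function is at most
  \<open>exp (- c) ^ k\<close> at distance between \<open>k\<close> and
  \<open>k + 1\<close>.\<close>

lemma integrable_slab_exp:
  fixes e :: "'a::euclidean_space"
  assumes eB: "e \<in> Basis" and d: "2 \<le> DIM('a)" and c: "c > 0"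
  shows "integrable lborel (\<lambda>V. indicator {V. \<bar>V \<bullet> e\<bar> \<le> 1} V * exp (- c * norm (perp e V) ^ (DIM('a) - 1)))"
proof -
  define n where "n = DIM('a) - 1"
  have n: "n \<ge> 1" using d by (simp add: n_def)
  have ne: "norm e = 1" using eB by simp
  define f where "f V = indicator {V. \<bar>V \<bullet> e\<bar> \<le> 1} V * exp (- c * norm (perp e V) ^ n)" for V :: 'a
  define S where "S k = {V. \<bar>V \<bullet> e\<bar> \<le> 1 \<and> norm (perp e V) < k}" for k :: real
  have S [measurable]: "S k \<in> sets borel" for k unfolding S_def by measurable
  have f [measurable]: "f \<in> borel_measurable borel" unfolding f_def by measurable
  have vol: "emeasure lborel (S (real k + 1)) = ennreal ((real k + 1) ^ n) * emeasure lborel (S 1)" for k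
  proof -
    have "squeeze e (real k + 1) -` S (real k + 1) = S 1"
      by (auto simp: S_def squeeze_inner[OF ne] perp_squeeze[OF ne])
    then show ?thesis using emeasure_squeeze[OF eB, of "real k + 1" "S (real k + 1)"] by (simp add: n_def)
  qed
  have "S 1 \<subseteq> ball 0 2"
  proof
    fix V assume V: "V \<in> S 1"
    have "(norm V)\<^sup>2 = \<bar>V \<bullet> e\<bar>\<^sup>2 + (norm (perp e V))\<^sup>2" using norm_perp[OF ne, of V] by simp
    also have "\<dots> \<le> 1\<^sup>2 + 1\<^sup>2" using V by (intro add_mono power_mono) (auto simp: S_def)
    also have "\<dots> < 2\<^sup>2" by simp
    finally have "norm V < 2" by (rule power2_less_imp_less) simp
    then show "V \<in> ball 0 2" by simp
  qed
  then have "emeasure lborel (S 1) < \<infinity>"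
    by (intro emeasure_bounded_finite) (rule bounded_subset[OF bounded_ball])
  then have S1: "emeasure lborel (S 1) = ennreal (measure lborel (S 1))" by (simp add: emeasure_eq_ennreal_measure)
  have le: "ennreal (f V) \<le> (\<Sum>k. ennreal (exp (- c) ^ k) * indicator (S (real k + 1)) V)" for V
  proof (cases "\<bar>V \<bullet> e\<bar> \<le> 1")
    case False
    then show ?thesis by (simp add: f_def)
  next
    case True
    define k where "k = nat \<lfloor>norm (perp e V)\<rfloor>"
    have k: "real k \<le> norm (perp e V)" "norm (perp e V) < real k + 1" by (auto simp: k_def)
    have "real k \<le> real k ^ n" using n by (cases "k = 0") (auto simp: self_le_power)
    also have "\<dots> \<le> norm (perp e V) ^ n" using k by (intro power_mono) auto
    finally have "f V \<le> exp (- c * real k)" using True c by (simp add: f_def)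
    also have "\<dots> = exp (- c) ^ k" by (simp add: exp_of_nat_mult[symmetric] mult.commute)
    finally have "ennreal (f V) \<le> ennreal (exp (- c) ^ k) * indicator (S (real k + 1)) V"
      using True k by (simp add: S_def ennreal_leI)
    also have "\<dots> \<le> (\<Sum>k. ennreal (exp (- c) ^ k) * indicator (S (real k + 1)) V)"
    proof -
      define g where "g k = ennreal (exp (- c) ^ k) * indicator (S (real k + 1)) V" for k
      have "sum g {k} \<le> suminf g" by (intro sum_le_suminf) auto
      then show ?thesis by (simp add: g_def[abs_def, symmetric]) (simp add: g_def)
    qed
    finally show ?thesis .
  qed
  have "(\<integral>\<^sup>+V. ennreal (f V) \<partial>lborel) \<le> (\<integral>\<^sup>+V. (\<Sum>k. ennreal (exp (- c) ^ k) * indicator (S (real k + 1)) V) \<partial>lborel)"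
    by (intro nn_integral_mono le)
  also have "\<dots> = (\<Sum>k. \<integral>\<^sup>+V. ennreal (exp (- c) ^ k) * indicator (S (real k + 1)) V \<partial>lborel)"
    by (rule nn_integral_suminf) measurable
  also have "\<dots> = (\<Sum>k. ennreal (measure lborel (S 1) * ((real k + 1) ^ n * exp (- c) ^ k)))"
  proof (rule suminf_cong)
    fix k
    have "(\<integral>\<^sup>+V. ennreal (exp (- c) ^ k) * indicator (S (real k + 1)) V \<partial>lborel) = ennreal (exp (- c) ^ k) * emeasure lborel (S (real k + 1))"
      by (rule nn_integral_cmult_indicator) simp
    also have "\<dots> = ennreal (measure lborel (S 1) * ((real k + 1) ^ n * exp (- c) ^ k))"
      unfolding vol S1 by (simp add: ennreal_mult'[symmetric] mult_ac)
    finally show "(\<integral>\<^sup>+V. ennreal (exp (- c) ^ k) * indicator (S (real k + 1)) V \<partial>lborel) = ennreal (measure lborel (S 1) * ((real k + 1) ^ n * exp (- c) ^ k))" .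
  qed
  also have "\<dots> < \<infinity>"
  proof -
    \<comment> \<open>One half of the exponential decay beats the polynomial, the other half is
      summable.\<close>
    define \<theta> where "\<theta> = exp (- c / 2)"
    have \<theta>: "0 \<le> \<theta>" "\<theta> < 1" using c by (auto simp: \<theta>_def)
    have sq: "exp (- c) = \<theta> * \<theta>" by (simp add: \<theta>_def mult_exp_exp)
    obtain K where K: "\<And>k::nat. (real k + 1) ^ n * \<theta> ^ k \<le> K" using poly_geometric_bounded[OF \<theta>] by metis
    have "summable (\<lambda>k. (real k + 1) ^ n * exp (- c) ^ k)"
    proof (rule summable_comparison_test)
      show "\<exists>N. \<forall>k\<ge>N. norm ((real k + 1) ^ n * exp (- c) ^ k) \<le> K * \<theta> ^ k"
      proof (intro exI allI impI)
        fix k :: nat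
        have "(real k + 1) ^ n * exp (- c) ^ k = ((real k + 1) ^ n * \<theta> ^ k) * \<theta> ^ k"
          by (simp add: sq power_mult_distrib)
        also have "\<dots> \<le> K * \<theta> ^ k" using \<theta> K by (intro mult_right_mono) auto
        finally show "norm ((real k + 1) ^ n * exp (- c) ^ k) \<le> K * \<theta> ^ k" by simp
      qed
      show "summable (\<lambda>k. K * \<theta> ^ k)" using \<theta> by (intro summable_mult summable_geometric) auto
    qed
    then have "summable (\<lambda>k. measure lborel (S 1) * ((real k + 1) ^ n * exp (- c) ^ k))" by (rule summable_mult)
    then have "(\<Sum>k. ennreal (measure lborel (S 1) * ((real k + 1) ^ n * exp (- c) ^ k)))
      = ennreal (\<Sum>k. measure lborel (S 1) * ((real k + 1) ^ n * exp (- c) ^ k))"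
      by (intro suminf_ennreal2) auto
    then show ?thesis by simp
  qed
  finally have "(\<integral>\<^sup>+V. ennreal (f V) \<partial>lborel) < \<infinity>" .
  moreover have "0 \<le> f V" for V by (simp add: f_def)
  ultimately have "integrable lborel f" by (intro integrableI_bounded) auto
  then show ?thesis unfolding f_def n_def .
qed

lemma borel_measurable_cap [measurable]: "cap \<in> borel_measurable borel"
proof -
  define g where "g y x = (indicator {x. 1 \<le> x \<bullet> y} x :: real)" for x y :: 'a
  have "case_prod g = indicator {p. 1 \<le> snd p \<bullet> fst p}"
    by (auto simp: indicator_def g_def)
  then have "case_prod g \<in> borel_measurable (borel \<Otimes>\<^sub>M uniform_sphere)" by simp
  from uniform_sphere.borel_measurable_lebesgue_integral[OF this]
  have "(\<lambda>y. \<integral>x. g y x \<partial>uniform_sphere) \<in> borel_measurable borel" .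
  then show ?thesis by (simp add: cap_def[abs_def] g_def)
qed

lemma cap_norm_1:
  fixes y :: "real ^ 'n::finite"
  assumes d: "2 \<le> CARD('n)" and y: "norm y = 1"
  shows "cap y = 0"
proof -
  have d': "2 \<le> DIM(real ^ 'n)" using d by simp
  have "AE x in uniform_sphere. \<not> 1 \<le> x \<bullet> y"
    using AE_uniform_sphere AE_uniform_sphere_hyperplane_1[OF d', of y]
  proof eventually_elim
    case (elim x)
    then show ?case using norm_cauchy_schwarz[of x y] y by auto
  qed
  then show ?thesis unfolding cap_def by (intro uniform_sphere.prob_eq_0[THEN iffD2]) auto
qed

lemma det_nz_iff_ker: "det (A :: real ^ 'n ^ 'n::finite) \<noteq> 0 \<longleftrightarrow> (\<forall>u. (\<forall>i. A $ i \<bullet> u = 0) \<longrightarrow> u = 0)"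
proof -
  have "det A \<noteq> 0 \<longleftrightarrow> (\<forall>u. A *v u = 0 \<longrightarrow> u = 0)"
    by (metis invertible_det_nz invertible_left_inverse matrix_left_invertible_ker)
  moreover have "A *v u = 0 \<longleftrightarrow> (\<forall>i. A $ i \<bullet> u = 0)" for u
    by (simp add: vec_eq_iff matrix_vector_mult_def inner_vec_def)
  ultimately show ?thesis by simp
qed

section \<open>The sample with one point pinned\<close>

lemma squeeze_sym: "squeeze e t a \<bullet> b = a \<bullet> squeeze e t b"
  by (simp add: squeeze_def perp_def inner_add_left inner_add_right inner_diff_left inner_diff_right inner_commute)

text \<open>The bijection \<open>f\<close> assigns sample indices to matrix rows, with index 0 in
  row \<open>k0\<close>. Pinning that point at the basis vector of the same row means that
  \<open>pinned\<close> is a matrix with one axis row left unreplaced, as in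
  \<open>AE_det_mixed_rows\<close>, and that \<open>squeeze e\<close> is diagonal.\<close>

locale first_point_fixed =
  fixes f :: "'n::finite \<Rightarrow> nat" and k0 :: 'n and d :: nat and e :: "real ^ 'n"
  assumes d: "d = CARD('n)" "2 \<le> d" and f: "bij_betw f UNIV {..<d}" and k0: "f k0 = 0"
    and e_def: "e = axis k0 1"
begin

abbreviation "I \<equiv> {1..<d}"

lemma e_Basis: "e \<in> Basis" by (simp add: e_def axis_in_Basis_iff)
lemma ne: "norm e = 1" by (simp add: e_def)

definition pinned :: "(nat \<Rightarrow> real ^ 'n) \<Rightarrow> real ^ 'n ^ 'n" where
  "pinned X = row_matrix f (X(0 := e))"

lemma pinned_k0: "pinned X $ k0 = e"
  by (simp add: pinned_def row_matrix_def k0)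

lemma pinned_other: "j \<noteq> k0 \<Longrightarrow> pinned X $ j = X (f j) \<and> f j \<in> I"
proof -
  assume j: "j \<noteq> k0"
  have "f j \<noteq> f k0" using f j by (auto simp: bij_betw_def inj_on_def)
  moreover have "f j < d" using f by (auto simp: bij_betw_def)
  ultimately show ?thesis by (simp add: pinned_def row_matrix_def k0)
qed

lemma index_pinned: "i \<in> I \<Longrightarrow> \<exists>j. j \<noteq> k0 \<and> f j = i"
proof -
  assume i: "i \<in> I"
  then have "i \<in> range f" using f by (simp add: bij_betw_def)
  then obtain j where "f j = i" by auto
  moreover have "j \<noteq> k0" using \<open>f j = i\<close> i k0 by auto
  ultimately show ?thesis by blast
qed

lemma all_pinned: "(\<forall>j. P (pinned X $ j)) \<longleftrightarrow> P e \<and> (\<forall>i\<in>I. P (X i))"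
  by (metis index_pinned pinned_k0 pinned_other)

lemma det_pinned_iff: "det (pinned X) \<noteq> 0 \<longleftrightarrow> (\<forall>u. e \<bullet> u = 0 \<and> (\<forall>i\<in>I. X i \<bullet> u = 0) \<longrightarrow> u = 0)"
  unfolding det_nz_iff_ker using all_pinned[of "\<lambda>r. r \<bullet> _ = 0"] by simp

lemma unit_sol_pinned:
  assumes "det (pinned X) \<noteq> 0"
  shows "e \<bullet> unit_sol (pinned X) = 1" "i \<in> I \<Longrightarrow> X i \<bullet> unit_sol (pinned X) = 1"
  using unit_sol_iff[OF assms, of "unit_sol (pinned X)"] all_pinned[of "\<lambda>r. r \<bullet> unit_sol (pinned X) = 1" X] by auto

lemma I_ne: "I \<noteq> {}" "finite I" "card I = d - 1" using d(2) by auto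

lemma pinned_nz:
  assumes "det (pinned V) \<noteq> 0" "i \<in> I"
  shows "V i \<noteq> 0"
proof
  assume 0: "V i = 0"
  obtain j where j: "j \<noteq> k0" "f j = i" using index_pinned assms(2) by blast
  then have "row j (pinned V) = 0" using pinned_other[OF j(1), of V] 0 by (simp add: row_def vec_eq_iff)
  then show False using assms(1) det_zero_row(2) by blast
qed

text \<open>The change of variables: \<open>proj_sq t V\<close> is the sample obtained from vectors \<open>V i\<close> whose components
  orthogonal to \<open>e\<close> are measured in units of \<open>t\<close>.\<close>

definition proj_sq :: "real \<Rightarrow> (nat \<Rightarrow> real ^ 'n) \<Rightarrow> nat \<Rightarrow> real ^ 'n" where
  "proj_sq t V = (\<lambda>i\<in>I. proj_sphere (squeeze e t (V i)))"

lemma squeeze_eq_0: "t > 0 \<Longrightarrow> squeeze e t v = 0 \<longleftrightarrow> v = 0"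
proof
  assume t: "t > 0" and "squeeze e t v = 0"
  then have "v \<bullet> e = 0" "t *\<^sub>R perp e v = 0"
    using squeeze_inner[OF ne, of t v] perp_squeeze[OF ne, of t v] by (simp_all add: perp_def)
  then show "v = 0" using t by (simp add: perp_def)
qed (simp add: squeeze_def perp_def)

text \<open>\<open>squeeze\<close> is self-adjoint, so it can be moved from the sample points to
  \<open>y\<close>. The last equation therefore has the fixed coefficient vector \<open>V i\<close>;
  only its right-hand side depends on \<open>t\<close>.\<close>

lemma squeezed_solution:
  assumes t: "t > 0" and D: "det (pinned V) \<noteq> 0"
  defines "y \<equiv> unit_sol (pinned (proj_sq t V))"
  shows "e \<bullet> y = 1" "i \<in> I \<Longrightarrow> proj_sq t V i \<bullet> y = 1" "i \<in> I \<Longrightarrow> norm (proj_sq t V i) = 1"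
    "i \<in> I \<Longrightarrow> V i \<bullet> squeeze e t y = norm (squeeze e t (V i))"
proof -
  have nz: "norm (squeeze e t (V i)) > 0" if "i \<in> I" for i
    using pinned_nz[OF D that] squeeze_eq_0[OF t] by simp
  have "det (pinned (proj_sq t V)) \<noteq> 0"
    unfolding det_pinned_iff
  proof (intro allI impI)
    fix u assume u: "e \<bullet> u = 0 \<and> (\<forall>i\<in>I. proj_sq t V i \<bullet> u = 0)"
    have "V i \<bullet> squeeze e t u = 0" if "i \<in> I" for i
      using u nz[OF that] that unfolding squeeze_sym[symmetric] by (auto simp: proj_sq_def)
    moreover have "e \<bullet> squeeze e t u = 0" using u squeeze_inner[OF ne, of t u] by (simp add: inner_commute)
    ultimately have "squeeze e t u = 0" using D unfolding det_pinned_iff by blast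
    then show "u = 0" using squeeze_eq_0[OF t] by blast
  qed
  from unit_sol_pinned[OF this]
  show 1: "e \<bullet> y = 1" and 2: "i \<in> I \<Longrightarrow> proj_sq t V i \<bullet> y = 1" by (simp_all add: y_def)
  show "i \<in> I \<Longrightarrow> norm (proj_sq t V i) = 1" using nz[of i] by (simp add: proj_sq_def)
  show "V i \<bullet> squeeze e t y = norm (squeeze e t (V i))" if i: "i \<in> I"
  proof -
    have "(squeeze e t (V i) /\<^sub>R norm (squeeze e t (V i))) \<bullet> y = 1"
      using unit_sol_pinned(2)[OF \<open>det (pinned (proj_sq t V)) \<noteq> 0\<close> i] i by (simp add: proj_sq_def y_def)
    then show ?thesis unfolding squeeze_sym[symmetric] using nz[OF i] by (simp add: field_simps)
  qed
qed

definition scale :: "nat \<Rightarrow> real" where "scale m = root (d - 1) (1 / real m)"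

lemma scale_pow: "m > 0 \<Longrightarrow> scale m ^ (d - 1) = 1 / real m"
  unfolding scale_def using d(2) by (intro real_root_pow_pos2) auto

lemma scale_pos: "m > 0 \<Longrightarrow> scale m > 0"
  unfolding scale_def using d(2) by simp

lemma scale_tendsto: "scale \<longlonglongrightarrow> 0"
proof -
  have "(\<lambda>m. root (d - 1) (1 / real m)) \<longlonglongrightarrow> root (d - 1) 0"
    by (intro tendsto_real_root lim_1_over_n)
  then show ?thesis by (simp add: scale_def[abs_def])
qed

definition integrand :: "nat \<Rightarrow> (nat \<Rightarrow> real ^ 'n) \<Rightarrow> real" where
  "integrand m X = (1 - cap (unit_sol (pinned X))) ^ (m - d)"

text \<open>The integrand after the change of variables; the indicators are what remains of the
  density of the vectors \<open>V i\<close> once constants are removed.\<close>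

definition scaled :: "nat \<Rightarrow> (nat \<Rightarrow> real ^ 'n) \<Rightarrow> real" where
  "scaled m V = (\<Prod>i\<in>I. indicator (ball 0 1) (squeeze e (scale m) (V i))) * integrand m (proj_sq (scale m) V)"

lemma integrand_bounds: "0 \<le> integrand m X" "integrand m X \<le> 1"
  using cap_bounds[of "unit_sol (pinned X)"] by (auto simp: integrand_def power_le_one)

text \<open>Division by a norm below 1 can only enlarge the component orthogonal to
  \<open>e\<close>.\<close>

lemma far_from_e:
  assumes t: "t > 0" and n1: "norm (squeeze e t v) < 1" and v: "v \<noteq> 0"
  shows "t * norm (perp e v) \<le> norm (proj_sphere (squeeze e t v) - e)"
proof -
  let ?s = "squeeze e t v"
  have n0: "norm ?s > 0" using v squeeze_eq_0[OF t] by simp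
  have "perp e (proj_sphere ?s - e) = proj_sphere ?s - (proj_sphere ?s \<bullet> e) *\<^sub>R e"
    by (simp add: perp_def inner_diff_left inner_self_1[OF ne] algebra_simps)
  also have "\<dots> = (1 / norm ?s) *\<^sub>R perp e ?s" by (simp add: perp_def divide_inverse algebra_simps)
  also have "\<dots> = (1 / norm ?s) *\<^sub>R (t *\<^sub>R perp e v)" by (simp only: perp_squeeze[OF ne])
  finally have "norm (perp e (proj_sphere ?s - e)) = (1 / norm ?s) * (t * norm (perp e v))"
    using t by simp
  then have "(1 / norm ?s) * (t * norm (perp e v)) \<le> norm (proj_sphere ?s - e)"
    using norm_perp_le[OF ne, of "proj_sphere ?s - e"] by simp
  moreover have "1 * (t * norm (perp e v)) \<le> (1 / norm ?s) * (t * norm (perp e v))"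
    using n0 n1 t by (intro mult_right_mono) auto
  ultimately show ?thesis by simp
qed

text \<open>The point \<open>e\<close> and each projected point lie on the boundary of the cap of
  \<open>y\<close>. So \<open>cap_lower_bound\<close> and \<open>scale m ^ (d - 1) = 1 / m\<close>
  give \<open>m * cap y >= c * norm (perp e (V i)) ^ (d - 1)\<close> for every \<open>i\<close>.
  Averaging over \<open>i\<close> makes the resulting exponential factor over the
  coordinates.\<close>

lemma scaled_dominated:
  obtains c where "c > 0" "\<And>m V. 2 * d \<le> m \<Longrightarrow> det (pinned V) \<noteq> 0 \<Longrightarrow>
    \<bar>scaled m V\<bar> \<le> (\<Prod>i\<in>I. indicator {v. \<bar>v \<bullet> e\<bar> \<le> 1} (V i) * exp (- c * norm (perp e (V i)) ^ (d - 1)))"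
proof -
  obtain c where c: "c > 0"
    "\<And>x x' y :: real ^ 'n. norm x = 1 \<Longrightarrow> norm x' = 1 \<Longrightarrow> x \<bullet> y = 1 \<Longrightarrow> x' \<bullet> y = 1 \<Longrightarrow> c * norm (x - x') ^ (d - 1) \<le> cap y"
    using cap_lower_bound[where 'n = 'n] d by metis
  \<comment> \<open>The factor \<open>d - 1\<close> comes from averaging over the indices, the
    factor 2 from \<open>m - d >= m / 2\<close>.\<close>
  define c' where "c' = c / (2 * real (d - 1))"
  have dpos: "real (d - 1) > 0" using d(2) by simp
  have c': "c' > 0" using c dpos by (simp add: c'_def)
  show ?thesis
  proof
    fix m V assume m: "2 * d \<le> m" and D: "det (pinned V) \<noteq> 0"
    have mpos: "m > 0" using m d(2) by simp
    define t where "t = scale m"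
    have t: "t > 0" "t ^ (d - 1) = 1 / real m" using scale_pos[OF mpos] scale_pow[OF mpos] by (simp_all add: t_def)
    define y where "y = unit_sol (pinned (proj_sq t V))"
    show "\<bar>scaled m V\<bar> \<le> (\<Prod>i\<in>I. indicator {v. \<bar>v \<bullet> e\<bar> \<le> 1} (V i) * exp (- c' * norm (perp e (V i)) ^ (d - 1)))"
    proof (cases "\<forall>i\<in>I. norm (squeeze e t (V i)) < 1")
      case False
      then have "scaled m V = 0"
        by (auto simp: scaled_def t_def[symmetric] indicator_def prod_zero_iff)
      then show ?thesis by (simp add: prod_nonneg)
    next
      case True
      have slab: "\<bar>V i \<bullet> e\<bar> \<le> 1" if "i \<in> I" for i
      proof -
        have "\<bar>squeeze e t (V i) \<bullet> e\<bar> \<le> norm (squeeze e t (V i)) * norm e" by (rule Cauchy_Schwarz_ineq2)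
        then show ?thesis using True that ne squeeze_inner[OF ne, of t "V i"] by force
      qed
      have capi: "c * norm (perp e (V i)) ^ (d - 1) / real m \<le> cap y" if i: "i \<in> I" for i
      proof -
        have "c * norm (perp e (V i)) ^ (d - 1) / real m = c * (t * norm (perp e (V i))) ^ (d - 1)"
          unfolding power_mult_distrib t(2) by simp
        also have "\<dots> \<le> c * norm (proj_sq t V i - e) ^ (d - 1)"
          using c(1) t far_from_e[OF t(1), of "V i"] True i pinned_nz[OF D i]
          by (intro mult_left_mono power_mono) (auto simp: proj_sq_def)
        also have "\<dots> \<le> cap y"
          unfolding y_def using squeezed_solution[OF t(1) D] i ne by (intro c(2)) auto
        finally show ?thesis .
      qed
      define S where "S = (\<Sum>i\<in>I. norm (perp e (V i)) ^ (d - 1))"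
      have "(\<Sum>i\<in>I. c * norm (perp e (V i)) ^ (d - 1) / real m) \<le> (\<Sum>i\<in>I. cap y)"
        by (intro sum_mono capi)
      then have "c * S / real m \<le> real (d - 1) * cap y"
        using I_ne by (simp add: S_def sum_distrib_left sum_divide_distrib)
      then have capS: "c * S \<le> real (d - 1) * cap y * real m"
        using mpos by (simp add: pos_divide_le_eq)
      have md: "real m / 2 \<le> real (m - d)" using m by (simp add: of_nat_diff)
      have "scaled m V = integrand m (proj_sq t V)"
        using True by (simp add: scaled_def t_def[symmetric] indicator_def)
      also have "\<dots> = (1 - cap y) ^ (m - d)" by (simp add: integrand_def y_def)
      also have "\<dots> \<le> exp (- cap y) ^ (m - d)"
        using cap_bounds[of y] exp_ge_add_one_self[of "- cap y"] by (intro power_mono) auto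
      also have "\<dots> = exp (- (real (m - d) * cap y))" by (simp add: exp_of_nat_mult[symmetric])
      also have "\<dots> \<le> exp (- (c' * S))"
      proof -
        have "c' * S = c * S / real (d - 1) / 2" by (simp add: c'_def)
        also have "\<dots> \<le> cap y * real m / 2"
        proof -
          have "c * S / real (d - 1) \<le> cap y * real m"
            using capS dpos by (subst pos_divide_le_eq) (simp_all only: mult_ac)
          then show ?thesis by simp
        qed
        also have "\<dots> \<le> cap y * real (m - d)" using mult_left_mono[OF md cap_bounds(1)[of y]] by simp
        finally show ?thesis by (simp add: mult.commute)
      qed
      also have "\<dots> = (\<Prod>i\<in>I. exp (- c' * norm (perp e (V i)) ^ (d - 1)))"
        using I_ne by (simp add: S_def sum_distrib_left exp_sum[symmetric] sum_negf)
      also have "\<dots> = (\<Prod>i\<in>I. indicator {v. \<bar>v \<bullet> e\<bar> \<le> 1} (V i) * exp (- c' * norm (perp e (V i)) ^ (d - 1)))"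
        using slab by (intro prod.cong) auto
      finally have "scaled m V \<le> (\<Prod>i\<in>I. indicator {v. \<bar>v \<bullet> e\<bar> \<le> 1} (V i) * exp (- c' * norm (perp e (V i)) ^ (d - 1)))" .
      moreover have "0 \<le> scaled m V" by (simp add: scaled_def integrand_bounds prod_nonneg)
      ultimately show ?thesis by simp
    qed
  qed (rule c')
qed

end

section \<open>Pointwise convergence of the scaled integrand\<close>

context first_point_fixed
begin

lemma squeeze_tendsto:
  assumes "t \<longlonglongrightarrow> 0"
  shows "(\<lambda>m::nat. norm (squeeze e (t m) v)) \<longlonglongrightarrow> \<bar>v \<bullet> e\<bar>"
proof -
  have "(\<lambda>m. norm ((v \<bullet> e) *\<^sub>R e + t m *\<^sub>R perp e v)) \<longlonglongrightarrow> norm ((v \<bullet> e) *\<^sub>R e + 0 *\<^sub>R perp e v)"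
    by (intro tendsto_intros assms)
  then show ?thesis using ne by (simp add: squeeze_def)
qed

text \<open>The projected point stays in the hemisphere opposite to \<open>e\<close>, at distance at
  least 1 from \<open>e\<close>. So the cap has measure at least a fixed \<open>c\<close>, and the
  power decays geometrically.\<close>

lemma scaled_tendsto_0_back:
  assumes D: "det (pinned V) \<noteq> 0" and i: "i \<in> I" "V i \<bullet> e < 0"
  shows "(\<lambda>m. scaled m V) \<longlonglongrightarrow> 0"
proof -
  obtain c where c: "c > 0"
    "\<And>x x' y :: real ^ 'n. norm x = 1 \<Longrightarrow> norm x' = 1 \<Longrightarrow> x \<bullet> y = 1 \<Longrightarrow> x' \<bullet> y = 1 \<Longrightarrow> c * norm (x - x') ^ (d - 1) \<le> cap y"
    using cap_lower_bound[where 'n = 'n] d by metis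
  have le: "c \<le> cap (unit_sol (pinned (proj_sq (scale m) V)))" if m: "m > 0" for m
  proof -
    define t where "t = scale m"
    have t: "t > 0" using scale_pos[OF m] by (simp add: t_def)
    note sol = squeezed_solution[OF t D]
    have "proj_sq t V i \<bullet> e < 0"
      using i pinned_nz[OF D i(1)] squeeze_eq_0[OF t] by (simp add: proj_sq_def squeeze_inner[OF ne] mult_less_0_iff)
    moreover have "\<bar>(proj_sq t V i - e) \<bullet> e\<bar> \<le> norm (proj_sq t V i - e) * norm e" by (rule Cauchy_Schwarz_ineq2)
    ultimately have "1 \<le> norm (proj_sq t V i - e)" using ne by (simp add: inner_diff_left inner_self_1[OF ne])
    then have "c * 1 \<le> c * norm (proj_sq t V i - e) ^ (d - 1)" using c(1) by (intro mult_left_mono) (auto simp: one_le_power)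
    also have "\<dots> \<le> cap (unit_sol (pinned (proj_sq t V)))" using sol i ne by (intro c(2)) auto
    finally show ?thesis by (simp add: t_def)
  qed
  have c1: "c \<le> 1" using le[of 1] cap_bounds(2) order_trans by fastforce
  have "(\<lambda>m. (1 - c) ^ m) \<longlonglongrightarrow> 0" using c(1) c1 by (intro LIMSEQ_realpow_zero) auto
  then have "(\<lambda>m. (1 - c) ^ ((m + d) - d)) \<longlonglongrightarrow> 0" by simp
  then have lim: "(\<lambda>m. (1 - c) ^ (m - d)) \<longlonglongrightarrow> 0"
    by (rule LIMSEQ_offset[where f = "\<lambda>m. (1 - c) ^ (m - d)"])
  show ?thesis
  proof (rule tendsto_sandwich[OF _ _ tendsto_const lim])
    show "eventually (\<lambda>m. 0 \<le> scaled m V) sequentially"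
      by (intro always_eventually allI) (simp add: scaled_def integrand_bounds prod_nonneg)
    show "eventually (\<lambda>m. scaled m V \<le> (1 - c) ^ (m - d)) sequentially"
    proof (intro eventually_sequentiallyI[of 1])
      fix m :: nat assume m: "1 \<le> m"
      have "scaled m V \<le> 1 * integrand m (proj_sq (scale m) V)"
        unfolding scaled_def by (intro mult_right_mono prod_le_1 integrand_bounds) (auto simp: indicator_def)
      also have "\<dots> \<le> (1 - c) ^ (m - d)"
        unfolding integrand_def mult_1 using le[of m] m cap_bounds(2) by (intro power_mono) auto
      finally show "scaled m V \<le> (1 - c) ^ (m - d)" .
    qed
  qed
qed

text \<open>Let \<open>y\<close> be dual to the hyperplane through the projected points. Then \<open>squeeze e t y\<close> solves a
  linear system whose matrix \<open>pinned V\<close> does not depend on \<open>t\<close>, and \<open>(squeeze e t y - e) / t\<^sup>2\<close>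
  converges.\<close>

lemma integrand_tendsto_front:
  assumes D: "det (pinned V) \<noteq> 0" and pos: "\<And>i. i \<in> I \<Longrightarrow> V i \<bullet> e > 0"
  obtains l where "(\<lambda>m. integrand m (proj_sq (scale m) V)) \<longlonglongrightarrow> l"
proof -
  define y where "y m = unit_sol (pinned (proj_sq (scale m) V))" for m
  define A where "A = pinned V"
  \<comment> \<open>The right-hand side of the linear system for \<open>squeeze e t y - e\<close>,
    divided by \<open>t ^ 2\<close>. Row \<open>k0\<close> gives 0 because both \<open>y\<close> and
    \<open>e\<close> have inner product 1 with \<open>e\<close>.\<close>
  define \<delta> where "\<delta> m = (\<chi> j. if j = k0 then 0 else (norm (perp e (V (f j))))\<^sup>2 / (norm (squeeze e (scale m) (V (f j))) + V (f j) \<bullet> e))" for m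
  define \<delta>' where "\<delta>' = (\<chi> j. if j = k0 then 0 else (norm (perp e (V (f j))))\<^sup>2 / (\<bar>V (f j) \<bullet> e\<bar> + V (f j) \<bullet> e))"
  define \<zeta> where "\<zeta> m = matrix_inv A *v \<delta> m" for m
  have Ainv: "matrix_inv A ** A = mat 1"
    using D unfolding A_def invertible_det_nz[symmetric] matrix_inv_def invertible_def by (rule someI2_ex) simp
  have "\<delta> \<longlonglongrightarrow> \<delta>'"
  proof (rule vec_tendstoI)
    fix j
    show "(\<lambda>m. \<delta> m $ j) \<longlonglongrightarrow> \<delta>' $ j"
    proof (cases "j = k0")
      case False
      then have "V (f j) \<bullet> e > 0" using pos pinned_other by blast
      moreover have "(\<lambda>m. (norm (perp e (V (f j))))\<^sup>2 / (norm (squeeze e (scale m) (V (f j))) + V (f j) \<bullet> e))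
        \<longlonglongrightarrow> (norm (perp e (V (f j))))\<^sup>2 / (\<bar>V (f j) \<bullet> e\<bar> + V (f j) \<bullet> e)"
        using \<open>V (f j) \<bullet> e > 0\<close>
        by (intro tendsto_divide tendsto_add squeeze_tendsto scale_tendsto tendsto_const) simp
      ultimately show ?thesis using False by (simp only: \<delta>_def \<delta>'_def vec_lambda_beta if_False)
    qed (simp add: \<delta>_def \<delta>'_def)
  qed
  then have \<zeta>lim: "\<zeta> \<longlonglongrightarrow> matrix_inv A *v \<delta>'"
    unfolding \<zeta>_def by (rule bounded_linear.tendsto[OF matrix_vector_mul_bounded_linear])
  have key: "norm (perp e (y m)) = scale m * norm (\<zeta> m) \<and> y m \<bullet> e = 1" if m: "m > 0" for m
  proof -
    define t where "t = scale m"
    have t: "t > 0" using scale_pos[OF m] by (simp add: t_def)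
    note sol = squeezed_solution[OF t D, folded y_def t_def]
    define z where "z = squeeze e t (y m)"
    have sol1: "e \<bullet> y m = 1" using sol(1) by (simp add: y_def t_def)
    have ze: "e \<bullet> z = 1" unfolding z_def using sol1 squeeze_inner[OF ne, of t "y m"] by (simp add: inner_commute)
    have "A *v (z - e) = t\<^sup>2 *\<^sub>R \<delta> m"
    proof (rule vec_eq_iff[THEN iffD2], rule allI)
      fix j
      have Aj: "(A *v u) $ j = A $ j \<bullet> u" for u by (simp add: matrix_vector_mult_def inner_vec_def)
      show "(A *v (z - e)) $ j = (t\<^sup>2 *\<^sub>R \<delta> m) $ j"
      proof (cases "j = k0")
        case True
        then show ?thesis unfolding Aj using ze inner_self_1[OF ne] by (simp add: A_def pinned_k0 \<delta>_def inner_diff_right)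
      next
        case False
        let ?v = "V (f j)"
        have fj: "f j \<in> I" "pinned V $ j = ?v" using pinned_other[OF False] by auto
        have s: "?v \<bullet> e > 0" using pos fj by simp
        have n: "norm (squeeze e t ?v) + ?v \<bullet> e > 0" using s norm_ge_zero[of "squeeze e t ?v"] by linarith
        have "?v \<bullet> z = norm (squeeze e t ?v)" unfolding z_def using sol(4)[OF fj(1)] by (simp add: y_def t_def)
        then have "(A *v (z - e)) $ j = norm (squeeze e t ?v) - ?v \<bullet> e"
          unfolding Aj by (simp add: A_def fj inner_diff_right)
        \<comment> \<open>Rationalising exhibits the factor \<open>t ^ 2\<close>; the denominator
          stays away from 0 because \<open>V i \<bullet> e\<close> is positive.\<close>
        also have "\<dots> = ((norm (squeeze e t ?v))\<^sup>2 - (?v \<bullet> e)\<^sup>2) / (norm (squeeze e t ?v) + ?v \<bullet> e)"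
          using n by (simp add: power2_eq_square square_diff_square_factored)
        also have "\<dots> = t\<^sup>2 * (norm (perp e ?v))\<^sup>2 / (norm (squeeze e t ?v) + ?v \<bullet> e)"
          by (simp add: norm_squeeze[OF ne])
        finally show ?thesis using False by (simp add: \<delta>_def t_def)
      qed
    qed
    then have "matrix_inv A *v (A *v (z - e)) = matrix_inv A *v (t\<^sup>2 *\<^sub>R \<delta> m)" by simp
    then have zz: "z - e = t\<^sup>2 *\<^sub>R \<zeta> m"
      by (simp add: matrix_vector_mul_assoc Ainv \<zeta>_def matrix_vector_mult_scaleR)
    have "t *\<^sub>R perp e (y m) = perp e z" by (simp add: z_def perp_squeeze[OF ne])
    also have "\<dots> = t\<^sup>2 *\<^sub>R \<zeta> m" using ze zz by (simp add: perp_def inner_commute)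
    finally have "t *\<^sub>R perp e (y m) = t *\<^sub>R (t *\<^sub>R \<zeta> m)" by (simp add: power2_eq_square)
    then have "perp e (y m) = t *\<^sub>R \<zeta> m" using t by (metis less_irrefl scaleR_cancel_left)
    then show ?thesis using t sol1 by (simp add: t_def inner_commute)
  qed
  obtain k where k: "k > 0"
    "\<And>y :: real ^ 'n. 1 < norm y \<Longrightarrow> cap y \<le> k * sqrt ((norm y)\<^sup>2 - 1) ^ (CARD('n) - 1)"
    "\<And>y :: real ^ 'n. 1 < norm y \<Longrightarrow> k * sqrt ((norm y)\<^sup>2 - 1) ^ (CARD('n) - 1) * (1 / norm y) ^ CARD('n) \<le> cap y"
    using cap_asymptotics[where 'n = 'n] d by metis
  have ny: "(norm (y m))\<^sup>2 = 1 + (scale m * norm (\<zeta> m))\<^sup>2" if "m > 0" for m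
    using norm_perp[OF ne, of "y m"] key[OF that] by simp
  \<comment> \<open>Since \<open>y m\<close> has component 1 along \<open>e\<close> and
    \<open>scale m * norm (\<zeta> m)\<close> across, the latter is the quantity
    \<open>sqrt (norm y ^ 2 - 1)\<close> of the cap bounds, and its power \<open>d - 1\<close>
    contains exactly the factor \<open>1 / m\<close>.\<close>
  have bounds: "k * norm (\<zeta> m) ^ (d - 1) * (1 / sqrt (1 + (scale m * norm (\<zeta> m))\<^sup>2)) ^ d \<le> real m * cap (y m)
      \<and> real m * cap (y m) \<le> k * norm (\<zeta> m) ^ (d - 1)" if m: "m > 0" for m
  proof -
    have nys: "norm (y m) = sqrt (1 + (scale m * norm (\<zeta> m))\<^sup>2)"
      using ny[OF m] by (metis norm_ge_zero real_sqrt_unique)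
    have sq: "sqrt ((norm (y m))\<^sup>2 - 1) = scale m * norm (\<zeta> m)"
      using ny[OF m] scale_pos[OF m] by simp
    have ms: "real m * (scale m * norm (\<zeta> m)) ^ (d - 1) = norm (\<zeta> m) ^ (d - 1)"
      unfolding power_mult_distrib scale_pow[OF m] using m by simp
    show ?thesis
    proof (cases "\<zeta> m = 0")
      case True
      \<comment> \<open>The hyperplane is tangent to the sphere; the cap bounds do not cover this
        case, but the cap is null.\<close>
      then have "norm (y m) = 1" using nys by simp
      then have "cap (y m) = 0" using cap_norm_1 d by simp
      then show ?thesis using True d(2) by (simp add: power_0_left)
    next
      case False
      then have "0 < (scale m * norm (\<zeta> m))\<^sup>2" using scale_pos[OF m] by simp
      then have "1 < norm (y m)" unfolding nys by (subst real_less_rsqrt) auto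
      note b = k(2)[OF this] k(3)[OF this]
      have "real m * cap (y m) \<le> real m * (k * (scale m * norm (\<zeta> m)) ^ (d - 1))"
        using b(1) unfolding sq d(1)[symmetric] by (intro mult_left_mono) auto
      also have "\<dots> = k * norm (\<zeta> m) ^ (d - 1)" using ms by (simp add: mult.left_commute)
      finally have 1: "real m * cap (y m) \<le> k * norm (\<zeta> m) ^ (d - 1)" .
      have "k * norm (\<zeta> m) ^ (d - 1) * (1 / sqrt (1 + (scale m * norm (\<zeta> m))\<^sup>2)) ^ d
          = real m * (k * (scale m * norm (\<zeta> m)) ^ (d - 1) * (1 / norm (y m)) ^ d)"
        unfolding ms[symmetric] nys by (simp add: mult_ac)
      also have "\<dots> \<le> real m * cap (y m)"
        using b(2) unfolding sq d(1)[symmetric] by (intro mult_left_mono) auto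
      finally show ?thesis using 1 by simp
    qed
  qed
  let ?L = "k * norm (matrix_inv A *v \<delta>') ^ (d - 1)"
  have "(\<lambda>m. real m * cap (y m)) \<longlonglongrightarrow> ?L"
  proof (rule tendsto_sandwich)
    show "eventually (\<lambda>m. k * norm (\<zeta> m) ^ (d - 1) * (1 / sqrt (1 + (scale m * norm (\<zeta> m))\<^sup>2)) ^ d \<le> real m * cap (y m)) sequentially"
      using bounds by (intro eventually_sequentiallyI[of 1]) auto
    show "eventually (\<lambda>m. real m * cap (y m) \<le> k * norm (\<zeta> m) ^ (d - 1)) sequentially"
      using bounds by (intro eventually_sequentiallyI[of 1]) auto
    show "(\<lambda>m. k * norm (\<zeta> m) ^ (d - 1)) \<longlonglongrightarrow> ?L" by (intro tendsto_intros \<zeta>lim)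
    have "(\<lambda>m. k * norm (\<zeta> m) ^ (d - 1) * (1 / sqrt (1 + (scale m * norm (\<zeta> m))\<^sup>2)) ^ d)
      \<longlonglongrightarrow> ?L * (1 / sqrt (1 + (0 * norm (matrix_inv A *v \<delta>'))\<^sup>2)) ^ d"
      by (intro tendsto_intros \<zeta>lim scale_tendsto) auto
    then show "(\<lambda>m. k * norm (\<zeta> m) ^ (d - 1) * (1 / sqrt (1 + (scale m * norm (\<zeta> m))\<^sup>2)) ^ d) \<longlonglongrightarrow> ?L" by simp
  qed
  then have "(\<lambda>m. (1 - cap (y m)) ^ (m - d)) \<longlonglongrightarrow> exp (- ?L)"
    by (intro power_one_minus_tendsto cap_bounds)
  then show ?thesis using that by (simp add: integrand_def y_def)
qed

text \<open>A component larger than 1 along \<open>e\<close> puts the point outside the ellipsoid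
  for every \<open>m\<close>. A negative one leads to the limit 0. If all components lie strictly
  between 0 and 1, the indicators are eventually 1 and the front case applies. The excluded values
  form a null set.\<close>

lemma scaled_convergent:
  assumes D: "det (pinned V) \<noteq> 0" and V: "\<And>i. i \<in> I \<Longrightarrow> V i \<bullet> e \<noteq> 0 \<and> \<bar>V i \<bullet> e\<bar> \<noteq> 1"
  shows "convergent (\<lambda>m. scaled m V)"
proof (cases "\<exists>i\<in>I. \<bar>V i \<bullet> e\<bar> > 1")
  case True
  then obtain i where i: "i \<in> I" "\<bar>V i \<bullet> e\<bar> > 1" by blast
  have "scaled m V = 0" for m
  proof -
    have "\<bar>squeeze e (scale m) (V i) \<bullet> e\<bar> \<le> norm (squeeze e (scale m) (V i)) * norm e" by (rule Cauchy_Schwarz_ineq2)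
    then have "squeeze e (scale m) (V i) \<notin> ball 0 1" using i ne by (simp add: squeeze_inner[OF ne])
    then have "(\<Prod>i\<in>I. indicator (ball 0 1) (squeeze e (scale m) (V i))) = (0::real)"
      using i(1) by (intro prod_zero) (auto simp: indicator_def)
    then show ?thesis by (simp add: scaled_def)
  qed
  then show ?thesis by (simp add: convergent_const)
next
  case False
  show ?thesis
  proof (cases "\<exists>i\<in>I. V i \<bullet> e < 0")
    case True
    then show ?thesis using scaled_tendsto_0_back[OF D] by (meson convergentI)
  next
    case F2: False
    then have "\<And>i. i \<in> I \<Longrightarrow> V i \<bullet> e > 0" using V by (meson linorder_neqE)
    then obtain l where l: "(\<lambda>m. integrand m (proj_sq (scale m) V)) \<longlonglongrightarrow> l"
      using integrand_tendsto_front[OF D] by metis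
    have "eventually (\<lambda>m. \<forall>i\<in>I. norm (squeeze e (scale m) (V i)) < 1) sequentially"
    proof (rule eventually_ball_finite)
      show "\<forall>i\<in>I. eventually (\<lambda>m. norm (squeeze e (scale m) (V i)) < 1) sequentially"
      proof
        fix i assume "i \<in> I"
        then have "\<bar>V i \<bullet> e\<bar> < 1" using False V by (meson linorder_neqE)
        then show "eventually (\<lambda>m. norm (squeeze e (scale m) (V i)) < 1) sequentially"
          by (rule order_tendstoD(2)[OF squeeze_tendsto[OF scale_tendsto]])
      qed
    qed simp
    then have "eventually (\<lambda>m. integrand m (proj_sq (scale m) V) = scaled m V) sequentially"
      by eventually_elim (simp add: scaled_def)
    then have "(\<lambda>m. scaled m V) \<longlonglongrightarrow> l" using l by (rule Lim_transform_eventually[rotated])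
    then show ?thesis by (rule convergentI)
  qed
qed

end

section \<open>Change of variables and dominated convergence\<close>

lemma AE_lborel_hyperplane:
  fixes a :: "'a::euclidean_space"
  assumes a: "a \<noteq> 0"
  shows "AE x in lborel. a \<bullet> x \<noteq> b"
proof -
  have "AE x in lebesgue. a \<bullet> x \<noteq> b"
    using negligible_hyperplane[of a b] a by (auto simp: negligible_iff_null_sets eventually_ae_filter)
  then have "AE x in completion lborel. a \<bullet> x \<noteq> b" by simp
  then show ?thesis by (simp add: AE_completion_iff)
qed

lemma sets_PiM_uniform_sphere: "sets (PiM I (\<lambda>_. uniform_sphere)) = sets (PiM I (\<lambda>_. borel))"
  by (rule sets_PiM_cong) auto

lemma sets_PiM_lborel: "sets (PiM I (\<lambda>_. lborel)) = sets (PiM I (\<lambda>_. borel))"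
  by (rule sets_PiM_cong) auto

context first_point_fixed
begin

lemma measurable_unit_sol_pinned [measurable]:
  "(\<lambda>X. unit_sol (pinned X)) \<in> borel_measurable (PiM I (\<lambda>_. borel))"
proof (rule borel_measurable_unit_sol)
  fix i j
  show "(\<lambda>X. pinned X $ i $ j) \<in> borel_measurable (PiM I (\<lambda>_. borel))"
  proof (cases "i = k0")
    case True
    then show ?thesis by (simp add: pinned_k0)
  next
    case False
    then have "(\<lambda>X. X (f i)) \<in> measurable (PiM I (\<lambda>_. borel)) (borel :: (real ^ 'n) measure)"
      using pinned_other by (intro measurable_component_singleton) auto
    then have "(\<lambda>X. X (f i) $ j) \<in> borel_measurable (PiM I (\<lambda>_. borel :: (real ^ 'n) measure))"
      by (rule borel_measurable_component)
    moreover have "(\<lambda>X. pinned X $ i $ j) = (\<lambda>X. X (f i) $ j)" using pinned_other[OF False] by auto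
    ultimately show ?thesis by simp
  qed
qed

lemma measurable_integrand [measurable]: "integrand m \<in> borel_measurable (PiM I (\<lambda>_. borel))"
  unfolding integrand_def[abs_def] by measurable

lemma measurable_proj_sq: "proj_sq t \<in> measurable (PiM I (\<lambda>_. borel)) (PiM I (\<lambda>_. borel))"
  unfolding proj_sq_def[abs_def]
proof (rule measurable_restrict)
  fix i assume "i \<in> I"
  then have [measurable]: "(\<lambda>V. V i) \<in> measurable (PiM I (\<lambda>_. borel)) (borel :: (real ^ 'n) measure)"
    by (rule measurable_component_singleton)
  show "(\<lambda>V. proj_sphere (squeeze e t (V i))) \<in> measurable (PiM I (\<lambda>_. borel)) (borel :: (real ^ 'n) measure)"
    by measurable
qed

lemma measurable_scaled: "scaled m \<in> borel_measurable (PiM I (\<lambda>_. borel))"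
proof -
  have "(\<lambda>V. indicator (ball 0 1) (squeeze e (scale m) (V i)) :: real) \<in> borel_measurable (PiM I (\<lambda>_. borel))" if "i \<in> I" for i
  proof -
    have 1: "(\<lambda>V. V i) \<in> measurable (PiM I (\<lambda>_. borel)) (borel :: (real ^ 'n) measure)"
      using that by (rule measurable_component_singleton)
    have 2: "(\<lambda>v. indicator (ball 0 1) (squeeze e (scale m) v) :: real) \<in> borel_measurable borel"
      by (rule measurable_compose[OF borel_measurable_squeeze]) (rule borel_measurable_indicator, rule borel_open, rule open_ball)
    show ?thesis by (rule measurable_compose[OF 1 2])
  qed
  then show ?thesis unfolding scaled_def[abs_def]
    by (intro borel_measurable_times borel_measurable_prod measurable_compose[OF measurable_proj_sq measurable_integrand])
qed

text \<open>Each of the \<open>d - 1\<close> free points contributes the constant density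
  \<open>scale m ^ (d - 1)\<close> over the ball volume, that is, a factor \<open>1 / m\<close>
  which cancels against \<open>m ^ (d - 1)\<close>. The map is applied coordinatewise to the product
  measure.\<close>

lemma integral_integrand:
  assumes m: "m > 0"
  shows "real m ^ (d - 1) * (\<integral>X. integrand m X \<partial>PiM I (\<lambda>_. uniform_sphere))
    = (1 / ball_vol TYPE(real ^ 'n)) ^ (d - 1) * (\<integral>V. scaled m V \<partial>PiM I (\<lambda>_. lborel))"
proof -
  define t where "t = scale m"
  have t: "t > 0" "t ^ (d - 1) = 1 / real m" using scale_pos[OF m] scale_pow[OF m] by (simp_all add: t_def)
  define b where "b = ball_vol TYPE(real ^ 'n)"
  have b: "b > 0" using ball_vol_pos by (simp add: b_def)
  define w where "w V = (1 / real m / b) * indicator (ball 0 1) (squeeze e t V)" for V :: "real ^ 'n"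
  have w0: "0 \<le> w V" for V using b by (simp add: w_def)
  have wm [measurable]: "w \<in> borel_measurable borel"
    unfolding w_def
    by (intro borel_measurable_times borel_measurable_const measurable_compose[OF borel_measurable_squeeze])
      (rule borel_measurable_indicator, rule borel_open, rule open_ball)
  define M where "M = density lborel (\<lambda>V. ennreal (w V))"
  have setsM [measurable_cong]: "sets M = sets borel" by (simp add: M_def)
  let ?\<phi> = "\<lambda>V. proj_sphere (squeeze e t V)"
  have us: "uniform_sphere = distr M borel ?\<phi>"
  proof -
    have "(\<lambda>V. ennreal (t ^ (DIM(real ^ 'n) - 1) / ball_vol TYPE(real ^ 'n)) * indicator (ball 0 1) (squeeze e t V)) = (\<lambda>V. ennreal (w V))"
      using d t by (auto simp: w_def b_def indicator_def)
    then show ?thesis using proj_squeeze_representation[OF e_Basis t(1)] by (simp add: M_def)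
  qed
  have us': "uniform_sphere = distr M uniform_sphere ?\<phi>"
  proof -
    have "distr M borel ?\<phi> = distr M uniform_sphere ?\<phi>" by (rule distr_cong) simp_all
    then show ?thesis by (rule trans[OF us])
  qed
  have PM: "prob_space M"
  proof (rule prob_spaceI)
    have "emeasure M (space M) = emeasure (distr M borel ?\<phi>) UNIV"
      by (subst emeasure_distr) (auto simp: M_def)
    then show "emeasure M (space M) = 1"
      unfolding us[symmetric] using uniform_sphere.emeasure_space_1 by simp
  qed
  have PiM_us: "PiM I (\<lambda>_. uniform_sphere) = distr (PiM I (\<lambda>_. M)) (PiM I (\<lambda>_. uniform_sphere)) (compose I ?\<phi>)"
  proof -
    have "distr (PiM I (\<lambda>_. M)) (PiM I (\<lambda>_. uniform_sphere)) (compose I ?\<phi>) = PiM I (\<lambda>_. distr M uniform_sphere ?\<phi>)"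
      using PM prob_space_uniform_sphere by (intro distr_PiM_finite_prob_space') auto
    then show ?thesis using us' by simp
  qed
  have PiM_M: "PiM I (\<lambda>_. M) = density (PiM I (\<lambda>_. lborel)) (\<lambda>V. ennreal (\<Prod>i\<in>I. w (V i)))"
  proof -
    have "PiM I (\<lambda>_. M) = density (PiM I (\<lambda>_. lborel)) (\<lambda>V. \<Prod>i\<in>I. ennreal (w (V i)))"
      unfolding M_def using PM unfolding M_def by (intro PiM_density_lborel) auto
    then show ?thesis using w0 by (simp add: prod_ennreal)
  qed
  have pr: "compose I ?\<phi> V = proj_sq t V" for V by (simp add: compose_def proj_sq_def restrict_def)
  have mi: "integrand m \<in> borel_measurable (PiM I (\<lambda>_. uniform_sphere))"
    unfolding measurable_cong_sets[OF sets_PiM_uniform_sphere refl] by (rule measurable_integrand)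
  have mM: "compose I ?\<phi> \<in> measurable (PiM I (\<lambda>_. M)) (PiM I (\<lambda>_. uniform_sphere))"
  proof -
    have "proj_sq t \<in> measurable (PiM I (\<lambda>_. M)) (PiM I (\<lambda>_. uniform_sphere))"
      using measurable_proj_sq[of t] setsM
      by (simp add: measurable_cong_sets[OF sets_PiM_cong[OF refl setsM] sets_PiM_uniform_sphere])
    moreover have "compose I ?\<phi> = proj_sq t" by (rule ext) (rule pr)
    ultimately show ?thesis by (simp only:)
  qed
  have "(\<integral>X. integrand m X \<partial>PiM I (\<lambda>_. uniform_sphere)) = (\<integral>V. integrand m (proj_sq t V) \<partial>PiM I (\<lambda>_. M))"
    by (subst PiM_us, subst integral_distr[OF mM mi]) (simp only: pr)
  also have "\<dots> = (\<integral>V. (\<Prod>i\<in>I. w (V i)) *\<^sub>R integrand m (proj_sq t V) \<partial>PiM I (\<lambda>_. lborel))"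
    unfolding PiM_M
  proof (rule integral_density)
    show "(\<lambda>V. integrand m (proj_sq t V)) \<in> borel_measurable (PiM I (\<lambda>_. lborel))"
      unfolding measurable_cong_sets[OF sets_PiM_lborel refl]
      by (rule measurable_compose[OF measurable_proj_sq measurable_integrand])
    show "(\<lambda>V. \<Prod>i\<in>I. w (V i)) \<in> borel_measurable (PiM I (\<lambda>_. lborel))"
      by measurable
    show "AE V in PiM I (\<lambda>_. lborel). 0 \<le> (\<Prod>i\<in>I. w (V i))" using w0 by (simp add: prod_nonneg)
  qed
  also have "\<dots> = (\<integral>V. (1 / real m / b) ^ (d - 1) * scaled m V \<partial>PiM I (\<lambda>_. lborel))"
    by (rule Bochner_Integration.integral_cong) (simp_all only: w_def scaled_def t_def prod.distrib prod_constant I_ne(3) real_scaleR_def mult.assoc)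
  also have "\<dots> = (1 / real m / b) ^ (d - 1) * (\<integral>V. scaled m V \<partial>PiM I (\<lambda>_. lborel))"
    by (rule Bochner_Integration.integral_mult_right_zero)
  finally show ?thesis using m by (simp add: b_def power_divide power_mult_distrib field_simps)
qed

lemma AE_good_directions:
  "AE V in PiM I (\<lambda>_. lborel). det (pinned V) \<noteq> 0 \<and> (\<forall>i\<in>I. V i \<bullet> e \<noteq> 0 \<and> \<bar>V i \<bullet> e\<bar> \<noteq> 1)"
proof -
  interpret L: product_sigma_finite "\<lambda>_::nat. lborel :: (real ^ 'n) measure" ..
  have img: "f ` (UNIV - {k0}) = I"
  proof
    show "f ` (UNIV - {k0}) \<subseteq> I" using pinned_other by blast
    show "I \<subseteq> f ` (UNIV - {k0})" using index_pinned by blast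
  qed
  have inj: "inj_on f (UNIV - {k0})" using f by (auto simp: bij_betw_def inj_on_def)
  have "AE V in PiM (f ` (UNIV - {k0})) (\<lambda>_. lborel :: (real ^ 'n) measure). det (\<chi> i. if i \<in> UNIV - {k0} then V (f i) else axis i 1) \<noteq> 0"
  proof (rule AE_det_mixed_rows[where M = lborel and f = f and J = "UNIV - {k0}"])
    show "sigma_finite_measure (lborel :: (real ^ 'n) measure)" by (rule lborel.sigma_finite_measure_axioms)
    show "AE x in lborel. a \<bullet> x \<noteq> 0" if "a \<noteq> 0" for a :: "real ^ 'n"
      using that by (rule AE_lborel_hyperplane)
  qed (use inj in simp_all)
  moreover have "(\<chi> i. if i \<in> UNIV - {k0} then V (f i) else axis i 1) = pinned V" for V
  proof (rule vec_eq_iff[THEN iffD2], rule allI)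
    fix i
    show "(\<chi> i. if i \<in> UNIV - {k0} then V (f i) else axis i 1) $ i = pinned V $ i"
    proof (cases "i = k0")
      case True
      have "pinned V $ k0 = axis k0 1" by (rule trans[OF pinned_k0 e_def])
      then show ?thesis using True by simp
    qed (use pinned_other[of i V] in simp)
  qed
  ultimately have 1: "AE V in PiM I (\<lambda>_. lborel). det (pinned V) \<noteq> 0" by (simp only: img)
  have 2: "AE V in PiM I (\<lambda>_. lborel). V i \<bullet> e \<noteq> b" if i: "i \<in> I" for i b
  proof -
    have "AE V in PiM (insert i (I - {i})) (\<lambda>_. lborel). V i \<bullet> e \<noteq> b"
    proof (rule L.AE_PiM_insert)
      have "(\<lambda>V. V i) \<in> measurable (PiM (insert i (I - {i})) (\<lambda>_. lborel)) (lborel :: (real ^ 'n) measure)"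
        by (rule measurable_component_singleton) simp
      then show "Measurable.pred (PiM (insert i (I - {i})) (\<lambda>_. lborel :: (real ^ 'n) measure)) (\<lambda>V. V i \<bullet> e \<noteq> b)"
        by measurable
      have "AE x in lborel. e \<bullet> x \<noteq> b" using e_Basis by (intro AE_lborel_hyperplane) auto
      then show "AE X in PiM (I - {i}) (\<lambda>_. lborel). AE x in lborel. (X(i := x)) i \<bullet> e \<noteq> b"
        by (simp add: inner_commute)
    qed auto
    moreover have "insert i (I - {i}) = I" using i by blast
    ultimately show ?thesis by (simp only:)
  qed
  have "AE V in PiM I (\<lambda>_. lborel). \<forall>i\<in>I. V i \<bullet> e \<noteq> 0 \<and> V i \<bullet> e \<noteq> 1 \<and> V i \<bullet> e \<noteq> - 1"
    using 2 by (intro AE_finite_allI) (auto simp: AE_conj_iff)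
  then show ?thesis using 1 by eventually_elim (auto simp: abs_if split: if_splits)
qed

lemma convergent_pinned_integral:
  "convergent (\<lambda>m. real m ^ (d - 1) * (\<integral>X. integrand m X \<partial>PiM I (\<lambda>_. uniform_sphere)))"
proof -
  interpret L: product_sigma_finite "\<lambda>_::nat. lborel :: (real ^ 'n) measure" ..
  obtain c where c: "c > 0" "\<And>m V. 2 * d \<le> m \<Longrightarrow> det (pinned V) \<noteq> 0 \<Longrightarrow>
    \<bar>scaled m V\<bar> \<le> (\<Prod>i\<in>I. indicator {v. \<bar>v \<bullet> e\<bar> \<le> 1} (V i) * exp (- c * norm (perp e (V i)) ^ (d - 1)))"
    by (rule scaled_dominated) (rule that)
  define w where "w V = (\<Prod>i\<in>I. indicator {v. \<bar>v \<bullet> e\<bar> \<le> 1} (V i) * exp (- c * norm (perp e (V i)) ^ (d - 1)))" for V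
  have w: "integrable (PiM I (\<lambda>_. lborel)) w"
    unfolding w_def
    using integrable_slab_exp[OF e_Basis _ c(1)] d by (intro L.product_integrable_prod) auto
  \<comment> \<open>The majorant is valid from \<open>2 * d\<close> on; the shift makes it hold for
    every index.\<close>
  define s where "s m = scaled (m + 2 * d)" for m
  have sm: "s m \<in> borel_measurable (PiM I (\<lambda>_. lborel))" for m
    unfolding s_def measurable_cong_sets[OF sets_PiM_lborel refl] by (rule measurable_scaled)
  define g where "g V = lim (\<lambda>m. s m V)" for V
  have gm: "g \<in> borel_measurable (PiM I (\<lambda>_. lborel))"
    unfolding g_def[abs_def] using sm by (rule borel_measurable_lim_metric)
  have lim: "AE V in PiM I (\<lambda>_. lborel). (\<lambda>m. s m V) \<longlonglongrightarrow> g V"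
    using AE_good_directions
  proof eventually_elim
    case (elim V)
    then have "convergent (\<lambda>m. scaled m V)" by (intro scaled_convergent) auto
    then have "convergent (\<lambda>m. s m V)" unfolding s_def by (rule convergent_ignore_initial_segment[THEN iffD2])
    then show ?case unfolding g_def by (rule convergent_LIMSEQ_iff[THEN iffD1])
  qed
  have bound: "AE V in PiM I (\<lambda>_. lborel). norm (s m V) \<le> w V" for m
    using AE_good_directions
  proof eventually_elim
    case (elim V)
    then show ?case using c(2)[of "m + 2 * d" V] by (simp add: s_def w_def)
  qed
  have "(\<lambda>m. \<integral>V. s m V \<partial>PiM I (\<lambda>_. lborel)) \<longlonglongrightarrow> (\<integral>V. g V \<partial>PiM I (\<lambda>_. lborel))"
    by (rule integral_dominated_convergence[OF gm sm w lim bound])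
  then have "convergent (\<lambda>m. \<integral>V. scaled (m + 2 * d) V \<partial>PiM I (\<lambda>_. lborel))"
    unfolding s_def by (rule convergentI)
  then have "convergent (\<lambda>m. (1 / ball_vol TYPE(real ^ 'n)) ^ (d - 1) * (\<integral>V. scaled (m + 2 * d) V \<partial>PiM I (\<lambda>_. lborel)))"
    by (rule convergent_mult[OF convergent_const])
  also have "(\<lambda>m. (1 / ball_vol TYPE(real ^ 'n)) ^ (d - 1) * (\<integral>V. scaled (m + 2 * d) V \<partial>PiM I (\<lambda>_. lborel)))
    = (\<lambda>m. real (m + 2 * d) ^ (d - 1) * (\<integral>X. integrand (m + 2 * d) X \<partial>PiM I (\<lambda>_. uniform_sphere)))"
    using d(2) by (intro ext integral_integrand[symmetric]) simp
  finally show ?thesis by (rule convergent_ignore_initial_segment[THEN iffD1])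
qed

end

subsection \<open>The expected number of facets of the sample hull\<close>

text \<open>Uniqueness of the solution carries it along with the rotation. The two determinants
  vanish together, and then both sides are 0, so the identity holds for every sample and not only
  almost surely.\<close>

lemma unit_sol_orthogonal:
  assumes R: "orthogonal_transformation R" and B: "\<And>i. B $ i = R (A $ i)"
  shows "unit_sol B = R (unit_sol A)"
proof -
  have RR: "R u \<bullet> R v = u \<bullet> v" for u v using R by (simp add: orthogonal_transformation_def)
  have surj: "\<exists>v. u = R v" for u using orthogonal_transformation_surj[OF R] by (metis surjD)
  have lin: "linear R" by (rule orthogonal_transformation_linear[OF R])
  have R0: "R u = 0 \<longleftrightarrow> u = 0" for u using orthogonal_transformation_norm[OF R, of u] by (metis norm_eq_zero)
  have det: "det B \<noteq> 0 \<longleftrightarrow> det A \<noteq> 0"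
    unfolding det_nz_iff_ker B by (metis RR R0 surj)
  show ?thesis
  proof (cases "det A = 0")
    case True
    then have "unit_sol A = 0" "unit_sol B = 0" using det by (simp_all add: unit_sol_def vec_eq_iff)
    then show ?thesis using R0 by simp
  next
    case False
    have "\<forall>i. A $ i \<bullet> unit_sol A = 1" using unit_sol_iff[OF False] by blast
    then have "\<forall>i. B $ i \<bullet> R (unit_sol A) = 1" by (simp add: B RR)
    then show ?thesis using unit_sol_iff[of B] det False by metis
  qed
qed

context first_point_fixed
begin

lemma range_f: "range f = {..<d}" using f by (simp add: bij_betw_def)
lemma inj_f: "inj f" using f by (simp add: bij_betw_def)

text \<open>For \<open>m >= d\<close>, the conditional probability, given the first \<open>d\<close>
  points, that all others lie strictly on the origin's side of the hyperplane through them.\<close>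

definition sample_integrand :: "nat \<Rightarrow> (nat \<Rightarrow> real ^ 'n) \<Rightarrow> real" where
  "sample_integrand m X = (1 - cap (unit_sol (row_matrix f X))) ^ (m - d)"

lemma sample_integrand_bounds: "0 \<le> sample_integrand m X" "sample_integrand m X \<le> 1"
  using cap_bounds[of "unit_sol (row_matrix f X)"] by (auto simp: sample_integrand_def power_le_one)

lemma measurable_unit_sol_row:
  assumes "{..<d} \<subseteq> K"
  shows "(\<lambda>X. unit_sol (row_matrix f X)) \<in> borel_measurable (PiM K (\<lambda>_. uniform_sphere))"
  unfolding measurable_cong_sets[OF sets_PiM_uniform_sphere refl]
  using assms range_f by (intro borel_measurable_unit_sol borel_measurable_row_matrix) simp

lemma measurable_sample_integrand:
  "sample_integrand m \<in> borel_measurable (PiM {..<d} (\<lambda>_. uniform_sphere))"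
  unfolding sample_integrand_def[abs_def] using measurable_unit_sol_row[OF order_refl] by measurable

text \<open>By rotation invariance the first sample point may be fixed at \<open>e\<close>.\<close>

lemma integral_sample_integrand:
  "(\<integral>X. sample_integrand m X \<partial>PiM {..<d} (\<lambda>_. uniform_sphere)) = (\<integral>X. integrand m X \<partial>PiM I (\<lambda>_. uniform_sphere))"
proof -
  interpret U: product_sigma_finite "\<lambda>_::nat. uniform_sphere :: (real ^ 'n) measure" ..
  have ins: "{..<d} = insert 0 I" using d(2) by auto
  have meas: "(\<lambda>X. ennreal (sample_integrand m X)) \<in> borel_measurable (PiM (insert 0 I) (\<lambda>_. uniform_sphere))"
    using measurable_sample_integrand unfolding ins by measurable
  have rot: "(\<integral>\<^sup>+X. ennreal (sample_integrand m (X(0 := y))) \<partial>PiM I (\<lambda>_. uniform_sphere))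
      = (\<integral>\<^sup>+X. ennreal (integrand m X) \<partial>PiM I (\<lambda>_. uniform_sphere))" if y: "norm y = 1" for y
  proof -
    obtain R where R: "orthogonal_transformation R" "R e = y"
      using rotation_exists[of e y] d ne y by auto
    have lin: "linear R" by (rule orthogonal_transformation_linear[OF R(1)])
    have mR [measurable]: "R \<in> borel_measurable borel"
      using lin by (intro borel_measurable_continuous_onI linear_continuous_on linear_conv_bounded_linear[THEN iffD1])
    have mRu: "R \<in> measurable uniform_sphere uniform_sphere"
      using mR by (simp add: measurable_cong_sets[OF sets_uniform_sphere sets_uniform_sphere])
    have us: "distr uniform_sphere uniform_sphere R = uniform_sphere"
    proof -
      have "distr uniform_sphere uniform_sphere R = distr uniform_sphere borel R" by (rule distr_cong) simp_all
      then show ?thesis using distr_uniform_sphere_orthogonal[OF R(1)] by simp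
    qed
    have inv: "distr (PiM I (\<lambda>_. uniform_sphere)) (PiM I (\<lambda>_. uniform_sphere)) (compose I R) = PiM I (\<lambda>_. uniform_sphere)"
    proof -
      have "distr (PiM I (\<lambda>_. uniform_sphere)) (PiM I (\<lambda>_. uniform_sphere)) (compose I R) = PiM I (\<lambda>_. distr uniform_sphere uniform_sphere R)"
        using prob_space_uniform_sphere mRu by (intro distr_PiM_finite_prob_space') auto
      then show ?thesis by (simp only: us)
    qed
    have mc: "compose I R \<in> measurable (PiM I (\<lambda>_. uniform_sphere)) (PiM I (\<lambda>_. uniform_sphere))"
      unfolding compose_def
    proof (rule measurable_restrict)
      fix i assume "i \<in> I"
      then have "(\<lambda>X. X i) \<in> measurable (PiM I (\<lambda>_. uniform_sphere)) uniform_sphere" by (rule measurable_component_singleton)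
      from measurable_compose[OF this mRu]
      show "(\<lambda>X. R (X i)) \<in> measurable (PiM I (\<lambda>_. uniform_sphere)) uniform_sphere" .
    qed
    have mH: "(\<lambda>X. ennreal (sample_integrand m (X(0 := y)))) \<in> borel_measurable (PiM I (\<lambda>_. uniform_sphere))"
    proof -
      have "(\<lambda>X. X(0 := y)) \<in> measurable (PiM I (\<lambda>_. uniform_sphere)) (PiM (insert 0 I) (\<lambda>_. uniform_sphere))"
      proof (rule measurable_PiM_single')
        fix i assume "i \<in> insert 0 I"
        then show "(\<lambda>X. (X(0 := y)) i) \<in> measurable (PiM I (\<lambda>_. uniform_sphere)) uniform_sphere"
          by (cases "i = 0") (auto intro: measurable_component_singleton)
      qed (auto simp: space_PiM PiE_def extensional_def)
      from measurable_compose[OF this meas] show ?thesis .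
    qed
    have "(\<integral>\<^sup>+X. ennreal (sample_integrand m (X(0 := y))) \<partial>PiM I (\<lambda>_. uniform_sphere))
      = (\<integral>\<^sup>+X. ennreal (sample_integrand m ((compose I R X)(0 := y))) \<partial>PiM I (\<lambda>_. uniform_sphere))"
      by (subst inv[symmetric], rule nn_integral_distr[OF mc], simp only: inv mH)
    also have "\<dots> = (\<integral>\<^sup>+X. ennreal (integrand m X) \<partial>PiM I (\<lambda>_. uniform_sphere))"
    proof (intro nn_integral_cong arg_cong[where f = ennreal])
      fix X
      have "row_matrix f ((compose I R X)(0 := y)) $ i = R (pinned X $ i)" for i
      proof (cases "i = k0")
        case True
        then show ?thesis using pinned_k0[of X] R(2) by (simp add: row_matrix_def k0)
      next
        case False
        then have "f i \<in> I" "pinned X $ i = X (f i)" using pinned_other by auto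
        then show ?thesis by (auto simp: row_matrix_def compose_def)
      qed
      then have "unit_sol (row_matrix f ((compose I R X)(0 := y))) = R (unit_sol (pinned X))"
        by (rule unit_sol_orthogonal[OF R(1)])
      then show "sample_integrand m ((compose I R X)(0 := y)) = integrand m X"
        by (simp add: sample_integrand_def integrand_def cap_orthogonal[OF R(1)])
    qed
    finally show ?thesis .
  qed
  have "(\<integral>\<^sup>+X. ennreal (sample_integrand m X) \<partial>PiM {..<d} (\<lambda>_. uniform_sphere))
    = (\<integral>\<^sup>+y. (\<integral>\<^sup>+X. ennreal (sample_integrand m (X(0 := y))) \<partial>PiM I (\<lambda>_. uniform_sphere)) \<partial>uniform_sphere)"
    unfolding ins by (rule U.product_nn_integral_insert_rev[OF _ _ meas]) auto
  also have "\<dots> = (\<integral>\<^sup>+y. (\<integral>\<^sup>+X. ennreal (integrand m X) \<partial>PiM I (\<lambda>_. uniform_sphere)) \<partial>(uniform_sphere :: (real ^ 'n) measure))"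
    by (rule nn_integral_cong_AE) (use AE_uniform_sphere rot in \<open>auto elim: eventually_mono\<close>)
  also have "\<dots> = (\<integral>\<^sup>+X. ennreal (integrand m X) \<partial>PiM I (\<lambda>_. uniform_sphere))"
    using uniform_sphere.emeasure_space_1[where ?'a = "real ^ 'n"] by simp
  finally have "enn2real (\<integral>\<^sup>+X. ennreal (sample_integrand m X) \<partial>PiM {..<d} (\<lambda>_. uniform_sphere))
    = enn2real (\<integral>\<^sup>+X. ennreal (integrand m X) \<partial>PiM I (\<lambda>_. uniform_sphere))" by simp
  moreover have "(\<integral>X. sample_integrand m X \<partial>PiM {..<d} (\<lambda>_. uniform_sphere))
      = enn2real (\<integral>\<^sup>+X. ennreal (sample_integrand m X) \<partial>PiM {..<d} (\<lambda>_. uniform_sphere))"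
    by (rule integral_eq_nn_integral[OF measurable_sample_integrand]) (simp add: sample_integrand_bounds)
  moreover have "(\<integral>X. integrand m X \<partial>PiM I (\<lambda>_. uniform_sphere))
      = enn2real (\<integral>\<^sup>+X. ennreal (integrand m X) \<partial>PiM I (\<lambda>_. uniform_sphere))"
  proof (rule integral_eq_nn_integral)
    show "integrand m \<in> borel_measurable (PiM I (\<lambda>_. uniform_sphere))"
      unfolding measurable_cong_sets[OF sets_PiM_uniform_sphere refl] by (rule measurable_integrand)
  qed (simp add: integrand_bounds)
  ultimately show ?thesis by simp
qed

definition first_vertex :: "nat \<Rightarrow> (nat \<Rightarrow> real ^ 'n) \<Rightarrow> bool" where
  "first_vertex m X \<longleftrightarrow> (\<forall>j\<in>{d..<m}. X j \<bullet> unit_sol (row_matrix f X) < 1)"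

lemma pred_first_vertex:
  assumes m: "d \<le> m"
  shows "Measurable.pred (PiM {..<m} (\<lambda>_. uniform_sphere)) (first_vertex m)"
proof -
  have "Measurable.pred (PiM {..<m} (\<lambda>_. uniform_sphere)) (\<lambda>X. X j \<bullet> unit_sol (row_matrix f X) < 1)" if j: "j \<in> {d..<m}" for j
  proof -
    have "(\<lambda>X. X j) \<in> measurable (PiM {..<m} (\<lambda>_. uniform_sphere)) (uniform_sphere :: (real ^ 'n) measure)"
      using j by (intro measurable_component_singleton) auto
    then have "(\<lambda>X. X j) \<in> borel_measurable (PiM {..<m} (\<lambda>_. uniform_sphere :: (real ^ 'n) measure))"
      by (simp only: measurable_cong_sets[OF refl sets_uniform_sphere])
    moreover have "(\<lambda>X. unit_sol (row_matrix f X)) \<in> borel_measurable (PiM {..<m} (\<lambda>_. uniform_sphere))"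
      using m by (intro measurable_unit_sol_row) auto
    ultimately show ?thesis by measurable
  qed
  then show ?thesis unfolding first_vertex_def[abs_def] by (intro pred_intros_finite) auto
qed

text \<open>Fubini for the first \<open>d\<close> points and the rest: with the hyperplane fixed,
  the remaining \<open>m - d\<close> points fall below it independently, each with probability
  \<open>1 - cap\<close>.\<close>

lemma prob_first_vertex:
  assumes m: "d \<le> m"
  shows "measure (PiM {..<m} (\<lambda>_. uniform_sphere)) {X \<in> space (PiM {..<m} (\<lambda>_. uniform_sphere)). first_vertex m X}
    = (\<integral>X. sample_integrand m X \<partial>PiM {..<d} (\<lambda>_. uniform_sphere))"
proof -
  let ?us = "\<lambda>_::nat. uniform_sphere :: (real ^ 'n) measure"
  let ?J = "{d..<m}"
  interpret U: product_sigma_finite ?us ..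
  have un: "{..<m} = {..<d} \<union> ?J" using m by auto
  let ?E = "{X \<in> space (PiM {..<m} ?us). first_vertex m X}"
  have E [measurable]: "?E \<in> sets (PiM {..<m} ?us)" using pred_first_vertex[OF m] by measurable
  have "emeasure (PiM {..<m} ?us) ?E = (\<integral>\<^sup>+X. indicator ?E X \<partial>PiM ({..<d} \<union> ?J) ?us)"
    unfolding un[symmetric] by simp
  also have "\<dots> = (\<integral>\<^sup>+X. (\<integral>\<^sup>+Z. indicator ?E (merge {..<d} ?J (X, Z)) \<partial>PiM ?J ?us) \<partial>PiM {..<d} ?us)"
  proof (rule U.product_nn_integral_fold)
    show "indicator ?E \<in> borel_measurable (PiM ({..<d} \<union> ?J) ?us)"
      unfolding un[symmetric] by (rule borel_measurable_indicator[OF E])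
  qed auto
  also have "\<dots> = (\<integral>\<^sup>+X. ennreal (sample_integrand m X) \<partial>PiM {..<d} ?us)"
  proof (rule nn_integral_cong)
    fix X assume X: "X \<in> space (PiM {..<d} ?us)"
    let ?y = "unit_sol (row_matrix f X)"
    have "(\<integral>\<^sup>+Z. indicator ?E (merge {..<d} ?J (X, Z)) \<partial>PiM ?J ?us)
      = (\<integral>\<^sup>+Z. indicator (Pi\<^sub>E ?J (\<lambda>_. {x. x \<bullet> ?y < 1})) Z \<partial>PiM ?J ?us)"
    proof (rule nn_integral_cong)
      fix Z assume Z: "Z \<in> space (PiM ?J ?us)"
      let ?W = "merge {..<d} ?J (X, Z)"
      have "?W \<in> space (PiM {..<m} ?us)" using un by (auto simp: space_PiM PiE_def extensional_def merge_def)
      moreover have "row_matrix f ?W = row_matrix f X"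
        using range_f by (auto simp: row_matrix_def merge_def vec_eq_iff)
      moreover have "?W j = Z j" if "j \<in> ?J" for j using that by (simp add: merge_def)
      ultimately have "?W \<in> ?E \<longleftrightarrow> Z \<in> Pi\<^sub>E ?J (\<lambda>_. {x. x \<bullet> ?y < 1})"
        using Z by (auto simp: first_vertex_def space_PiM PiE_def)
      then show "(indicator ?E ?W :: ennreal) = indicator (Pi\<^sub>E ?J (\<lambda>_. {x. x \<bullet> ?y < 1})) Z"
        by (simp add: indicator_def)
    qed
    also have "\<dots> = emeasure (PiM ?J ?us) (Pi\<^sub>E ?J (\<lambda>_. {x. x \<bullet> ?y < 1}))"
      by (rule nn_integral_indicator) (intro sets_PiM_I_finite, auto)
    also have "\<dots> = (\<Prod>j\<in>?J. emeasure uniform_sphere {x. x \<bullet> ?y < 1})"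
      by (rule U.emeasure_PiM) auto
    also have "emeasure uniform_sphere {x. x \<bullet> ?y < 1} = ennreal (1 - cap ?y)"
    proof -
      have "{x. x \<bullet> ?y < 1} = space uniform_sphere - {x. 1 \<le> x \<bullet> ?y}" by auto
      then have "measure uniform_sphere {x. x \<bullet> ?y < 1} = 1 - cap ?y"
        unfolding cap_def by (simp only:) (rule uniform_sphere.prob_compl, simp)
      then show ?thesis by (simp add: uniform_sphere.emeasure_eq_measure)
    qed
    also have "(\<Prod>j\<in>?J. ennreal (1 - cap ?y)) = ennreal (sample_integrand m X)"
      using cap_bounds(2)[of ?y] by (simp add: sample_integrand_def ennreal_power)
    finally show "(\<integral>\<^sup>+Z. indicator ?E (merge {..<d} ?J (X, Z)) \<partial>PiM ?J ?us) = ennreal (sample_integrand m X)" .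
  qed
  finally have "emeasure (PiM {..<m} ?us) ?E = (\<integral>\<^sup>+X. ennreal (sample_integrand m X) \<partial>PiM {..<d} ?us)" .
  moreover have "(\<integral>X. sample_integrand m X \<partial>PiM {..<d} ?us) = enn2real (\<integral>\<^sup>+X. ennreal (sample_integrand m X) \<partial>PiM {..<d} ?us)"
    by (rule integral_eq_nn_integral[OF measurable_sample_integrand]) (simp add: sample_integrand_bounds)
  ultimately show ?thesis by (simp add: measure_def)
qed

end

section \<open>Counting vertices of the dual by index sets\<close>

definition supporting_index :: "nat \<Rightarrow> (nat \<Rightarrow> 'a::euclidean_space) \<Rightarrow> nat set \<Rightarrow> bool" where
  "supporting_index m X J \<longleftrightarrow> (\<exists>y. (\<forall>i\<in>J. X i \<bullet> y = 1) \<and> (\<forall>j\<in>{..<m} - J. X j \<bullet> y < 1))"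

lemma (in general_position) card_vertices:
  "card V = card {J. J \<subseteq> {..<m} \<and> card J = DIM('a) \<and> supporting_index m x J}"
proof -
  have "bij_betw act V {J. J \<subseteq> {..<m} \<and> card J = DIM('a) \<and> supporting_index m x J}"
    unfolding bij_betw_def
  proof (intro conjI inj_on_act set_eqI iffI)
    fix J assume "J \<in> act ` V"
    then obtain v where v: "v \<in> V" "J = act v" by blast
    have "x j \<bullet> v < 1" if "j \<in> {..<m} - act v" for j
      using that vertexD(2)[OF v(1), of j] by (auto simp: act_def)
    then have "supporting_index m x J" unfolding supporting_index_def v(2)
      by (intro exI[of _ v]) (auto simp: act_def)
    then show "J \<in> {J. J \<subseteq> {..<m} \<and> card J = DIM('a) \<and> supporting_index m x J}"
      using act_sub vertexD(1)[OF v(1)] v(2) by auto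
  next
    fix J assume "J \<in> {J. J \<subseteq> {..<m} \<and> card J = DIM('a) \<and> supporting_index m x J}"
    then obtain y where J: "J \<subseteq> {..<m}" "card J = DIM('a)"
      and y: "\<forall>i\<in>J. x i \<bullet> y = 1" "\<forall>j\<in>{..<m} - J. x j \<bullet> y < 1"
      by (auto simp: supporting_index_def)
    have a: "act y = J" using J y by (force simp: act_def)
    have "y \<in> K" unfolding in_K
    proof (intro allI impI)
      fix i assume "i < m"
      then show "x i \<bullet> y \<le> 1" using y by (cases "i \<in> J") (auto intro: less_imp_le)
    qed
    then show "J \<in> act ` V" using a J(2) by (auto simp: vertex_iff)
  qed
  then show ?thesis by (rule bij_betw_same_card)
qed

text \<open>A permutation of the sample that moves \<open>J\<close> to the first \<open>d\<close>
  places. As the points are independent and identically distributed, every \<open>J\<close> then has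
  the same probability as the first \<open>d\<close> indices.\<close>

lemma exists_enumeration:
  fixes J :: "nat set"
  assumes J: "J \<subseteq> {..<m}" "card J = d"
  obtains \<pi> where "inj_on \<pi> {..<m}" "\<pi> ` {..<d} = J" "\<pi> ` {d..<m} = {..<m} - J"
proof -
  have fJ: "finite J" using J finite_subset by auto
  have dm: "d \<le> m" using card_mono[OF _ J(1)] J(2) by simp
  obtain g where g: "bij_betw g {..<d} J" using finite_same_card_bij[of "{..<d}" J] fJ J by auto
  have "card ({..<m} - J) = card {d..<m}" using J fJ by (simp add: card_Diff_subset)
  then obtain h where h: "bij_betw h {d..<m} ({..<m} - J)" using finite_same_card_bij[of "{d..<m}" "{..<m} - J"] by auto
  define \<pi> where "\<pi> n = (if n < d then g n else h n)" for n
  have 1: "\<pi> ` {..<d} = J" using g by (auto simp: \<pi>_def bij_betw_def)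
  have 2: "\<pi> ` {d..<m} = {..<m} - J" using h by (force simp: \<pi>_def bij_betw_def)
  have un: "{..<m} = {..<d} \<union> {d..<m}" using dm by auto
  have "inj_on \<pi> {..<d}" using g by (auto simp: \<pi>_def bij_betw_def inj_on_def)
  moreover have "inj_on \<pi> {d..<m}" using h by (auto simp: \<pi>_def bij_betw_def inj_on_def)
  moreover have "\<pi> ` ({..<d} - {d..<m}) \<inter> \<pi> ` ({d..<m} - {..<d}) = {}" using 1 2 by blast
  ultimately have "inj_on \<pi> {..<m}" unfolding un inj_on_Un by blast
  then show ?thesis using that 1 2 by blast
qed

section \<open>Rarity of samples with an unbounded dual\<close>

lemma finite_sphere_net:
  obtains A :: "'a::euclidean_space set" where "finite A" "A \<subseteq> sphere 0 1"
    "\<And>u. norm u = 1 \<Longrightarrow> \<exists>a\<in>A. norm (u - a) < 1 / 2"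
proof -
  have cover: "sphere (0::'a) 1 \<subseteq> (\<Union>a\<in>sphere 0 1. ball a (1/2))" by force
  obtain A where A: "finite A" "A \<subseteq> sphere (0::'a) 1" "sphere 0 1 \<subseteq> (\<Union>a\<in>A. ball a (1/2))"
    by (rule compactE_image[OF compact_sphere open_ball cover]) (rule that)
  show ?thesis
  proof (rule that[OF A(1,2)])
    fix u :: 'a assume "norm u = 1"
    then have "u \<in> sphere 0 1" by simp
    then have "u \<in> (\<Union>a\<in>A. ball a (1/2))" using A(3) by blast
    then show "\<exists>a\<in>A. norm (u - a) < 1 / 2" by (auto simp: dist_norm norm_minus_commute)
  qed
qed

text \<open>For unit vectors \<open>a\<close> of a \<open>1/2\<close>-net: if every cap \<open>x \<bullet> a > 1/2\<close> contains a sample point, then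
  so does every open half-space through the origin, and the dual is bounded.\<close>

definition sparse :: "nat \<Rightarrow> 'a::euclidean_space set \<Rightarrow> (nat \<Rightarrow> 'a) \<Rightarrow> bool" where
  "sparse m A X \<longleftrightarrow> (\<exists>a\<in>A. \<forall>i<m. X i \<bullet> a \<le> 1 / 2)"

lemma bounded_dual_if_not_sparse:
  assumes gp: "general_position X m" and X: "\<And>i. i < m \<Longrightarrow> norm (X i) = 1"
    and A: "\<And>u. norm u = 1 \<Longrightarrow> \<exists>a\<in>A. norm (u - a) < 1 / 2" and ns: "\<not> sparse m A X"
  shows "bounded_dual X m"
proof -
  interpret general_position X m by fact
  show ?thesis
  proof
    fix u :: 'a assume u: "u \<noteq> 0"
    obtain a where a: "a \<in> A" "norm (u /\<^sub>R norm u - a) < 1 / 2" using A[of "u /\<^sub>R norm u"] u by auto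
    obtain i where i: "i < m" "X i \<bullet> a > 1 / 2" using ns a(1) by (auto simp: sparse_def not_le)
    have "\<bar>X i \<bullet> (u /\<^sub>R norm u - a)\<bar> \<le> norm (X i) * norm (u /\<^sub>R norm u - a)" by (rule Cauchy_Schwarz_ineq2)
    then have "X i \<bullet> (u /\<^sub>R norm u) > 0" using i a(2) X[OF i(1)] by (simp add: inner_diff_right)
    then have "X i \<bullet> u > 0" using u by (simp add: zero_less_mult_iff)
    then show "\<exists>i<m. X i \<bullet> u > 0" using i(1) by blast
  qed
qed

lemma prob_space_sphere_sample: "prob_space (sphere_sample m)"
  unfolding sphere_sample_def by (rule prob_space_PiM) (rule prob_space_uniform_sphere)

lemma sets_sphere_sample: "sets (sphere_sample m) = sets (PiM {..<m} (\<lambda>_. borel))"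
  unfolding sphere_sample_def by (rule sets_PiM_uniform_sphere)

lemma measurable_sphere_sample_component: "i < m \<Longrightarrow> (\<lambda>X. X i) \<in> borel_measurable (sphere_sample m)"
  unfolding measurable_cong_sets[OF sets_sphere_sample refl] by (rule measurable_component_singleton) simp

lemma pred_sparse:
  assumes "finite A"
  shows "Measurable.pred (sphere_sample m) (sparse m A)"
proof -
  have "Measurable.pred (sphere_sample m) (\<lambda>X. X i \<bullet> a \<le> 1 / 2)" if "i \<in> {..<m}" for i and a :: 'a
  proof -
    have [measurable]: "(\<lambda>X. X i) \<in> borel_measurable (sphere_sample m)"
      by (rule measurable_sphere_sample_component) (use that in simp)
    show ?thesis by measurable
  qed
  then have "Measurable.pred (sphere_sample m) (\<lambda>X. \<exists>a\<in>A. \<forall>i\<in>{..<m}. X i \<bullet> a \<le> 1 / 2)"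
    using assms by (intro pred_intros_finite) auto
  then show ?thesis by (simp add: sparse_def[abs_def] lessThan_iff Ball_def)
qed

text \<open>A union bound over the net: by rotation invariance every cap around a net point has the
  same positive measure, and \<open>m\<close> independent points miss it with geometrically small
  probability.\<close>

lemma prob_sparse_le:
  fixes A :: "(real ^ 'n::finite) set"
  assumes d: "2 \<le> CARD('n)" and A: "finite A" "A \<subseteq> sphere 0 1"
  obtains \<theta> where "0 \<le> \<theta>" "\<theta> < 1"
    "\<And>m. measure (sphere_sample m) {X \<in> space (sphere_sample m). sparse m A X} \<le> real (card A) * \<theta> ^ m"
proof -
  obtain e :: "real ^ 'n" where e: "norm e = 1" using vector_choose_size[of 1] by auto
  \<comment> \<open>The cap is \<open>x \<bullet> e >= 2 / 3\<close>. The factor lies above 1, so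
    the cap has positive measure, and below 2, so the cap avoids the set
    \<open>x \<bullet> e <= 1 / 2\<close>.\<close>
  define p where "p = cap ((3 / 2) *\<^sub>R e)"
  obtain k where k: "k > 0"
    "\<And>y :: real ^ 'n. 1 < norm y \<Longrightarrow> k * sqrt ((norm y)\<^sup>2 - 1) ^ (CARD('n) - 1) * (1 / norm y) ^ CARD('n) \<le> cap y"
    using cap_asymptotics[OF d] by metis
  have "0 < k * sqrt ((3 / 2)\<^sup>2 - 1) ^ (CARD('n) - 1) * (1 / (3 / 2)) ^ CARD('n)"
    using k(1) by (simp add: power2_eq_square)
  also have "\<dots> \<le> p" using k(2)[of "(3 / 2) *\<^sub>R e"] e by (simp add: p_def)
  finally have p0: "p > 0" .
  have p1: "p \<le> 1" by (simp add: p_def cap_bounds)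
  have one: "measure uniform_sphere {x. x \<bullet> a \<le> 1 / 2} \<le> 1 - p" if a: "a \<in> A" for a
  proof -
    have "norm a = 1" using a A(2) by auto
    then obtain R where R: "orthogonal_transformation R" "R e = a" using rotation_exists[OF d, of e a] e by auto
    have "R ((3 / 2) *\<^sub>R e) = (3 / 2) *\<^sub>R a" using R by (simp add: linear_scale orthogonal_transformation_linear)
    then have pa: "p = cap ((3 / 2) *\<^sub>R a)" unfolding p_def using cap_orthogonal[OF R(1)] by metis
    have "{x. x \<bullet> a \<le> 1 / 2} \<subseteq> space uniform_sphere - {x. 1 \<le> x \<bullet> ((3 / 2) *\<^sub>R a)}" by auto
    then have "measure uniform_sphere {x. x \<bullet> a \<le> 1 / 2} \<le> measure uniform_sphere (space uniform_sphere - {x. 1 \<le> x \<bullet> ((3 / 2) *\<^sub>R a)})"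
      by (intro uniform_sphere.finite_measure_mono) auto
    also have "\<dots> = 1 - p" unfolding pa cap_def by (rule uniform_sphere.prob_compl) simp
    finally show ?thesis .
  qed
  have "measure (sphere_sample m) {X \<in> space (sphere_sample m). sparse m A X} \<le> real (card A) * (1 - p) ^ m" for m
  proof -
    interpret S: prob_space "sphere_sample m :: (nat \<Rightarrow> real ^ 'n) measure" by (rule prob_space_sphere_sample)
    interpret U: product_sigma_finite "\<lambda>_::nat. uniform_sphere :: (real ^ 'n) measure" ..
    have "{X \<in> space (sphere_sample m). sparse m A X} = (\<Union>a\<in>A. Pi\<^sub>E {..<m} (\<lambda>_. {x. x \<bullet> a \<le> 1 / 2}))"
      by (auto simp: sparse_def sphere_sample_def space_PiM PiE_def Pi_def)
    moreover have "measure (sphere_sample m) (\<Union>a\<in>A. Pi\<^sub>E {..<m} (\<lambda>_. {x. x \<bullet> a \<le> 1 / 2}))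
        \<le> (\<Sum>a\<in>A. measure (sphere_sample m) (Pi\<^sub>E {..<m} (\<lambda>_. {x. x \<bullet> a \<le> 1 / 2})))"
      unfolding sphere_sample_def using A(1)
      by (intro measure_UNION_le sets_PiM_I_finite) auto
    moreover have "measure (sphere_sample m) (Pi\<^sub>E {..<m} (\<lambda>_. {x. x \<bullet> a \<le> 1 / 2})) \<le> (1 - p) ^ m" if a: "a \<in> A" for a
    proof -
      have "emeasure (sphere_sample m) (Pi\<^sub>E {..<m} (\<lambda>_. {x. x \<bullet> a \<le> 1 / 2})) = (\<Prod>i\<in>{..<m}. emeasure uniform_sphere {x. x \<bullet> a \<le> 1 / 2})"
        unfolding sphere_sample_def by (rule U.emeasure_PiM) auto
      also have "\<dots> = ennreal (measure uniform_sphere {x. x \<bullet> a \<le> 1 / 2} ^ m)"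
        by (simp add: uniform_sphere.emeasure_eq_measure ennreal_power)
      finally have "measure (sphere_sample m) (Pi\<^sub>E {..<m} (\<lambda>_. {x. x \<bullet> a \<le> 1 / 2})) = measure uniform_sphere {x. x \<bullet> a \<le> 1 / 2} ^ m"
        by (simp add: measure_def)
      also have "\<dots> \<le> (1 - p) ^ m" using one[OF a] by (intro power_mono) auto
      finally show ?thesis .
    qed
    ultimately have "measure (sphere_sample m) {X \<in> space (sphere_sample m). sparse m A X} \<le> (\<Sum>a\<in>A. (1 - p) ^ m)"
      by (simp only:) (meson order_trans sum_mono)
    then show ?thesis by simp
  qed
  then show ?thesis using that[of "1 - p"] p0 p1 by simp
qed

lemma num_facets_sample_hull_le: "real (num_facets (sample_hull m X)) \<le> (real m + 1) ^ DIM('a)"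
  for X :: "nat \<Rightarrow> 'a::euclidean_space"
proof -
  have "num_facets (sample_hull m X) \<le> (card (X ` {..<m}) + 1) ^ DIM('a)"
    unfolding sample_hull_def by (rule num_facets_convex_hull_le) simp
  also have "\<dots> \<le> (m + 1) ^ DIM('a)"
    using card_image_le[of "{..<m}" X] by (intro power_mono) auto
  finally have "real (num_facets (sample_hull m X)) \<le> real ((m + 1) ^ DIM('a))" by (rule of_nat_mono)
  then show ?thesis by (simp add: add.commute)
qed

lemma integrable_num_facets:
  "integrable (sphere_sample m :: (nat \<Rightarrow> 'a::euclidean_space) measure) (\<lambda>X. real (num_facets (sample_hull m X)))"
proof -
  interpret S: prob_space "sphere_sample m :: (nat \<Rightarrow> 'a) measure" by (rule prob_space_sphere_sample)
  show ?thesis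
  proof (rule S.integrable_const_bound[where B = "(real m + 1) ^ DIM('a)"])
    show "(\<lambda>X. real (num_facets (sample_hull m X))) \<in> borel_measurable (sphere_sample m :: (nat \<Rightarrow> 'a) measure)"
      unfolding measurable_cong_sets[OF sets_sphere_sample refl] by (rule borel_measurable_num_facets)
  qed (simp add: num_facets_sample_hull_le)
qed

lemma AE_sphere_sample_norm:
  "AE X in (sphere_sample m :: (nat \<Rightarrow> 'a::euclidean_space) measure). \<forall>i<m. norm (X i) = 1"
proof -
  have "AE X in (sphere_sample m :: (nat \<Rightarrow> 'a) measure). \<forall>i\<in>{..<m}. X i \<in> sphere 0 1"
  proof (rule AE_finite_allI)
    fix i assume "i \<in> {..<m}"
    then show "AE X in (sphere_sample m :: (nat \<Rightarrow> 'a) measure). X i \<in> sphere 0 1"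
      unfolding sphere_sample_def
      by (intro AE_PiM_component prob_space_uniform_sphere AE_uniform_sphere)
  qed simp
  then show ?thesis by eventually_elim auto
qed

section \<open>Existence of the limit of the expected number of facets per point\<close>

lemma binomial_ratio_convergent: "convergent (\<lambda>m. real (m choose d) / real m ^ d)"
proof -
  have lim: "(\<lambda>m. \<Prod>i = 0..<d. (1 - real i / real m) / real (d - i)) \<longlonglongrightarrow> (\<Prod>i = 0..<d. (1 - 0) / real (d - i))"
    by (intro tendsto_prod tendsto_divide tendsto_diff tendsto_const lim_const_over_n) simp
  have ev: "eventually (\<lambda>m. (\<Prod>i = 0..<d. (1 - real i / real m) / real (d - i)) = real (m choose d) / real m ^ d) sequentially"
  proof (intro eventually_sequentiallyI[of "Suc d"])
    fix m assume m: "Suc d \<le> m"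
    then have "real (m choose d) = (\<Prod>i = 0..<d. real (m - i) / real (d - i))"
      using binomial_altdef_of_nat[of d m, where 'a = real] by simp
    then have "real (m choose d) / real m ^ d = (\<Prod>i = 0..<d. real (m - i) / real (d - i)) / (\<Prod>i = 0..<d. real m)"
      by simp
    also have "\<dots> = (\<Prod>i = 0..<d. real (m - i) / real (d - i) / real m)"
      by (rule prod_dividef[symmetric])
    also have "\<dots> = (\<Prod>i = 0..<d. (1 - real i / real m) / real (d - i))"
      using m by (intro prod.cong refl) (simp add: of_nat_diff field_simps)
    finally show "(\<Prod>i = 0..<d. (1 - real i / real m) / real (d - i)) = real (m choose d) / real m ^ d" by simp
  qed
  show ?thesis using tendsto_cong[OF ev, THEN iffD1, OF lim] by (rule convergentI)
qed

lemma poly_geometric_tendsto_0: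
  fixes \<theta> :: real
  assumes \<theta>: "0 \<le> \<theta>" "\<theta> < 1"
  shows "(\<lambda>m. (real m + 1) ^ k * \<theta> ^ m) \<longlonglongrightarrow> 0"
proof -
  obtain C where C: "\<And>n::nat. (real n + 1) ^ Suc k * \<theta> ^ n \<le> C" using poly_geometric_bounded[OF \<theta>] by metis
  have "(\<lambda>m. C * (1 / real (Suc m))) \<longlonglongrightarrow> C * 0"
    by (intro tendsto_mult tendsto_const LIMSEQ_Suc[OF lim_1_over_n])
  then have lim: "(\<lambda>m. C / (real m + 1)) \<longlonglongrightarrow> 0" by (simp add: add.commute)
  show ?thesis
  proof (rule tendsto_sandwich[OF _ _ tendsto_const lim])
    show "eventually (\<lambda>m. 0 \<le> (real m + 1) ^ k * \<theta> ^ m) sequentially" using \<theta> by simp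
    show "eventually (\<lambda>m. (real m + 1) ^ k * \<theta> ^ m \<le> C / (real m + 1)) sequentially"
      using C by (intro always_eventually allI) (simp add: field_simps)
  qed
qed

context first_point_fixed
begin

definition index_enum :: "nat \<Rightarrow> nat set \<Rightarrow> nat \<Rightarrow> nat" where
  "index_enum m J = (SOME \<pi>. inj_on \<pi> {..<m} \<and> \<pi> ` {..<d} = J \<and> \<pi> ` {d..<m} = {..<m} - J)"

lemma index_enum:
  assumes "J \<subseteq> {..<m}" "card J = d"
  shows "inj_on (index_enum m J) {..<m}" "index_enum m J ` {..<d} = J" "index_enum m J ` {d..<m} = {..<m} - J"
proof -
  have "\<exists>\<pi>. inj_on \<pi> {..<m} \<and> \<pi> ` {..<d} = J \<and> \<pi> ` {d..<m} = {..<m} - J"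
    using exists_enumeration[OF assms] by metis
  then have "inj_on (index_enum m J) {..<m} \<and> index_enum m J ` {..<d} = J \<and> index_enum m J ` {d..<m} = {..<m} - J"
    unfolding index_enum_def by (rule someI_ex)
  then show "inj_on (index_enum m J) {..<m}" "index_enum m J ` {..<d} = J" "index_enum m J ` {d..<m} = {..<m} - J"
    by auto
qed

definition reindexed :: "nat \<Rightarrow> nat set \<Rightarrow> (nat \<Rightarrow> real ^ 'n) \<Rightarrow> nat \<Rightarrow> real ^ 'n" where
  "reindexed m J X = (\<lambda>n\<in>{..<m}. X (index_enum m J n))"

definition index_sets :: "nat \<Rightarrow> nat set set" where
  "index_sets m = {J. J \<subseteq> {..<m} \<and> card J = d}"

lemma index_sets: "finite (index_sets m)" "card (index_sets m) = m choose d"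
  unfolding index_sets_def by (auto simp: n_subsets intro: finite_subset[of _ "Pow {..<m}"])

text \<open>A measurable substitute for the number of vertices of the dual, with which it agrees
  almost surely for \<open>m >= d\<close>. All summands have the same expectation.\<close>

definition vertex_count :: "nat \<Rightarrow> (nat \<Rightarrow> real ^ 'n) \<Rightarrow> real" where
  "vertex_count m X = (\<Sum>J\<in>index_sets m.
     indicator {X \<in> space (sphere_sample m). first_vertex m X} (reindexed m J X))"

lemma distr_reindexed:
  assumes J: "J \<in> index_sets m"
  shows "distr (sphere_sample m) (sphere_sample m) (reindexed m J) = sphere_sample m"
    and "reindexed m J \<in> measurable (sphere_sample m) (sphere_sample m)"
proof -
  have e: "inj_on (index_enum m J) {..<m}" "index_enum m J \<in> {..<m} \<rightarrow> {..<m}"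
    using index_enum[of J m] J d(2) by (auto simp: index_sets_def) (metis Diff_iff Un_iff atLeastLessThan_iff image_eqI lessThan_iff linorder_not_le subsetD)
  show "distr (sphere_sample m) (sphere_sample m) (reindexed m J) = sphere_sample m"
    unfolding sphere_sample_def reindexed_def[abs_def]
    using distr_PiM_reindex[of "{..<m}" "\<lambda>_. uniform_sphere" "index_enum m J" "{..<m}"] e prob_space_uniform_sphere by simp
  show "reindexed m J \<in> measurable (sphere_sample m) (sphere_sample m)"
    unfolding sphere_sample_def reindexed_def[abs_def]
    using e(2) by (intro measurable_restrict measurable_component_singleton) auto
qed

lemma integral_vertex_count:
  assumes m: "d \<le> m"
  shows "integrable (sphere_sample m) (vertex_count m)"
    and "(\<integral>X. vertex_count m X \<partial>sphere_sample m) = real (m choose d) * (\<integral>X. integrand m X \<partial>PiM I (\<lambda>_. uniform_sphere))"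
proof -
  interpret S: prob_space "sphere_sample m :: (nat \<Rightarrow> real ^ 'n) measure" by (rule prob_space_sphere_sample)
  let ?E = "{X \<in> space (sphere_sample m). first_vertex m X}"
  have E [measurable]: "?E \<in> sets (sphere_sample m)" using pred_first_vertex[OF m] unfolding sphere_sample_def by measurable
  have mi: "(\<lambda>X. indicator ?E (reindexed m J X) :: real) \<in> borel_measurable (sphere_sample m)" if "J \<in> index_sets m" for J
    by (rule measurable_compose[OF distr_reindexed(2)[OF that] borel_measurable_indicator[OF E]])
  have int: "integrable (sphere_sample m) (\<lambda>X. indicator ?E (reindexed m J X) :: real)" if "J \<in> index_sets m" for J
    by (rule S.integrable_const_bound[where B = 1]) (use mi[OF that] in auto)
  show "integrable (sphere_sample m) (vertex_count m)"
    unfolding vertex_count_def[abs_def] using int by (rule Bochner_Integration.integrable_sum)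
  have one: "(\<integral>X. indicator ?E (reindexed m J X) \<partial>sphere_sample m) = (\<integral>X. integrand m X \<partial>PiM I (\<lambda>_. uniform_sphere))"
    if J: "J \<in> index_sets m" for J
  proof -
    have "(\<integral>X. indicator ?E (reindexed m J X) \<partial>sphere_sample m) = (\<integral>X. indicator ?E X \<partial>distr (sphere_sample m) (sphere_sample m) (reindexed m J) :: real)"
      by (rule integral_distr[OF distr_reindexed(2)[OF J] borel_measurable_indicator[OF E], symmetric])
    also have "\<dots> = measure (sphere_sample m) ?E"
      unfolding distr_reindexed(1)[OF J] by simp
    also have "\<dots> = (\<integral>X. integrand m X \<partial>PiM I (\<lambda>_. uniform_sphere))"
      unfolding sphere_sample_def prob_first_vertex[OF m] by (rule integral_sample_integrand)
    finally show ?thesis .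
  qed
  have "(\<integral>X. vertex_count m X \<partial>sphere_sample m) = (\<Sum>J\<in>index_sets m. \<integral>X. indicator ?E (reindexed m J X) \<partial>sphere_sample m)"
    unfolding vertex_count_def using int by (rule Bochner_Integration.integral_sum)
  also have "\<dots> = real (m choose d) * (\<integral>X. integrand m X \<partial>PiM I (\<lambda>_. uniform_sphere))"
    using one by (simp add: index_sets(2))
  finally show "(\<integral>X. vertex_count m X \<partial>sphere_sample m) = real (m choose d) * (\<integral>X. integrand m X \<partial>PiM I (\<lambda>_. uniform_sphere))" .
qed

text \<open>Almost surely all \<open>d\<close>-subsets of the sample are nonsingular, so the
  existential quantifier over \<open>y\<close> in \<open>supporting_index\<close> has
  \<open>unit_sol\<close> as its only candidate.\<close>

lemma AE_card_vertices:
  assumes m: "d \<le> m"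
  shows "AE X in sphere_sample m. real (card (vertices (general_position.K X m))) = vertex_count m X"
proof -
  have "AE X in (sphere_sample m :: (nat \<Rightarrow> real ^ 'n) measure). \<forall>J\<in>index_sets m. det (row_matrix f (reindexed m J X)) \<noteq> 0"
  proof (rule AE_finite_allI[OF index_sets(1)])
    fix J assume "J \<in> index_sets m"
    then have J: "J \<subseteq> {..<m}" "card J = d" by (auto simp: index_sets_def)
    note e = index_enum[OF J]
    have "inj (index_enum m J \<circ> f)"
    proof (rule comp_inj_on[OF inj_f])
      show "inj_on (index_enum m J) (range f)" unfolding range_f using e(1) m by (auto intro: inj_on_subset)
    qed
    moreover have "range (index_enum m J \<circ> f) \<subseteq> {..<m}"
      using J(1) by (simp only: image_comp[symmetric] range_f e(2))
    ultimately have "AE X in PiM {..<m} (\<lambda>_. uniform_sphere). det (row_matrix (index_enum m J \<circ> f) X) \<noteq> 0"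
      by (rule AE_det_row_matrix)
    moreover have "row_matrix (index_enum m J \<circ> f) X = row_matrix f (reindexed m J X)" for X :: "nat \<Rightarrow> real ^ 'n"
    proof -
      have "f i < m" for i using range_f m by (metis UNIV_I image_eqI lessThan_iff less_le_trans)
      then show ?thesis by (simp add: row_matrix_def reindexed_def)
    qed
    ultimately show "AE X in sphere_sample m. det (row_matrix f (reindexed m J X)) \<noteq> 0"
      unfolding sphere_sample_def by (simp only:)
  qed
  moreover have "AE X in (sphere_sample m :: (nat \<Rightarrow> real ^ 'n) measure). general_position X m"
    by (rule AE_general_position) (use d in simp)
  moreover have "AE X in (sphere_sample m :: (nat \<Rightarrow> real ^ 'n) measure). X \<in> space (sphere_sample m)" by simp
  ultimately show ?thesis
  proof eventually_elim
    case (elim X)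
    interpret general_position X m by (rule elim(2))
    have iff: "supporting_index m X J \<longleftrightarrow> first_vertex m (reindexed m J X)" if J': "J \<in> index_sets m" for J
    proof -
      have J: "J \<subseteq> {..<m}" "card J = d" using J' by (auto simp: index_sets_def)
      note e = index_enum[OF J]
      let ?Y = "reindexed m J X"
      have Y: "?Y n = X (index_enum m J n)" if "n < m" for n using that by (simp add: reindexed_def)
      have "(\<forall>i\<in>J. X i \<bullet> y = 1) \<longleftrightarrow> (\<forall>i. row_matrix f ?Y $ i \<bullet> y = 1)" for y
      proof -
        have "(\<forall>i\<in>J. X i \<bullet> y = 1) \<longleftrightarrow> (\<forall>i\<in>index_enum m J ` {..<d}. X i \<bullet> y = 1)"
          by (simp only: e(2))
        also have "\<dots> \<longleftrightarrow> (\<forall>n\<in>{..<d}. ?Y n \<bullet> y = 1)" using Y m by auto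
        also have "\<dots> \<longleftrightarrow> (\<forall>n\<in>range f. ?Y n \<bullet> y = 1)" by (simp only: range_f)
        also have "\<dots> \<longleftrightarrow> (\<forall>i. row_matrix f ?Y $ i \<bullet> y = 1)" by (simp add: row_matrix_def)
        finally show ?thesis .
      qed
      then have 1: "(\<forall>i\<in>J. X i \<bullet> y = 1) \<longleftrightarrow> y = unit_sol (row_matrix f ?Y)" for y
        using unit_sol_iff elim(1) J' by blast
      have 2: "(\<forall>j\<in>{..<m} - J. X j \<bullet> y < 1) \<longleftrightarrow> (\<forall>n\<in>{d..<m}. ?Y n \<bullet> y < 1)" for y
      proof -
        have "(\<forall>j\<in>{..<m} - J. X j \<bullet> y < 1) \<longleftrightarrow> (\<forall>j\<in>index_enum m J ` {d..<m}. X j \<bullet> y < 1)"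
          by (simp only: e(3))
        also have "\<dots> \<longleftrightarrow> (\<forall>n\<in>{d..<m}. ?Y n \<bullet> y < 1)" using Y by auto
        finally show ?thesis .
      qed
      show ?thesis unfolding supporting_index_def first_vertex_def 1 2 by blast
    qed
    have "card (vertices K) = card {J \<in> index_sets m. supporting_index m X J}"
      unfolding card_vertices index_sets_def using d(1) by (auto intro: arg_cong[where f = card])
    then have "real (card (vertices K)) = (\<Sum>J\<in>index_sets m. if supporting_index m X J then 1 else 0)"
      using index_sets(1)[of m] by (simp add: sum.If_cases Int_def)
    also have "\<dots> = vertex_count m X"
      unfolding vertex_count_def
    proof (rule sum.cong[OF refl])
      fix J assume J: "J \<in> index_sets m"
      have "reindexed m J X \<in> space (sphere_sample m)" using measurable_space[OF distr_reindexed(2)[OF J] elim(3)] .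
      then show "(if supporting_index m X J then 1 else 0) = (indicator {X \<in> space (sphere_sample m). first_vertex m X} (reindexed m J X) :: real)"
        using iff[OF J] by simp
    qed
    finally show ?case .
  qed
qed

text \<open>Off the sparse event the facet number equals \<open>vertex_count\<close>, and on it both
  are at most \<open>(m + 1) ^ d\<close>. Hence the two expectations differ by a term that vanishes
  in the limit, and the expectation of \<open>vertex_count\<close> is explicit.\<close>

lemma convergent_expected_facets:
  "convergent (\<lambda>m. expected_facets_P1 TYPE(real ^ 'n) m / real m)"
proof -
  have d': "2 \<le> CARD('n)" using d by simp
  obtain A :: "(real ^ 'n) set" where A: "finite A" "A \<subseteq> sphere 0 1" "\<And>u. norm u = 1 \<Longrightarrow> \<exists>a\<in>A. norm (u - a) < 1 / 2"
    by (rule finite_sphere_net) (rule that)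
  obtain \<theta> where \<theta>: "0 \<le> \<theta>" "\<theta> < 1"
    "\<And>m. measure (sphere_sample m) {X \<in> space (sphere_sample m). sparse m A X} \<le> real (card A) * \<theta> ^ m"
    by (rule prob_sparse_le[OF d' A(1,2)]) (rule that)
  define Ev where "Ev m = real (m choose d) * (\<integral>X. integrand m X \<partial>PiM I (\<lambda>_. uniform_sphere))" for m
  have err: "\<bar>expected_facets_P1 TYPE(real ^ 'n) m - Ev m\<bar> \<le> (real m + 1) ^ d * (real (card A) * \<theta> ^ m)" if m: "d \<le> m" for m
  proof -
    interpret S: prob_space "sphere_sample m :: (nat \<Rightarrow> real ^ 'n) measure" by (rule prob_space_sphere_sample)
    let ?B = "{X \<in> space (sphere_sample m). sparse m A X}"
    have B [measurable]: "?B \<in> sets (sphere_sample m)" using pred_sparse[OF A(1)] by measurable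
    have "AE X in sphere_sample m. \<bar>real (num_facets (sample_hull m X)) - vertex_count m X\<bar> \<le> (real m + 1) ^ d * indicator ?B X"
      using AE_card_vertices[OF m] AE_general_position[OF d', of m] AE_sphere_sample_norm AE_space
    proof eventually_elim
      case (elim X)
      interpret general_position X m by (rule elim(2))
      show ?case
      proof (cases "sparse m A X")
        case False
        interpret bounded_dual X m
          by (rule bounded_dual_if_not_sparse[OF elim(2) _ A(3) False]) (use elim(3) in auto)
        have "real (num_facets (sample_hull m X)) = vertex_count m X"
          using num_facets_sample_hull elim(1) by simp
        then show ?thesis by simp
      next
        case True
        have "real (card (vertices K)) \<le> real ((m + 1) ^ DIM(real ^ 'n))" using card_V_le by (rule of_nat_mono)
        then have "vertex_count m X \<le> (real m + 1) ^ d" using elim(1) d(1) by (simp add: add.commute)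
        moreover have "0 \<le> vertex_count m X" by (simp add: vertex_count_def sum_nonneg)
        moreover have "real (num_facets (sample_hull m X)) \<le> (real m + 1) ^ d"
          using num_facets_sample_hull_le[of m X] d(1) by simp
        ultimately show ?thesis using True elim(4) by (simp add: abs_le_iff)
      qed
    qed
    moreover have int: "integrable (sphere_sample m) (\<lambda>X. real (num_facets (sample_hull m X)) - vertex_count m X)"
      by (intro Bochner_Integration.integrable_diff integrable_num_facets integral_vertex_count(1)[OF m])
    moreover have "integrable (sphere_sample m) (\<lambda>X. (real m + 1) ^ d * indicator ?B X)"
      by (intro integrable_mult_right integrable_real_indicator B) (simp add: S.emeasure_eq_measure)
    ultimately have "\<bar>\<integral>X. real (num_facets (sample_hull m X)) - vertex_count m X \<partial>sphere_sample m\<bar>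
      \<le> (\<integral>X. (real m + 1) ^ d * indicator ?B X \<partial>sphere_sample m)"
      by (intro order_trans[OF integral_abs_bound] integral_mono_AE integrable_abs) auto
    also have "\<dots> = (real m + 1) ^ d * measure (sphere_sample m) ?B" by simp
    also have "\<dots> \<le> (real m + 1) ^ d * (real (card A) * \<theta> ^ m)" by (intro mult_left_mono \<theta>(3)) simp
    finally show ?thesis
      unfolding expected_facets_P1_def Ev_def integral_vertex_count(2)[OF m, symmetric]
      by (subst (asm) Bochner_Integration.integral_diff[OF integrable_num_facets integral_vertex_count(1)[OF m]])
  qed
  have "(\<lambda>m. real (card A) * ((real m + 1) ^ d * \<theta> ^ m) * (1 / real m)) \<longlonglongrightarrow> real (card A) * 0 * 0"
    by (intro tendsto_mult tendsto_const poly_geometric_tendsto_0 \<theta> lim_1_over_n)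
  then have e0: "(\<lambda>m. real (card A) * ((real m + 1) ^ d * \<theta> ^ m) * (1 / real m)) \<longlonglongrightarrow> 0" by simp
  have "(\<lambda>m. (expected_facets_P1 TYPE(real ^ 'n) m - Ev m) / real m) \<longlonglongrightarrow> 0"
  proof (rule Lim_null_comparison[OF _ e0])
    show "eventually (\<lambda>m. norm ((expected_facets_P1 TYPE(real ^ 'n) m - Ev m) / real m) \<le> real (card A) * ((real m + 1) ^ d * \<theta> ^ m) * (1 / real m)) sequentially"
    proof (intro eventually_sequentiallyI[of d])
      fix m assume "d \<le> m"
      from divide_right_mono[OF err[OF this], of "real m"]
      show "norm ((expected_facets_P1 TYPE(real ^ 'n) m - Ev m) / real m) \<le> real (card A) * ((real m + 1) ^ d * \<theta> ^ m) * (1 / real m)"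
        by (simp add: mult_ac)
    qed
  qed
  then have c1: "convergent (\<lambda>m. (expected_facets_P1 TYPE(real ^ 'n) m - Ev m) / real m)" by (rule convergentI)
  \<comment> \<open>The power \<open>m ^ d\<close> is split as \<open>m ^ (d - 1)\<close>, which
    compensates the decay of the pinned integral, and one \<open>m\<close> for the
    normalisation.\<close>
  have "convergent (\<lambda>m. (real (m choose d) / real m ^ d) * (real m ^ (d - 1) * (\<integral>X. integrand m X \<partial>PiM I (\<lambda>_. uniform_sphere))))"
    by (intro convergent_mult binomial_ratio_convergent convergent_pinned_integral)
  also have "(\<lambda>m. (real (m choose d) / real m ^ d) * (real m ^ (d - 1) * (\<integral>X. integrand m X \<partial>PiM I (\<lambda>_. uniform_sphere)))) = (\<lambda>m. Ev m / real m)"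
  proof
    fix m
    have "real m ^ d = real m ^ (d - 1) * real m" using d(2) by (metis One_nat_def Suc_leD Suc_pred numeral_2_eq_2 power_Suc2 less_eq_Suc_le)
    then show "(real (m choose d) / real m ^ d) * (real m ^ (d - 1) * (\<integral>X. integrand m X \<partial>PiM I (\<lambda>_. uniform_sphere))) = Ev m / real m"
      by (simp add: Ev_def)
  qed
  finally have "convergent (\<lambda>m. (expected_facets_P1 TYPE(real ^ 'n) m - Ev m) / real m + Ev m / real m)"
    by (intro convergent_add c1)
  then show ?thesis by (simp add: diff_divide_distrib)
qed

end

subsection \<open>The bound for random vertex subsets\<close>

lemma convergent_expected_facets_P1:
  assumes d: "2 \<le> CARD('n::finite)"
  shows "(\<lambda>m. expected_facets_P1 TYPE(real ^ 'n) m / real m) \<longlonglongrightarrow> facet_constant TYPE(real ^ 'n)"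
proof -
  obtain f :: "'n \<Rightarrow> nat" where f: "bij_betw f UNIV {..<CARD('n)}"
    using finite_same_card_bij[of "UNIV :: 'n set" "{..<CARD('n)}"] by auto
  have "0 \<in> range f" using f d by (auto simp: bij_betw_def)
  then obtain k0 where k0: "f k0 = 0" by (metis imageE)
  interpret first_point_fixed f k0 "CARD('n)" "axis k0 1 :: real ^ 'n"
    by unfold_locales (use d f k0 in auto)
  show ?thesis unfolding facet_constant_def using convergent_expected_facets by (rule convergent_LIMSEQ_iff[THEN iffD1])
qed

text \<open>For a fixed sample the bound is linear in the number of vertices of the dual. This is
  the number of facets of the sample hull, so integrating over the sample produces
  \<open>expected_facets_P1\<close>.\<close>

lemma expected_facets_P2_le:
  fixes q B C \<theta> :: real and A :: "(real ^ 'n::finite) set"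
  defines "d \<equiv> CARD('n)"
  assumes d: "2 \<le> CARD('n)" and q: "0 \<le> q" "q \<le> 1" "8 * (real d - 1) * q < 1"
    and B: "\<And>k. 4 * (real d * real k) ^ d \<le> B * 2 ^ k"
    and C: "\<And>n. (real n + 1) ^ d * ((1 + q) / root (d + 1) 2) ^ n \<le> C"
    and A: "finite A" "\<And>u. norm u = 1 \<Longrightarrow> \<exists>a\<in>A. norm (u - a) < 1 / 2"
    and \<theta>: "measure (sphere_sample m) {X \<in> space (sphere_sample m). sparse m A X} \<le> real (card A) * \<theta> ^ m"
  shows "expected_facets_P2 TYPE(real ^ 'n) m (1 - q) \<le> real m
      + expected_facets_P1 TYPE(real ^ 'n) m * ((1 - q) ^ d * (q + (8 * (real d - 1) * q)\<^sup>2 * B / (1 - 8 * (real d - 1) * q)))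
      + C + ((real m + 1) ^ d + 1) ^ d * (real (card A) * \<theta> ^ m)"
proof -
  interpret S: prob_space "sphere_sample m :: (nat \<Rightarrow> real ^ 'n) measure" by (rule prob_space_sphere_sample)
  define w where "w = (1 - q) ^ d * (q + (8 * (real d - 1) * q)\<^sup>2 * B / (1 - 8 * (real d - 1) * q))"
  have B0: "0 \<le> B" using B[of 0] d by (simp add: d_def power_0_left)
  have C0: "0 \<le> C" using C[of 0] by simp
  have w0: "0 \<le> w" using q B0 unfolding w_def by (intro mult_nonneg_nonneg add_nonneg_nonneg divide_nonneg_nonneg) auto
  let ?B = "{X \<in> space (sphere_sample m). sparse m A X}"
  let ?f = "\<lambda>X :: nat \<Rightarrow> real ^ 'n. real (num_facets (sample_hull m X))"
  let ?R = "((real m + 1) ^ d + 1) ^ d"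
  have BS [measurable]: "?B \<in> sets (sphere_sample m)" using pred_sparse[OF A(1)] by measurable
  define g where "g X = real m + ?f X * w + C + ?R * indicator ?B X" for X
  have i1: "integrable (sphere_sample m) (\<lambda>X. ?f X * w)" by (intro integrable_mult_left integrable_num_facets)
  have i2: "integrable (sphere_sample m) (\<lambda>X. ?R * indicator ?B X)"
    by (intro integrable_mult_right integrable_real_indicator BS) (simp add: S.emeasure_eq_measure)
  have int: "integrable (sphere_sample m) g"
    unfolding g_def by (intro Bochner_Integration.integrable_add i1 i2) simp_all
  have "expected_facets_P2 TYPE(real ^ 'n) m (1 - q) \<le> (\<integral>X. g X \<partial>sphere_sample m)"
    unfolding expected_facets_P2_def
  \<comment> \<open>Only the majorant has to be integrable. If the inner expectation were not, its
    integral would be 0 by convention, which is why \<open>g\<close> is also shown to be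
    nonnegative.\<close>
  proof (rule integral_mono_AE'[OF int])
    show "AE X in sphere_sample m. measure_pmf.expectation (vertex_subset_hull (dual_polytope (sample_hull m X)) (1 - q)) (\<lambda>Q. real (num_facets Q)) \<le> g X"
      using AE_general_position[OF d, of m] AE_sphere_sample_norm AE_space
    proof eventually_elim
      case (elim X)
      interpret general_position X m by (rule elim(1))
      have f0: "0 \<le> ?f X * w" using w0 by simp
      show ?case
      proof (cases "sparse m A X")
        case True
        have "measure_pmf.expectation (vertex_subset_hull K (1 - q)) (\<lambda>Q. real (num_facets Q)) \<le> ?R"
          using expectation_num_facets_crude[of "1 - q"] by (simp add: d_def)
        also have "\<dots> \<le> g X" using True elim(3) f0 C0 by (simp add: g_def)
        finally show ?thesis by (simp add: K_def)
      next
        case False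
        interpret bounded_dual X m
          by (rule bounded_dual_if_not_sparse[OF elim(1) _ A(2) False]) (use elim(2) in auto)
        have "measure_pmf.expectation (vertex_subset_hull K (1 - q)) (\<lambda>Q. real (num_facets Q))
          \<le> real m + real (card V) * (1 - q) ^ DIM(real ^ 'n)
            * (q + (8 * (real DIM(real ^ 'n) - 1) * q)\<^sup>2 * B / (1 - 8 * (real DIM(real ^ 'n) - 1) * q)) + C"
          using d q B C unfolding d_def by (intro expectation_num_facets_le) auto
        also have "\<dots> = real m + real (card V) * w + C" by (simp add: w_def d_def)
        also have "\<dots> \<le> g X" using False by (simp add: g_def num_facets_sample_hull)
        finally show ?thesis by (simp add: K_def)
      qed
    qed
    show "AE X in sphere_sample m. 0 \<le> g X" using w0 C0 by (simp add: g_def)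
  qed
  also have "\<dots> = real m + expected_facets_P1 TYPE(real ^ 'n) m * w + C + ?R * measure (sphere_sample m) ?B"
    unfolding g_def expected_facets_P1_def using i1 i2 S.prob_space by simp
  also have "\<dots> \<le> real m + expected_facets_P1 TYPE(real ^ 'n) m * w + C + ?R * (real (card A) * \<theta> ^ m)"
    by (intro add_left_mono mult_left_mono \<theta>) simp
  finally show ?thesis by (simp only: w_def)
qed

text \<open>Since \<open>d + 1 <= 3 * (d - 1)\<close>, the hypothesis gives
  \<open>(d + 1) * q < 3 / 8\<close>, which is below \<open>ln 2\<close>, while
  \<open>(1 + q) ^ (d + 1)\<close> is at most \<open>exp ((d + 1) * q)\<close>.\<close>

lemma chernoff_base_less_1:
  fixes q :: real
  assumes d: "2 \<le> d" and q: "0 \<le> q" "8 * (real d - 1) * q < 1"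
  shows "(1 + q) / root (d + 1) 2 < 1"
proof -
  define u where "u = (real d - 1) * q"
  have "8 * u < 1" using q(2) by (simp only: u_def mult.assoc)
  have "(real d + 1) * q \<le> 3 * (real d - 1) * q" using d q by (intro mult_right_mono) auto
  also have "\<dots> = 3 * u" by (simp only: u_def mult.assoc)
  also have "\<dots> < 2 / 3" using \<open>8 * u < 1\<close> by simp
  also have "\<dots> \<le> ln 2" by (rule ln2_ge_two_thirds)
  finally have "exp ((real d + 1) * q) < 2" by (metis exp_less_cancel_iff exp_ln zero_less_numeral)
  moreover have "(1 + q) ^ (d + 1) \<le> exp q ^ (d + 1)" using q by (intro power_mono exp_ge_add_one_self) auto
  moreover have "exp q ^ (d + 1) = exp ((real d + 1) * q)" by (subst exp_of_nat_mult[symmetric]) (simp add: add.commute)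
  ultimately have "(1 + q) ^ (d + 1) < 2" by simp
  then have "root (d + 1) ((1 + q) ^ (d + 1)) < root (d + 1) 2" by (subst real_root_less_iff) auto
  then have "1 + q < root (d + 1) 2" using q by (subst (asm) real_root_power_cancel) auto
  then show ?thesis using q by (simp add: divide_less_eq)
qed

theorem theorem2:
  fixes d :: nat
  assumes "d = CARD('n::finite)" and "2 \<le> d"
  shows "\<exists>C::real. \<forall>p::real. 0 \<le> p \<and> p \<le> 1 \<and> p > 1 - 1 / (8 * (real d - 1)) \<longrightarrow>
    (let q = 1 - p in
      Limsup sequentially
        (\<lambda>m. ereal (expected_facets_P2 TYPE(real ^ 'n) m p / real m))
      \<le> ereal (1 + facet_constant TYPE(real ^ 'n) * p ^ d * q *
                   (1 + C * q / (1 - 8 * (real d - 1) * q))))"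
proof -
  have d: "2 \<le> CARD('n)" using assms by simp
  obtain B0 where B0: "\<And>n::nat. (real n + 1) ^ d * (1 / 2) ^ n \<le> B0"
    using poly_geometric_bounded[of "1 / 2" d] by auto
  \<comment> \<open>Depends on \<open>d\<close> only, as it must, since it enters the constant that
    is chosen before \<open>p\<close>.\<close>
  define B where "B = 4 * real d ^ d * B0"
  have B: "4 * (real d * real k) ^ d \<le> B * 2 ^ k" for k
  proof -
    have "real k ^ d \<le> (real k + 1) ^ d" by (intro power_mono) auto
    also have "\<dots> \<le> B0 * 2 ^ k" using B0[of k] by (simp add: power_one_over field_simps)
    finally have "4 * real d ^ d * real k ^ d \<le> 4 * real d ^ d * (B0 * 2 ^ k)" by (intro mult_left_mono) auto
    then show ?thesis by (simp add: B_def power_mult_distrib mult_ac)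
  qed
  obtain A :: "(real ^ 'n) set" where A: "finite A" "A \<subseteq> sphere 0 1" "\<And>u. norm u = 1 \<Longrightarrow> \<exists>a\<in>A. norm (u - a) < 1 / 2"
    by (rule finite_sphere_net) (rule that)
  obtain \<theta> where \<theta>: "0 \<le> \<theta>" "\<theta> < 1"
    "\<And>m. measure (sphere_sample m) {X \<in> space (sphere_sample m). sparse m A X} \<le> real (card A) * \<theta> ^ m"
    by (rule prob_sparse_le[OF d A(1,2)]) (rule that)
  show ?thesis
  proof (intro exI[of _ "64 * (real d - 1)\<^sup>2 * B"] allI impI)
    fix p :: real
    assume p: "0 \<le> p \<and> p \<le> 1 \<and> p > 1 - 1 / (8 * (real d - 1))"
    define q where "q = 1 - p"
    have "q < 1 / (8 * (real d - 1))" using p by (simp add: q_def)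
    then have q: "0 \<le> q" "q \<le> 1" "8 * (real d - 1) * q < 1"
      using p assms(2) by (auto simp: q_def field_simps)
    have pq: "p = 1 - q" by (simp add: q_def)
    have \<rho>: "0 \<le> (1 + q) / root (d + 1) 2" "(1 + q) / root (d + 1) 2 < 1"
      using q chernoff_base_less_1[OF assms(2) q(1,3)] by auto
    \<comment> \<open>This constant depends on \<open>q\<close>, which is harmless: it is divided by
      \<open>m\<close> and disappears in the limit.\<close>
    obtain C where C: "\<And>n::nat. (real n + 1) ^ d * ((1 + q) / root (d + 1) 2) ^ n \<le> C"
      using poly_geometric_bounded[OF \<rho>] by metis
    define w where "w = (1 - q) ^ d * (q + (8 * (real d - 1) * q)\<^sup>2 * B / (1 - 8 * (real d - 1) * q))"
    define E where "E m = expected_facets_P1 TYPE(real ^ 'n) m" for m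
    define b where "b m = 1 + E m / real m * w + C * (1 / real m)
      + 2 ^ d * real (card A) * ((real m + 1) ^ (d * d) * \<theta> ^ m) * (1 / real m)" for m
    have le: "expected_facets_P2 TYPE(real ^ 'n) m p / real m \<le> b m" if m: "m \<ge> 1" for m
    proof -
      have "1 \<le> (real m + 1) ^ d" by (rule one_le_power) simp
      then have "((real m + 1) ^ d + 1) ^ d \<le> (2 * (real m + 1) ^ d) ^ d" by (intro power_mono) auto
      also have "\<dots> = 2 ^ d * (real m + 1) ^ (d * d)" by (simp add: power_mult_distrib power_mult)
      finally have R: "((real m + 1) ^ d + 1) ^ d * (real (card A) * \<theta> ^ m)
          \<le> 2 ^ d * (real m + 1) ^ (d * d) * (real (card A) * \<theta> ^ m)"
        using \<theta>(1) by (intro mult_right_mono) auto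
      have "expected_facets_P2 TYPE(real ^ 'n) m p \<le> real m + E m * w + C + ((real m + 1) ^ d + 1) ^ d * (real (card A) * \<theta> ^ m)"
        using expected_facets_P2_le[OF d, of q B C A m \<theta>] q B C A \<theta>(3) unfolding pq w_def E_def assms(1)[symmetric] by blast
      also have "\<dots> \<le> real m + E m * w + C + 2 ^ d * (real m + 1) ^ (d * d) * (real (card A) * \<theta> ^ m)"
        using R by simp
      finally have "expected_facets_P2 TYPE(real ^ 'n) m p / real m
        \<le> (real m + E m * w + C + 2 ^ d * (real m + 1) ^ (d * d) * (real (card A) * \<theta> ^ m)) / real m"
        by (intro divide_right_mono) auto
      also have "\<dots> = b m" using m by (simp add: b_def add_divide_distrib mult_ac)
      finally show ?thesis .
    qed
    have "b \<longlonglongrightarrow> 1 + facet_constant TYPE(real ^ 'n) * w + C * 0 + 2 ^ d * real (card A) * 0 * 0"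
      unfolding b_def[abs_def] E_def
      by (intro tendsto_add tendsto_mult tendsto_const convergent_expected_facets_P1[OF d] lim_1_over_n
          poly_geometric_tendsto_0 \<theta>)
    then have "(\<lambda>m. ereal (b m)) \<longlonglongrightarrow> ereal (1 + facet_constant TYPE(real ^ 'n) * w)" by simp
    then have "Limsup sequentially (\<lambda>m. ereal (b m)) = ereal (1 + facet_constant TYPE(real ^ 'n) * w)"
      by (intro lim_imp_Limsup) auto
    moreover have "Limsup sequentially (\<lambda>m. ereal (expected_facets_P2 TYPE(real ^ 'n) m p / real m)) \<le> Limsup sequentially (\<lambda>m. ereal (b m))"
      using le by (intro Limsup_mono eventually_sequentiallyI[of 1]) auto
    moreover have "w = p ^ d * q * (1 + 64 * (real d - 1)\<^sup>2 * B * q / (1 - 8 * (real d - 1) * q))"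
      unfolding w_def pq by (simp add: power2_eq_square algebra_simps)
    ultimately show "let q = 1 - p in
      Limsup sequentially (\<lambda>m. ereal (expected_facets_P2 TYPE(real ^ 'n) m p / real m))
      \<le> ereal (1 + facet_constant TYPE(real ^ 'n) * p ^ d * q *
           (1 + 64 * (real d - 1)\<^sup>2 * B * q / (1 - 8 * (real d - 1) * q)))"
      unfolding Let_def q_def[symmetric] by (simp add: mult.assoc)
  qed
qed

end
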